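(* Let $\mathcal M$ be a von Neumann algebra with a normal faithful finite trace $\tau$, let $\mathcal T=(T_t)_{t\ge 0}$ be a quantum Markov semigroup on $\mathcal M$, and let $\mathcal P=(P_t)_{t\ge0}$ be its subordinated Poisson semigroup. Assume that $(T_t)_{t\ge0}$ is quasi-monotone, and let $0<\alpha<1$. Then there is a constant $C>0$, independent of $f$, such that for all $f\in\mathcal M$: (i) $\|f\|_{\mathcal L^c_\alpha(\mathcal P)}\le C\|f\|_{\mathcal L^c_{\alpha/2}(\mathcal T)}$; (ii) $\|f\|_{\Lambda_\alpha(\mathcal P)}\le C\|f\|_{\Lambda_{\alpha/2}(\mathcal T)}$; (iii) if moreover $(T_t)_{t\ge0}$ has the $\Gamma^2\ge0$ property, $\|f\|_{\ell^c_{\alpha/2}(\mathcal T)}\le C\|f\|_{\ell^c_\alpha(\mathcal P)}$.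
   Context: Notation: $\|\cdot\|_\infty$ is the operator norm of $\mathcal M$, $\mathcal M_+$ its positive cone, $|x|^2=x^*x$. Norms of general $f\in\mathcal M$ are allowed to be $+\infty$. A (quantum) Markov semigroup on $(\mathcal M,\tau)$ is a family $(T_t)_{t\ge0}$ of operators on $\mathcal M$ with $T_tT_s=T_{t+s}$, $T_0=\mathrm{id}$, such that every $T_t$ is normal, completely positive and unital ($T_t(1)=1$); $\tau(T_t(f^* )g)=\tau(f^*T_t(g))$ for all $f,g\in\mathcal M\cap L^2(\mathcal M)$; and $T_t(f)\to f$ in the weak-$*$ topology as $t\to0^+$ for all $f\in\mathcal M$. Its generator is $A=\lim_{t\to0}\frac{\mathrm{id}-T_t}{t}$, so $T_t=e^{-tA}$, with weak-$*$ domain $\mathrm{dom}_\infty(A)=\{f\in\mathcal M:\lim_{t\to0}\frac{f-T_tf}{t}\text{ exists weak-}*\}$. By convention $T_sf\in\mathrm{dom}_\infty(A)$ for every $s>0$, $f\in\mathcal M$. The subordinated Poisson semigroup is $P_t=e^{-t\sqrt A}$, i.e. $P_0=\mathrm{id}$ and $P_t=\frac{1}{2\sqrt\pi}\int_0^\infty t e^{-t^2/(4u)}u^{-3/2}T_u\,du$ for $t>0$. Quasi-monotone: $(T_t)_{t\ge0}$ is quasi-decreasing (resp. quasi-increasing) if there is $\beta\ge0$ such that $\frac{T_t(f)}{t^\beta}\ge\frac{T_s(f)}{s^\beta}$ (resp. $\frac{T_t(f)}{t^\beta}\le\frac{T_s(f)}{s^\beta}$) for all $f\in\mathcal M_+$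 and $s>t>0$; it is quasi-monotone if it is quasi-decreasing or quasi-increasing. Norms. For $\mathcal S=(S_t)_{t\ge0}$ equal to $\mathcal T$ or $\mathcal P$, $0<\alpha<1$ and $f\in\mathcal M$: $\|f\|_{\mathcal L^c_\alpha(\mathcal S)}=\|f\|_\infty+\sup_{t>0}\frac1{t^\alpha}\big\|S_t|f-S_tf|^2\big\|_\infty^{1/2}$; $\|f\|_{\ell^c_\alpha(\mathcal S)}=\|f\|_\infty+\sup_{t>0}\frac1{t^\alpha}\big\|S_t|f|^2-|S_tf|^2\big\|_\infty^{1/2}$; $\|f\|_{\Lambda_\alpha(\mathcal S)}=\|f\|_\infty+\sup_{t>0}\frac1{t^{\alpha-1}}\big\|\frac{\partial S_tf}{\partial t}\big\|_\infty$. The condition $\Gamma^2\ge0$: the gradient form is $2\Gamma(f,g)=(Af^* )g+f^*(Ag)-A(f^*g)$, $\Gamma(f)=\Gamma(f,f)$, and the iterated form is $2\Gamma^2(f,g)=\Gamma(Af,g)+\Gamma(f,Ag)-A\Gamma(f,g)$. "$\Gamma^2\ge0$" means $\Gamma^2(f,f)\ge0$ for all nice $f$, equivalently (and this is the precise form to be used) $T_r\Gamma(T_{s+t}f)\le T_{r+t}\Gamma(T_sf)$ for all $r,s,t>0$ and $f\in\mathcal M$, where $2T_u\Gamma(T_vf)$ is read as $T_u((AT_vf^* )(T_vf))+T_u((T_vf^* )(AT_vf))-AT_u((T_vf^* )(T_vf))$. *)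

theory Defs
  imports "HOL-Analysis.Analysis"
begin

section \<open>Complex Hilbert spaces and bounded operators\<close>

text \<open>The inner product is linear in the first variable. Since the root of a negative
  real is negative in HOL, the last axiom also makes the form positive definite.\<close>

class chilbert_space = banach +
  fixes scaleC :: "complex \<Rightarrow> 'a \<Rightarrow> 'a" (infixr "*\<^sub>C" 75)
    and cinner :: "'a \<Rightarrow> 'a \<Rightarrow> complex"
  assumes scaleC_add_right: "c *\<^sub>C (x + y) = c *\<^sub>C x + c *\<^sub>C y"
    and scaleC_add_left: "(c + d) *\<^sub>C x = c *\<^sub>C x + d *\<^sub>C x"
    and scaleC_scaleC: "c *\<^sub>C d *\<^sub>C x = (c * d) *\<^sub>C x"
    and scaleC_of_real: "complex_of_real r *\<^sub>C x = r *\<^sub>R x"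
    and cinner_commute: "cinner x y = cnj (cinner y x)"
    and cinner_add_left: "cinner (x + y) z = cinner x z + cinner y z"
    and cinner_scaleC_left: "cinner (c *\<^sub>C x) y = c * cinner x y"
    and norm_eq_sqrt_cinner: "norm x = sqrt (Re (cinner x x))"

text \<open>Operators are elements of the library type of real-linear bounded operators, whose norm
  is the operator norm; \<open>B(H)\<close> consists of the complex-linear ones among them.\<close>

type_synonym 'h oper = "'h \<Rightarrow>\<^sub>L 'h"

definition bounded_ops :: "'h::chilbert_space oper set" where
  "bounded_ops = {a. \<forall>c x. blinfun_apply a (c *\<^sub>C x) = c *\<^sub>C blinfun_apply a x}"

definition scale_op :: "complex \<Rightarrow> 'h::chilbert_space oper \<Rightarrow> 'h oper" where
  "scale_op c a = Blinfun (\<lambda>x. c *\<^sub>C blinfun_apply a x)"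

definition adj_op :: "'h::chilbert_space oper \<Rightarrow> 'h oper" where
  "adj_op a = (THE b. \<forall>x y. cinner (blinfun_apply a x) y = cinner x (blinfun_apply b y))"

definition abs_sq :: "'h::chilbert_space oper \<Rightarrow> 'h oper" where
  "abs_sq a = adj_op a o\<^sub>L a"

definition positive_op :: "'h::chilbert_space oper \<Rightarrow> bool" where
  "positive_op a \<longleftrightarrow> (\<forall>x. cinner (blinfun_apply a x) x \<in> \<real>\<^sub>\<ge>\<^sub>0)"

definition le_op :: "'h::chilbert_space oper \<Rightarrow> 'h oper \<Rightarrow> bool" (infix "\<preceq>" 50) where
  "a \<preceq> b \<longleftrightarrow> positive_op (b - a)"

lemma blinfun_apply_scale_op: "blinfun_apply (scale_op c a) x = c *\<^sub>C blinfun_apply a x"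
proof -
  have norm_scaleC: "norm (c *\<^sub>C y) = cmod c * norm y" for y :: 'a
  proof -
    have r: "cinner y y = complex_of_real (Re (cinner y y))"
      using cinner_commute[of y y] by (simp add: complex_eq_iff)
    have "cinner (c *\<^sub>C y) (c *\<^sub>C y) = c * cnj (c * cinner y y)"
      by (metis cinner_commute cinner_scaleC_left)
    also have "\<dots> = (c * cnj c) * cinner y y"
      by (subst (1 2) r) simp
    also have "\<dots> = complex_of_real ((cmod c)\<^sup>2 * Re (cinner y y))"
      by (subst r) (simp only: complex_norm_square[symmetric] of_real_mult)
    finally show ?thesis
      by (simp add: norm_eq_sqrt_cinner real_sqrt_mult)
  qed
  have "bounded_linear (\<lambda>y. c *\<^sub>C y :: 'a)"
  proof
    fix r and x y :: 'a
    show "c *\<^sub>C (x + y) = c *\<^sub>C x + c *\<^sub>C y" by (rule scaleC_add_right)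
    show "c *\<^sub>C r *\<^sub>R x = r *\<^sub>R c *\<^sub>C x"
      by (simp add: scaleC_of_real[symmetric] scaleC_scaleC mult.commute)
    show "\<exists>K. \<forall>x::'a. norm (c *\<^sub>C x) \<le> norm x * K"
      by (auto simp: norm_scaleC intro!: exI[of _ "cmod c"])
  qed
  then have "bounded_linear (\<lambda>x. c *\<^sub>C blinfun_apply a x)"
    by (rule bounded_linear_compose) (rule blinfun.bounded_linear_right)
  then show ?thesis
    by (simp add: scale_op_def bounded_linear_Blinfun_apply)
qed


section \<open>Von Neumann algebras\<close>

definition commutant :: "'h::chilbert_space oper set \<Rightarrow> 'h oper set" where
  "commutant S = {b \<in> bounded_ops. \<forall>a\<in>S. a o\<^sub>L b = b o\<^sub>L a}"

text \<open>The equation \<open>M'' = M\<close> makes \<open>M\<close> a unital complex subalgebra of \<open>B(H)\<close>.\<close>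

definition von_neumann_algebra :: "'h::chilbert_space oper set \<Rightarrow> bool" where
  "von_neumann_algebra M \<longleftrightarrow>
     M \<subseteq> bounded_ops \<and> (\<forall>a\<in>M. adj_op a \<in> M) \<and> commutant (commutant M) = M"

definition l2_seq :: "(nat \<Rightarrow> 'h::chilbert_space) \<Rightarrow> bool" where
  "l2_seq \<xi> \<longleftrightarrow> summable (\<lambda>n. (norm (\<xi> n))\<^sup>2)"

definition vec_functional ::
    "(nat \<Rightarrow> 'h::chilbert_space) \<Rightarrow> (nat \<Rightarrow> 'h) \<Rightarrow> 'h oper \<Rightarrow> complex" where
  "vec_functional \<xi> \<eta> a = (\<Sum>n. cinner (blinfun_apply a (\<xi> n)) (\<eta> n))"

text \<open>The functionals \<open>vec_functional \<xi> \<eta>\<close> with square-summable \<open>\<xi>\<close> and \<open>\<eta>\<close> are those of the predual of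
  \<open>M\<close>; the weak-* topology is the coarsest topology on \<open>M\<close> making them continuous.\<close>

definition weak_star :: "'h::chilbert_space oper set \<Rightarrow> 'h oper topology" where
  "weak_star M = topology_generated_by
     {{a \<in> M. vec_functional \<xi> \<eta> a \<in> U} | \<xi> \<eta> U. l2_seq \<xi> \<and> l2_seq \<eta> \<and> open U}"

definition weak_star_integral ::
    "'h::chilbert_space oper set \<Rightarrow> 'b measure \<Rightarrow> ('b \<Rightarrow> 'h oper) \<Rightarrow> 'h oper" where
  "weak_star_integral M \<mu> g = (THE b. b \<in> M \<and>
     (\<forall>\<xi> \<eta>. l2_seq \<xi> \<and> l2_seq \<eta> \<longrightarrow>
        has_bochner_integral \<mu> (\<lambda>u. vec_functional \<xi> \<eta> (g u)) (vec_functional \<xi> \<eta> b)))"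

text \<open>A finite trace is given by its linear extension from the positive cone to all of \<open>M\<close>.\<close>

definition normal_faithful_finite_trace ::
    "'h::chilbert_space oper set \<Rightarrow> ('h oper \<Rightarrow> complex) \<Rightarrow> bool" where
  "normal_faithful_finite_trace M \<tau> \<longleftrightarrow>
     (\<forall>a\<in>M. \<forall>b\<in>M. \<tau> (a + b) = \<tau> a + \<tau> b) \<and>
     (\<forall>c. \<forall>a\<in>M. \<tau> (scale_op c a) = c * \<tau> a) \<and>
     (\<forall>a\<in>M. positive_op a \<longrightarrow> \<tau> a \<in> \<real>\<^sub>\<ge>\<^sub>0) \<and>
     (\<forall>a\<in>M. \<forall>b\<in>M. \<tau> (a o\<^sub>L b) = \<tau> (b o\<^sub>L a)) \<and>
     (\<forall>a\<in>M. positive_op a \<and> \<tau> a = 0 \<longrightarrow> a = 0) \<and>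
     continuous_map (weak_star M) euclidean \<tau>"


section \<open>Quantum Markov semigroups\<close>

text \<open>Positivity of the matrix \<open>(a i j)\<close>, \<open>i, j < n\<close>, as an operator on the \<open>n\<close>-fold direct sum
  of the Hilbert space.\<close>

definition positive_matrix :: "nat \<Rightarrow> (nat \<Rightarrow> nat \<Rightarrow> 'h::chilbert_space oper) \<Rightarrow> bool" where
  "positive_matrix n a \<longleftrightarrow>
     (\<forall>\<xi>. (\<Sum>i<n. \<Sum>j<n. cinner (blinfun_apply (a i j) (\<xi> j)) (\<xi> i)) \<in> \<real>\<^sub>\<ge>\<^sub>0)"

definition completely_positive ::
    "'h::chilbert_space oper set \<Rightarrow> ('h oper \<Rightarrow> 'h oper) \<Rightarrow> bool" where
  "completely_positive M \<Phi> \<longleftrightarrow>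
     (\<forall>n a. (\<forall>i<n. \<forall>j<n. a i j \<in> M) \<and> positive_matrix n a \<longrightarrow>
        positive_matrix n (\<lambda>i j. \<Phi> (a i j)))"

text \<open>Since \<open>\<tau>\<close> is finite, \<open>M\<close> is contained in \<open>L\<^sup>2\<close>, so the symmetry condition ranges over
  all of \<open>M\<close>.\<close>

definition markov_semigroup ::
    "'h::chilbert_space oper set \<Rightarrow> ('h oper \<Rightarrow> complex) \<Rightarrow> (real \<Rightarrow> 'h oper \<Rightarrow> 'h oper) \<Rightarrow> bool"
  where
  "markov_semigroup M \<tau> T \<longleftrightarrow>
     (\<forall>t\<ge>0. (\<forall>f\<in>M. T t f \<in> M) \<and>
        (\<forall>f\<in>M. \<forall>g\<in>M. T t (f + g) = T t f + T t g) \<and>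
        (\<forall>c. \<forall>f\<in>M. T t (scale_op c f) = scale_op c (T t f))) \<and>
     (\<forall>f\<in>M. T 0 f = f) \<and>
     (\<forall>t\<ge>0. \<forall>s\<ge>0. \<forall>f\<in>M. T t (T s f) = T (t + s) f) \<and>
     (\<forall>t\<ge>0. continuous_map (weak_star M) (weak_star M) (T t)) \<and>
     (\<forall>t\<ge>0. completely_positive M (T t)) \<and>
     (\<forall>t\<ge>0. T t id_blinfun = id_blinfun) \<and>
     (\<forall>t\<ge>0. \<forall>f\<in>M. \<forall>g\<in>M. \<tau> (T t (adj_op f) o\<^sub>L g) = \<tau> (adj_op f o\<^sub>L T t g)) \<and>
     (\<forall>f\<in>M. limitin (weak_star M) (\<lambda>t. T t f) f (at_right 0))"

definition dom_inf ::
    "'h::chilbert_space oper set \<Rightarrow> (real \<Rightarrow> 'h oper \<Rightarrow> 'h oper) \<Rightarrow> 'h oper set" where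
  "dom_inf M T =
     {f \<in> M. \<exists>g. limitin (weak_star M) (\<lambda>t. (1 / t) *\<^sub>R (f - T t f)) g (at_right 0)}"

definition generator ::
    "'h::chilbert_space oper set \<Rightarrow> (real \<Rightarrow> 'h oper \<Rightarrow> 'h oper) \<Rightarrow> 'h oper \<Rightarrow> 'h oper" where
  "generator M T f =
     (THE g. limitin (weak_star M) (\<lambda>t. (1 / t) *\<^sub>R (f - T t f)) g (at_right 0))"

definition poisson ::
    "'h::chilbert_space oper set \<Rightarrow> (real \<Rightarrow> 'h oper \<Rightarrow> 'h oper) \<Rightarrow> real \<Rightarrow> 'h oper \<Rightarrow> 'h oper"
  where
  "poisson M T t f =
     (if t = 0 then f
      else weak_star_integral M (restrict_space lborel {0<..})
        (\<lambda>u. (1 / (2 * sqrt pi) * (t * exp (- t\<^sup>2 / (4 * u)) * u powr (- 3 / 2))) *\<^sub>R T u f))"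

definition quasi_decreasing ::
    "'h::chilbert_space oper set \<Rightarrow> (real \<Rightarrow> 'h oper \<Rightarrow> 'h oper) \<Rightarrow> bool" where
  "quasi_decreasing M T \<longleftrightarrow>
     (\<exists>\<beta>\<ge>0. \<forall>f\<in>M. \<forall>s t. positive_op f \<and> s > t \<and> t > 0 \<longrightarrow>
        (1 / s powr \<beta>) *\<^sub>R T s f \<preceq> (1 / t powr \<beta>) *\<^sub>R T t f)"

definition quasi_increasing ::
    "'h::chilbert_space oper set \<Rightarrow> (real \<Rightarrow> 'h oper \<Rightarrow> 'h oper) \<Rightarrow> bool" where
  "quasi_increasing M T \<longleftrightarrow>
     (\<exists>\<beta>\<ge>0. \<forall>f\<in>M. \<forall>s t. positive_op f \<and> s > t \<and> t > 0 \<longrightarrow>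
        (1 / t powr \<beta>) *\<^sub>R T t f \<preceq> (1 / s powr \<beta>) *\<^sub>R T s f)"

definition quasi_monotone ::
    "'h::chilbert_space oper set \<Rightarrow> (real \<Rightarrow> 'h oper \<Rightarrow> 'h oper) \<Rightarrow> bool" where
  "quasi_monotone M T \<longleftrightarrow> quasi_decreasing M T \<or> quasi_increasing M T"

text \<open>\<open>two_T_Gamma_T M T u v f\<close> is \<open>2 T\<^sub>u \<Gamma>(T\<^sub>v f)\<close>, read with the generator outside \<open>T\<^sub>u\<close> in the last
  term, because \<open>|T\<^sub>v f|\<^sup>2\<close> itself need not lie in the domain of the generator.\<close>

definition two_T_Gamma_T ::
    "'h::chilbert_space oper set \<Rightarrow> (real \<Rightarrow> 'h oper \<Rightarrow> 'h oper) \<Rightarrow> real \<Rightarrow> real \<Rightarrow> 'h oper \<Rightarrow> 'h oper"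
  where
  "two_T_Gamma_T M T u v f =
     T u (generator M T (T v (adj_op f)) o\<^sub>L T v f)
     + T u (T v (adj_op f) o\<^sub>L generator M T (T v f))
     - generator M T (T u (T v (adj_op f) o\<^sub>L T v f))"

definition Gamma2_nonneg ::
    "'h::chilbert_space oper set \<Rightarrow> (real \<Rightarrow> 'h oper \<Rightarrow> 'h oper) \<Rightarrow> bool" where
  "Gamma2_nonneg M T \<longleftrightarrow>
     (\<forall>r>0. \<forall>s>0. \<forall>t>0. \<forall>f\<in>M.
        (1 / 2) *\<^sub>R two_T_Gamma_T M T r (s + t) f \<preceq> (1 / 2) *\<^sub>R two_T_Gamma_T M T (r + t) s f)"


section \<open>Lipschitz norms\<close>

definition norm_Lc ::
    "real \<Rightarrow> (real \<Rightarrow> 'h::chilbert_space oper \<Rightarrow> 'h oper) \<Rightarrow> 'h oper \<Rightarrow> ennreal" where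
  "norm_Lc \<alpha> S f = ennreal (norm f)
     + (SUP t\<in>{0<..}. ennreal (1 / t powr \<alpha> * sqrt (norm (S t (abs_sq (f - S t f))))))"

definition norm_lc ::
    "real \<Rightarrow> (real \<Rightarrow> 'h::chilbert_space oper \<Rightarrow> 'h oper) \<Rightarrow> 'h oper \<Rightarrow> ennreal" where
  "norm_lc \<alpha> S f = ennreal (norm f)
     + (SUP t\<in>{0<..}. ennreal (1 / t powr \<alpha> * sqrt (norm (S t (abs_sq f) - abs_sq (S t f)))))"

definition weak_star_deriv ::
    "'h::chilbert_space oper set \<Rightarrow> (real \<Rightarrow> 'h oper) \<Rightarrow> real \<Rightarrow> 'h oper" where
  "weak_star_deriv M g t =
     (THE d. limitin (weak_star M) (\<lambda>h. (1 / h) *\<^sub>R (g (t + h) - g t)) d (at 0))"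

definition norm_Lambda ::
    "'h::chilbert_space oper set \<Rightarrow> real \<Rightarrow> (real \<Rightarrow> 'h oper \<Rightarrow> 'h oper) \<Rightarrow> 'h oper \<Rightarrow> ennreal" where
  "norm_Lambda M \<alpha> S f = ennreal (norm f)
     + (SUP t\<in>{0<..}.
          ennreal (1 / t powr (\<alpha> - 1) * norm (weak_star_deriv M (\<lambda>s. S s f) t)))"

end

theory Submission
  imports Defs "HOL-Probability.Distributions"
begin

text \<open>Substituting \<open>u = t\<^sup>2 v\<close> in the definition of the subordinated semigroup gives
  \<open>P\<^sub>t f = \<integral> \<kappa>(v) T\<^bsub>t\<^sup>2v\<^esub> f dv\<close> with one fixed probability density \<open>\<kappa>\<close> on the half-line
  (\<open>poisson_vec_functional\<close>). It decays like \<open>v\<^bsup>-3/2\<^esup>\<close>, so its moment of order \<open>\<alpha>/2 < 1/2\<close> is finite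
  (\<open>poisson_kernel_moment_integrable\<close>). A bound of order \<open>u\<^bsup>\<alpha>/2\<^esup>\<close> along the orbit of \<open>T\<close> therefore
  averages to a bound of order \<open>t\<^sup>\<alpha>\<close> for \<open>P\<close>; the first two comparisons are of this kind.

  For the \<open>L\<^sup>c\<close> norm, the Kadison-Schwarz inequality gives
  \<open>\<parallel>T\<^sub>t f - T\<^sub>2\<^sub>t f\<parallel>\<^sup>2 \<le> \<parallel>T\<^sub>t |f - T\<^sub>t f|\<^sup>2\<parallel>\<close>, so the norm for \<open>T\<close> controls the dyadic increments of the orbit.
  These form a geometric series, and \<open>T\<^sub>u f \<rightarrow> f\<close> in the weak-* topology then yields
  \<open>\<parallel>f - T\<^sub>u f\<parallel> \<le> C K u\<^bsup>\<alpha>/2\<^esup>\<close> (\<open>norm_diff_orbit_le\<close>). Averaging gives \<open>\<parallel>f - P\<^sub>t f\<parallel> \<le> C' K t\<^sup>\<alpha>\<close>, which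
  is more than needed because \<open>\<parallel>P\<^sub>t |g|\<^sup>2\<parallel> \<le> \<parallel>g\<parallel>\<^sup>2\<close>. For the \<open>\<Lambda>\<close> norm one differentiates under the integral:
  the factor \<open>2 t v\<close> of the chain rule and the bound \<open>K (t\<^sup>2 v)\<^bsup>\<alpha>/2 - 1\<^esup>\<close> combine to \<open>2 K t\<^bsup>\<alpha> - 1\<^esup> v\<^bsup>\<alpha>/2\<^esup>\<close>
  (\<open>poisson_derivative\<close>).

  For the \<open>l\<^sup>c\<close> norm put \<open>D\<^sub>u = T\<^sub>u |f|\<^sup>2 - |T\<^sub>u f|\<^sup>2\<close>, a positive operator. By convexity of \<open>g \<mapsto> |g|\<^sup>2\<close>,
  \<open>\<integral> \<kappa>(v) D\<^bsub>t\<^sup>2v\<^esub> dv \<le> P\<^sub>t |f|\<^sup>2 - |P\<^sub>t f|\<^sup>2\<close> (\<open>poisson_defect_ge\<close>). So it suffices that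
  \<open>D\<^sub>w \<le> C D\<^sub>w\<^sub>v\<close> for all \<open>v\<close> in a fixed compact interval, on which \<open>\<kappa>\<close> is bounded below
  (\<open>defect_comparison\<close>). Always \<open>T\<^sub>r D\<^sub>w \<le> D\<^bsub>r+w\<^esub>\<close>. If \<open>T\<close> is quasi-increasing, then
  \<open>T\<^sub>\<epsilon> D\<^sub>w \<le> T\<^sub>r D\<^sub>w\<close> for \<open>\<epsilon> < r\<close>, and \<open>\<epsilon> \<rightarrow> 0\<close> gives \<open>D\<^sub>w \<le> D\<^sub>u\<close> for \<open>w < u\<close>. If \<open>T\<close> is
  quasi-decreasing, consider \<open>p(s) = T\<^bsub>w-s\<^esub> |T\<^sub>s f|\<^sup>2\<close>: its derivative is \<open>- 2 T\<^bsub>w-s\<^esub> \<Gamma>(T\<^sub>s f)\<close>, and the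
  condition \<open>\<Gamma>\<^sup>2 \<ge> 0\<close> says that this increases, so that \<open>p\<close> is convex. Hence
  \<open>D\<^sub>w = p(0) - p(w) \<le> 2 (p(0) - p(w/2)) = 2 T\<^bsub>w/2\<^esub> D\<^bsub>w/2\<^esub>\<close>, and for \<open>u\<close> slightly smaller than \<open>w\<close>
  quasi-monotonicity replaces \<open>T\<^bsub>w/2\<^esub>\<close> by a multiple of \<open>T\<^bsub>u-w/2\<^esub>\<close>, which gives \<open>D\<^sub>w \<le> C D\<^sub>u\<close>.

  Generators, integrals and derivatives are defined in the weak-* topology, but \<open>T\<^sub>s f\<close> belongs to the
  domain of the generator for \<open>s > 0\<close>, and by uniform boundedness this makes \<open>u \<mapsto> T\<^sub>u f\<close> continuously
  differentiable in norm on the open half-line (\<open>orbit_has_vector_derivative\<close>). All limits that follow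
  can therefore be taken in norm or in scalar products.\<close>

section \<open>Geometry of complex Hilbert spaces\<close>

lemma cinner_add_right: "cinner x (y + z) = cinner x y + cinner x z"
  for x :: "'h::chilbert_space"
  by (metis cinner_commute cinner_add_left complex_cnj_add)

lemma cinner_scaleC_right: "cinner x (c *\<^sub>C y) = cnj c * cinner x y"
  for x :: "'h::chilbert_space"
  by (metis cinner_commute cinner_scaleC_left complex_cnj_mult)

lemma cinner_scaleR_left: "cinner (r *\<^sub>R x) y = complex_of_real r * cinner x y"
  for x :: "'h::chilbert_space"
  by (metis scaleC_of_real cinner_scaleC_left)

lemma cinner_scaleR_right: "cinner x (r *\<^sub>R y) = complex_of_real r * cinner x y"
  for x :: "'h::chilbert_space"
  by (metis scaleC_of_real cinner_scaleC_right complex_cnj_complex_of_real)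

lemma cinner_minus_left: "cinner (- x) y = - cinner x y"
  for x :: "'h::chilbert_space"
  using cinner_scaleR_left[of "-1" x y] by simp

lemma cinner_minus_right: "cinner x (- y) = - cinner x y"
  for x :: "'h::chilbert_space"
  using cinner_scaleR_right[of x "-1" y] by simp

lemma cinner_diff_left: "cinner (x - y) z = cinner x z - cinner y z"
  for x :: "'h::chilbert_space"
  using cinner_add_left[of x "-y" z] by (simp add: cinner_minus_left)

lemma cinner_diff_right: "cinner x (y - z) = cinner x y - cinner x z"
  for x :: "'h::chilbert_space"
  using cinner_add_right[of x y "-z"] by (simp add: cinner_minus_right)

lemma cinner_zero [simp]: "cinner 0 y = 0" "cinner y 0 = 0"
  for y :: "'h::chilbert_space"
  using cinner_diff_left[of 0 0 y] cinner_diff_right[of y 0 0] by simp_all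

lemmas cinner_simps = cinner_add_left cinner_add_right cinner_diff_left cinner_diff_right
  cinner_minus_left cinner_minus_right cinner_scaleC_left cinner_scaleC_right
  cinner_scaleR_left cinner_scaleR_right

lemma Re_cinner_self: "Re (cinner x x) = (norm x)\<^sup>2"
  for x :: "'h::chilbert_space"
proof -
  have "sqrt (Re (cinner x x)) \<ge> 0"
    by (simp flip: norm_eq_sqrt_cinner)
  then show ?thesis
    by (simp add: norm_eq_sqrt_cinner)
qed

lemma cinner_self: "cinner x x = complex_of_real ((norm x)\<^sup>2)"
  for x :: "'h::chilbert_space"
  using cinner_commute[of x x] Re_cinner_self[of x] by (simp add: complex_eq_iff)

lemma Re_cinner_commute: "Re (cinner x y) = Re (cinner y x)"
  for x :: "'h::chilbert_space"
  by (subst cinner_commute) simp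

lemma norm_add_sq: "(norm (x + y))\<^sup>2 = (norm x)\<^sup>2 + 2 * Re (cinner x y) + (norm y)\<^sup>2"
  for x :: "'h::chilbert_space"
  using Re_cinner_commute[of x y]
  by (simp add: Re_cinner_self[symmetric] cinner_simps)

lemma norm_diff_sq: "(norm (x - y))\<^sup>2 = (norm x)\<^sup>2 - 2 * Re (cinner x y) + (norm y)\<^sup>2"
  for x :: "'h::chilbert_space"
  using norm_add_sq[of x "-y"] by (simp add: cinner_minus_right)

lemma norm_scaleC: "norm (c *\<^sub>C x) = cmod c * norm x"
  for x :: "'h::chilbert_space"
proof -
  have "(norm (c *\<^sub>C x))\<^sup>2 = Re (c * cnj c * cinner x x)"
    by (simp only: Re_cinner_self[symmetric] cinner_scaleC_left cinner_scaleC_right mult.assoc)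
       (simp add: algebra_simps)
  also have "\<dots> = (cmod c * norm x)\<^sup>2"
    by (simp add: cinner_self complex_norm_square[symmetric] power_mult_distrib
        flip: of_real_power of_real_mult)
  finally show ?thesis
    by (simp add: power2_eq_iff_nonneg)
qed

lemma bounded_linear_scaleC: "bounded_linear (\<lambda>x. c *\<^sub>C x :: 'h::chilbert_space)"
  by standard
    (auto simp: scaleC_add_right scaleC_of_real[symmetric] scaleC_scaleC norm_scaleC
      mult.commute intro!: exI[of _ "cmod c"])

lemma Re_cinner_le: "Re (cinner x y) \<le> norm x * norm y"
  for x :: "'h::chilbert_space"
proof (cases "x = 0 \<or> y = 0")
  case False
  define a b where "a = norm x" and "b = norm y"
  have ab: "a > 0" "b > 0"
    using False by (auto simp: a_def b_def)
  have "0 \<le> (norm (b *\<^sub>R x - a *\<^sub>R y))\<^sup>2"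
    by simp
  also have "\<dots> = 2 * a * b * (a * b - Re (cinner x y))"
    unfolding norm_diff_sq
    by (simp add: cinner_simps a_def[symmetric] b_def[symmetric] power2_eq_square algebra_simps)
  finally have "0 \<le> (2 * a * b) * (a * b - Re (cinner x y))" .
  moreover have "2 * a * b > 0"
    using ab by simp
  ultimately have "0 \<le> a * b - Re (cinner x y)"
    by (simp only: zero_le_mult_iff) linarith
  then show ?thesis
    by (simp add: a_def b_def)
qed auto

lemma cmod_cinner_le: "cmod (cinner x y) \<le> norm x * norm y"
  for x :: "'h::chilbert_space"
proof (cases "cinner x y = 0")
  case False
  define c where "c = cnj (cinner x y) / cmod (cinner x y)"
  have "cmod c = 1"
    using False by (simp add: c_def norm_divide)
  moreover have "c * cinner x y = complex_of_real (cmod (cinner x y))"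
    using False by (simp add: c_def mult.commute complex_norm_square[symmetric] power2_eq_square)
  then have "cmod (cinner x y) = Re (cinner (c *\<^sub>C x) y)"
    by (simp add: cinner_scaleC_left)
  ultimately show ?thesis
    using Re_cinner_le[of "c *\<^sub>C x" y] by (simp add: norm_scaleC)
qed auto

lemma bounded_bilinear_cinner: "bounded_bilinear (cinner :: 'h::chilbert_space \<Rightarrow> 'h \<Rightarrow> complex)"
  by standard
    (auto simp: cinner_simps scaleR_conv_of_real intro!: exI[of _ 1] cmod_cinner_le)

lemma norm_le_Re_cinner:
  fixes z :: "'h::chilbert_space"
  assumes "\<And>y. Re (cinner z y) \<le> c * norm y" "c \<ge> 0"
  shows "norm z \<le> c"
proof (cases "z = 0")
  case False
  have "(norm z)\<^sup>2 \<le> c * norm z"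
    using assms(1)[of z] by (simp add: Re_cinner_self)
  then show ?thesis
    using False by (simp add: power2_eq_square)
qed (use assms in simp)

text \<open>The representing vector minimises \<open>\<parallel>z\<parallel>\<^sup>2 - 2 r(z)\<close>; a minimising sequence is Cauchy by the
  parallelogram law, and stationarity of the limit in every direction is the desired identity.\<close>

lemma riesz_representation:
  fixes r :: "'h::chilbert_space \<Rightarrow> real"
  assumes "bounded_linear r"
  shows "\<exists>z. \<forall>x. r x = Re (cinner x z)"
proof -
  interpret r: bounded_linear r by fact
  obtain K where K: "\<And>x. \<bar>r x\<bar> \<le> norm x * K" "K \<ge> 0"
    using r.nonneg_bounded by auto
  define J where "J z = (norm z)\<^sup>2 - 2 * r z" for z
  have J_ge: "J z \<ge> - K\<^sup>2" for z
  proof -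
    have "0 \<le> (norm z - K)\<^sup>2" by simp
    also have "\<dots> = (norm z)\<^sup>2 - 2 * (norm z * K) + K\<^sup>2"
      by (simp add: power2_diff)
    finally show ?thesis
      using K(1)[of z] by (simp add: J_def)
  qed
  define m where "m = Inf (range J)"
  have bdd: "bdd_below (range J)"
    using J_ge by (auto intro!: bdd_belowI)
  have m_le: "m \<le> J z" for z
    unfolding m_def by (rule cInf_lower) (auto simp: bdd)
  have "\<exists>z. J z < m + inverse (real (Suc n))" for n
    using cInf_lessD[of "range J" "m + inverse (real (Suc n))"] by (auto simp: m_def)
  then obtain z where z: "\<And>n. J (z n) < m + inverse (real (Suc n))"
    by metis
  have par: "(norm (a - b))\<^sup>2 \<le> 2 * (J a + J b - 2 * m)" for a b
  proof -
    have "(norm (a - b))\<^sup>2 = 2 * (norm a)\<^sup>2 + 2 * (norm b)\<^sup>2 - (norm (a + b))\<^sup>2"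
      by (simp add: norm_add_sq norm_diff_sq)
    also have "\<dots> = 2 * J a + 2 * J b - 4 * J ((1/2) *\<^sub>R (a + b))"
    proof -
      have "J ((1/2) *\<^sub>R (a + b)) = (norm (a + b))\<^sup>2 / 4 - (r a + r b)"
        unfolding J_def r.scaleR r.add norm_scaleR by (simp add: power_divide add_divide_distrib)
      then show ?thesis by (simp add: J_def)
    qed
    finally show ?thesis
      using m_le[of "(1/2) *\<^sub>R (a + b)"] by simp
  qed
  have "Cauchy z"
  proof (rule metric_CauchyI)
    fix e :: real
    assume "e > 0"
    then obtain N where N: "inverse (real (Suc N)) < e\<^sup>2 / 4"
      using reals_Archimedean[of "e\<^sup>2 / 4"] by auto
    show "\<exists>N. \<forall>p\<ge>N. \<forall>q\<ge>N. dist (z p) (z q) < e"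
    proof (intro exI allI impI)
      fix p q
      assume pq: "p \<ge> N" "q \<ge> N"
      have "inverse (real (Suc p)) \<le> inverse (real (Suc N))"
        "inverse (real (Suc q)) \<le> inverse (real (Suc N))"
        using pq by simp_all
      then have "inverse (real (Suc p)) < e\<^sup>2 / 4" "inverse (real (Suc q)) < e\<^sup>2 / 4"
        using N by linarith+
      then have "2 * (J (z p) + J (z q) - 2 * m) < e\<^sup>2"
        using z[of p] z[of q]
        by argo
      then have "(norm (z p - z q))\<^sup>2 < e\<^sup>2"
        by (rule le_less_trans[OF par])
      then show "dist (z p) (z q) < e"
        using \<open>e > 0\<close> by (simp add: dist_norm power_less_imp_less_base)
    qed
  qed
  then obtain w where w: "z \<longlonglongrightarrow> w"
    using Cauchy_convergent convergent_def by blast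
  have "(\<lambda>n. J (z n)) \<longlonglongrightarrow> J w"
    unfolding J_def by (intro tendsto_intros w r.tendsto)
  moreover have "(\<lambda>n. m + inverse (real (Suc n))) \<longlonglongrightarrow> m + 0"
    by (intro tendsto_intros LIMSEQ_inverse_real_of_nat)
  ultimately have "J w \<le> m + 0"
    by (rule LIMSEQ_le) (use z in \<open>auto intro: less_imp_le\<close>)
  then have Jw: "J w \<le> J v" for v
    using m_le[of v] by simp
  have "r x = Re (cinner x w)" for x
  proof -
    define d where "d = Re (cinner x w) - r x"
    have quad: "0 \<le> 2 * s * d + s\<^sup>2 * (norm x)\<^sup>2" for s
      using Jw[of "w + s *\<^sub>R x"] Re_cinner_commute[of x w]
      by (simp add: J_def d_def norm_add_sq r.add r.scaleR cinner_simps power_mult_distrib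
          algebra_simps)
    \<comment> \<open>the summand \<open>1\<close> avoids a case distinction at \<open>x = 0\<close>; \<open>s = - d / q\<close> is nearly the minimiser\<close>
    define q where "q = 1 + (norm x)\<^sup>2"
    have q: "q > 0"
      by (simp add: q_def add_pos_nonneg)
    have "0 \<le> 2 * (- d / q) * d + (- d / q)\<^sup>2 * (norm x)\<^sup>2"
      by (rule quad)
    also have "\<dots> \<le> 2 * (- d / q) * d + (- d / q)\<^sup>2 * q"
      by (simp add: q_def mult_left_mono)
    also have "\<dots> = - d\<^sup>2 / q"
      using q by (simp add: power2_eq_square)
    finally have "d\<^sup>2 \<le> 0"
      using q by (simp add: field_simps)
    then show ?thesis
      by (simp add: d_def)
  qed
  then show ?thesis by blast
qed

section \<open>Bounded operators and adjoints\<close>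

lemma cinner_eqI:
  fixes y z :: "'h::chilbert_space"
  assumes "\<And>x. Re (cinner x y) = Re (cinner x z)"
  shows "y = z"
proof -
  have "(norm (y - z))\<^sup>2 = 0"
    using assms[of "y - z"] by (simp add: Re_cinner_self[symmetric] cinner_simps)
  then show ?thesis by simp
qed

lemma bounded_opsD: "a \<in> bounded_ops \<Longrightarrow> blinfun_apply a (c *\<^sub>C x) = c *\<^sub>C blinfun_apply a x"
  by (simp add: bounded_ops_def)

text \<open>Riesz representation of the functionals \<open>x \<mapsto> Re \<langle>a x, y\<rangle>\<close> yields the adjoint; complex linearity
  of \<open>a\<close> recovers the imaginary parts.\<close>

lemma adjoint_exists:
  fixes a :: "'h::chilbert_space oper"
  assumes a: "a \<in> bounded_ops"
  shows "\<exists>b::'h oper. \<forall>x y. cinner (a x) y = cinner x (b y)"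
proof -
  have "\<exists>z. \<forall>x. Re (cinner (a x) y) = Re (cinner x z)" for y
  proof (rule riesz_representation)
    show "bounded_linear (\<lambda>x. Re (cinner (a x) y))"
      by (intro bounded_linear_compose[OF bounded_linear_Re]
          bounded_linear_compose[OF bounded_bilinear.bounded_linear_left[OF bounded_bilinear_cinner]]
          blinfun.bounded_linear_right)
  qed
  then obtain B where B: "\<And>x y. Re (cinner (a x) y) = Re (cinner x (B y))"
    by metis
  have full: "cinner (a x) y = cinner x (B y)" for x y
  proof (rule complex_eqI)
    show "Re (cinner (a x) y) = Re (cinner x (B y))" by (rule B)
    have "Re (cinner (a (\<i> *\<^sub>C x)) y) = Re (cinner (\<i> *\<^sub>C x) (B y))" by (rule B)
    then show "Im (cinner (a x) y) = Im (cinner x (B y))"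
      by (simp add: bounded_opsD[OF a] cinner_simps)
  qed
  have "bounded_linear B"
  proof
    show "B (x + y) = B x + B y" for x y
      by (rule cinner_eqI) (simp add: B[symmetric] cinner_simps)
    show "B (r *\<^sub>R x) = r *\<^sub>R B x" for r x
      by (rule cinner_eqI) (simp add: B[symmetric] cinner_simps)
    show "\<exists>K. \<forall>x. norm (B x) \<le> norm x * K"
    proof (intro exI allI)
      fix y
      show "norm (B y) \<le> norm y * norm a"
      proof (rule norm_le_Re_cinner)
        fix x
        have "Re (cinner (B y) x) = Re (cinner (a x) y)"
          by (simp only: B Re_cinner_commute[of "B y"])
        also have "\<dots> \<le> norm (a x) * norm y" by (rule Re_cinner_le)
        also have "\<dots> \<le> (norm a * norm x) * norm y"
          by (intro mult_right_mono norm_blinfun) simp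
        finally show "Re (cinner (B y) x) \<le> norm y * norm a * norm x"
          by (simp add: mult_ac)
      qed simp
    qed
  qed
  then show ?thesis
    using full by (intro exI[of _ "Blinfun B"]) (simp add: bounded_linear_Blinfun_apply)
qed

text \<open>The definite description in \<open>adj_op\<close> denotes: the adjoint exists, and it is determined by its scalar
  products.\<close>

lemma cinner_adj_op:
  fixes a :: "'h::chilbert_space oper"
  assumes "a \<in> bounded_ops"
  shows "cinner (a x) y = cinner x (adj_op a y)"
proof -
  obtain b :: "'h oper" where b: "\<forall>x y. cinner (a x) y = cinner x (b y)"
    using adjoint_exists[OF assms] by blast
  have "\<forall>x y. cinner (a x) y = cinner x (adj_op a y)"
    unfolding adj_op_def
  proof (rule theI)
    fix b' :: "'h oper"
    assume b': "\<forall>x y. cinner (a x) y = cinner x (b' y)"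
    show "b' = b"
      by (rule blinfun_eqI, rule cinner_eqI) (use b b' in metis)
  qed (rule b)
  then show ?thesis by blast
qed

lemma cinner_adj_op':
  fixes a :: "'h::chilbert_space oper"
  assumes "a \<in> bounded_ops"
  shows "cinner (adj_op a x) y = cinner x (a y)"
  by (metis assms cinner_adj_op cinner_commute)

lemma adj_op_unique:
  fixes a b :: "'h::chilbert_space oper"
  assumes "a \<in> bounded_ops" "\<And>x y. cinner (a x) y = cinner x (b y)"
  shows "adj_op a = b"
  by (rule blinfun_eqI, rule cinner_eqI) (metis assms cinner_adj_op)

lemma norm_adj_op_le:
  fixes a :: "'h::chilbert_space oper"
  assumes "a \<in> bounded_ops"
  shows "norm (adj_op a) \<le> norm a"
proof (rule norm_blinfun_bound)
  fix y
  show "norm (adj_op a y) \<le> norm a * norm y"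
  proof (rule norm_le_Re_cinner)
    fix x
    have "Re (cinner (adj_op a y) x) \<le> norm y * norm (a x)"
      by (simp add: cinner_adj_op'[OF assms] Re_cinner_le)
    also have "\<dots> \<le> norm y * (norm a * norm x)"
      by (intro mult_left_mono norm_blinfun) simp
    finally show "Re (cinner (adj_op a y) x) \<le> norm a * norm y * norm x"
      by (simp add: mult_ac)
  qed simp
qed simp

lemma cinner_abs_sq:
  fixes a :: "'h::chilbert_space oper"
  assumes "a \<in> bounded_ops"
  shows "cinner (abs_sq a x) y = cinner (a x) (a y)"
  by (simp add: abs_sq_def cinner_adj_op'[OF assms])

lemma norm_abs_sq_le:
  fixes a :: "'h::chilbert_space oper"
  assumes "a \<in> bounded_ops"
  shows "norm (abs_sq a) \<le> (norm a)\<^sup>2"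
proof -
  have "norm (abs_sq a) \<le> norm (adj_op a) * norm a"
    unfolding abs_sq_def by (rule norm_blinfun_compose)
  also have "\<dots> \<le> (norm a)\<^sup>2"
    by (simp add: power2_eq_square mult_right_mono norm_adj_op_le[OF assms])
  finally show ?thesis .
qed

lemma oper_eq_iff: "a = b \<longleftrightarrow> (\<forall>x. a x = b x)"
  for a :: "'h::chilbert_space oper"
  by (auto intro: blinfun_eqI)

lemma norm_oper_le:
  fixes a :: "'h::chilbert_space oper"
  assumes "\<And>x y. Re (cinner (a x) y) \<le> c * norm x * norm y" "c \<ge> 0"
  shows "norm a \<le> c"
  by (rule norm_blinfun_bound) (use assms in \<open>auto intro!: norm_le_Re_cinner\<close>)

text \<open>Polarisation: since the form of \<open>a\<close> is real on the diagonal, it is hermitian, so that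
  \<open>4 Re \<langle>a x, y\<rangle> = \<langle>a (x + y), x + y\<rangle> - \<langle>a (x - y), x - y\<rangle>\<close>.\<close>

lemma norm_positive_op_le:
  fixes a :: "'h::chilbert_space oper"
  assumes a: "a \<in> bounded_ops" and pos: "positive_op a"
    and le: "\<And>x. Re (cinner (a x) x) \<le> c * (norm x)\<^sup>2" and c: "c \<ge> 0"
  shows "norm a \<le> c"
proof -
  have real: "Im (cinner (a x) x) = 0" "Re (cinner (a x) x) \<ge> 0" for x
    using pos by (auto simp: positive_op_def complex_nonneg_Reals_iff)
  have sym: "Re (cinner (a y) x) = Re (cinner (a x) y)" for x y
    using real(1)[of "x + \<i> *\<^sub>C y"] real(1)[of x] real(1)[of y]
    by (simp add: blinfun.add_right bounded_opsD[OF a] cinner_simps)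
  have unit: "Re (cinner (a x) y) \<le> c" if "norm x = 1" "norm y = 1" for x y
  proof -
    have "4 * Re (cinner (a x) y) = Re (cinner (a (x + y)) (x + y)) - Re (cinner (a (x - y)) (x - y))"
      using sym[of x y] by (simp add: blinfun.add_right blinfun.diff_right cinner_simps)
    also have "\<dots> \<le> c * (norm (x + y))\<^sup>2"
      using le[of "x + y"] real(2)[of "x - y"] by linarith
    also have "\<dots> \<le> c * 2\<^sup>2"
      using that norm_triangle_ineq[of x y] c by (intro mult_left_mono power_mono) auto
    finally show ?thesis by simp
  qed
  show ?thesis
  proof (rule norm_oper_le)
    fix x y
    show "Re (cinner (a x) y) \<le> c * norm x * norm y"
    proof (cases "x = 0 \<or> y = 0")
      case False
      have "Re (cinner (a (x /\<^sub>R norm x)) (y /\<^sub>R norm y)) \<le> c"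
        using False by (intro unit) simp_all
      moreover have "Re (cinner (a (x /\<^sub>R norm x)) (y /\<^sub>R norm y))
          = Re (cinner (a x) y) / (norm x * norm y)"
        unfolding blinfun.scaleR_right cinner_scaleR_left cinner_scaleR_right
        using False by (simp add: field_simps power2_eq_square)
      ultimately have "Re (cinner (a x) y) / (norm x * norm y) \<le> c"
        by simp
      moreover have "norm x * norm y > 0"
        using False by simp
      ultimately show ?thesis
        by (simp add: pos_divide_le_eq mult.assoc)
    qed auto
  qed (rule c)
qed

lemma closed_bounded_ops: "closed (bounded_ops :: 'h::chilbert_space oper set)"
proof -
  have "closed {a :: 'h oper. a (c *\<^sub>C x) = c *\<^sub>C a x}" for c x
    by (intro closed_Collect_eq continuous_intros
        bounded_linear.continuous_on[OF bounded_linear_scaleC])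
  moreover have "bounded_ops = (\<Inter>c. \<Inter>x. {a :: 'h oper. a (c *\<^sub>C x) = c *\<^sub>C a x})"
    by (auto simp: bounded_ops_def)
  ultimately show ?thesis
    by (metis (no_types, lifting) closed_INT)
qed

section \<open>Von Neumann algebras are closed subalgebras\<close>

locale vn_algebra =
  fixes M :: "'h::chilbert_space oper set"
  assumes vn: "von_neumann_algebra M"
begin

lemma M_iff: "a \<in> M \<longleftrightarrow> a \<in> bounded_ops \<and> (\<forall>b\<in>commutant M. b o\<^sub>L a = a o\<^sub>L b)"
  using vn unfolding von_neumann_algebra_def commutant_def by blast

lemma M_bounded_ops: "a \<in> M \<Longrightarrow> a \<in> bounded_ops"
  by (simp add: M_iff)

lemma M_adj: "a \<in> M \<Longrightarrow> adj_op a \<in> M"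
  using vn unfolding von_neumann_algebra_def by blast

lemma M_apply_scaleC: "a \<in> M \<Longrightarrow> a (c *\<^sub>C x) = c *\<^sub>C a x"
  by (simp add: M_bounded_ops bounded_opsD)

lemma M_commute: "a \<in> M \<Longrightarrow> b \<in> commutant M \<Longrightarrow> b (a x) = a (b x)"
  for a b :: "'h oper"
  unfolding M_iff by (metis blinfun_apply_blinfun_compose)

lemma MI:
  fixes a :: "'h oper"
  assumes "\<And>c x. a (c *\<^sub>C x) = c *\<^sub>C a x" "\<And>b x. b \<in> commutant M \<Longrightarrow> b (a x) = a (b x)"
  shows "a \<in> M"
  unfolding M_iff using assms by (simp add: bounded_ops_def oper_eq_iff)

lemma commutant_scaleC: "b \<in> commutant M \<Longrightarrow> b (c *\<^sub>C x) = c *\<^sub>C b x" for b :: "'h oper"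
  by (simp add: commutant_def bounded_opsD)

lemma M_id: "id_blinfun \<in> M"
  by (rule MI) auto

lemma M_add: "a \<in> M \<Longrightarrow> b \<in> M \<Longrightarrow> a + b \<in> M"
  by (rule MI)
    (simp_all add: M_apply_scaleC M_commute[of a] M_commute[of b] blinfun.add_left blinfun.add_right scaleC_add_right)

lemma M_scale_op: "a \<in> M \<Longrightarrow> scale_op c a \<in> M"
  by (rule MI)
    (simp_all add: M_apply_scaleC M_commute[of a] blinfun_apply_scale_op scaleC_scaleC mult.commute
      commutant_scaleC)

lemma scale_op_of_real: "scale_op (complex_of_real r) a = r *\<^sub>R a"
  by (rule blinfun_eqI) (simp add: blinfun_apply_scale_op scaleC_of_real blinfun.scaleR_left)

lemma M_scaleR: "a \<in> M \<Longrightarrow> r *\<^sub>R a \<in> M"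
  using M_scale_op[of a "complex_of_real r"] by (simp add: scale_op_of_real)

lemma M_compose: "a \<in> M \<Longrightarrow> b \<in> M \<Longrightarrow> a o\<^sub>L b \<in> M"
  by (rule MI) (simp_all add: M_apply_scaleC M_commute[of a] M_commute[of b])

lemma M_zero: "0 \<in> M"
  using M_scaleR[OF M_id, of 0] by simp

lemma M_minus: "a \<in> M \<Longrightarrow> - a \<in> M"
  using M_scaleR[of a "-1"] by simp

lemma M_diff: "a \<in> M \<Longrightarrow> b \<in> M \<Longrightarrow> a - b \<in> M"
  using M_add[OF _ M_minus, of a b] by simp

lemma M_abs_sq: "a \<in> M \<Longrightarrow> abs_sq a \<in> M"
  by (simp add: abs_sq_def M_compose M_adj)

text \<open>Being fixed by the double commutant, \<open>M\<close> is an intersection of kernels of commutator maps, which are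
  norm continuous. This is what allows norm limits and norm integrals to be formed inside \<open>M\<close>.\<close>

lemma M_closed: "closed M"
proof -
  have eq: "M = bounded_ops \<inter> (\<Inter>b\<in>commutant M. {a. b o\<^sub>L a = a o\<^sub>L b})"
    by (auto simp: M_iff)
  have "closed {a. b o\<^sub>L a = a o\<^sub>L b}" for b :: "'h oper"
    by (intro closed_Collect_eq continuous_intros
        bounded_bilinear.continuous_on[OF bounded_bilinear_blinfun_compose])
  then show ?thesis
    by (subst eq) (intro closed_Int closed_INT closed_bounded_ops ballI)
qed

end

section \<open>The weak-* topology\<close>

text \<open>Scalar products \<open>\<langle>a x, y\<rangle>\<close> are among the functionals of the predual: take sequences supported at \<open>0\<close>.\<close>

lemma l2_seq_single: "l2_seq (\<lambda>n. if n = 0 then x else 0)"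
  unfolding l2_seq_def by (rule summable_finite[of "{0}"]) auto

lemma vec_functional_single:
  "vec_functional (\<lambda>n. if n = 0 then x else 0) (\<lambda>n. if n = 0 then y else 0) a = cinner (a x) y"
  unfolding vec_functional_def by (subst suminf_finite[of "{0}"]) auto

lemma bounded_linear_vec_functional:
  fixes \<xi> \<eta> :: "nat \<Rightarrow> 'h::chilbert_space"
  assumes \<xi>: "l2_seq \<xi>" and \<eta>: "l2_seq \<eta>"
  shows "bounded_linear (vec_functional \<xi> \<eta>)"
proof -
  \<comment> \<open>\<open>\<parallel>\<xi>\<^sub>n\<parallel> \<parallel>\<eta>\<^sub>n\<parallel> \<le> \<parallel>\<xi>\<^sub>n\<parallel>\<^sup>2 + \<parallel>\<eta>\<^sub>n\<parallel>\<^sup>2\<close> replaces the Cauchy-Schwarz inequality for series\<close>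
  define S where "S n = (norm (\<xi> n))\<^sup>2 + (norm (\<eta> n))\<^sup>2" for n
  have S: "summable S"
    using \<xi> \<eta> unfolding S_def l2_seq_def by (rule summable_add)
  have bound: "norm (cinner (blinfun_apply a (\<xi> n)) (\<eta> n)) \<le> norm a * S n" for a n
  proof -
    have "norm (cinner (blinfun_apply a (\<xi> n)) (\<eta> n)) \<le> norm (blinfun_apply a (\<xi> n)) * norm (\<eta> n)"
      by (rule cmod_cinner_le)
    also have "\<dots> \<le> norm a * norm (\<xi> n) * norm (\<eta> n)"
      by (intro mult_right_mono norm_blinfun) simp
    also have "\<dots> = norm a * (norm (\<xi> n) * norm (\<eta> n))"
      by simp
    also have "\<dots> \<le> norm a * S n"
    proof (rule mult_left_mono)
      have "2 * (norm (\<xi> n) * norm (\<eta> n)) \<le> S n"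
        using sum_squares_bound[of "norm (\<xi> n)" "norm (\<eta> n)"] by (simp add: S_def mult.assoc)
      moreover have "0 \<le> norm (\<xi> n) * norm (\<eta> n)" by simp
      ultimately show "norm (\<xi> n) * norm (\<eta> n) \<le> S n" by linarith
    qed simp
    finally show ?thesis .
  qed
  have sum: "summable (\<lambda>n. norm (cinner (blinfun_apply a (\<xi> n)) (\<eta> n)))" for a
    by (rule summable_comparison_test'[OF summable_mult[OF S, of "norm a"]]) (simp add: bound)
  note sum' = summable_norm_cancel[OF sum]
  show ?thesis
  proof
    show "vec_functional \<xi> \<eta> (a + b) = vec_functional \<xi> \<eta> a + vec_functional \<xi> \<eta> b" for a b
      by (simp add: vec_functional_def blinfun.add_left cinner_add_left suminf_add sum')
    show "vec_functional \<xi> \<eta> (r *\<^sub>R a) = r *\<^sub>R vec_functional \<xi> \<eta> a" for r a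
      by (simp add: vec_functional_def blinfun.scaleR_left cinner_scaleR_left suminf_mult sum'
          scaleR_conv_of_real)
    show "\<exists>K. \<forall>a. norm (vec_functional \<xi> \<eta> a) \<le> norm a * K"
    proof (intro exI allI)
      fix a
      have "norm (vec_functional \<xi> \<eta> a) \<le> (\<Sum>n. norm (cinner (blinfun_apply a (\<xi> n)) (\<eta> n)))"
        unfolding vec_functional_def by (rule summable_norm[OF sum])
      also have "\<dots> \<le> (\<Sum>n. norm a * S n)"
        by (rule suminf_le[OF bound sum summable_mult[OF S]])
      also have "\<dots> = norm a * suminf S"
        by (rule suminf_mult[OF S])
      finally show "norm (vec_functional \<xi> \<eta> a) \<le> norm a * suminf S" .
    qed
  qed
qed

lemma topspace_weak_star: "topspace (weak_star M) = M"
proof -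
  have "l2_seq (\<lambda>n. 0)"
    by (simp add: l2_seq_def)
  then have "M \<in> {{a \<in> M. vec_functional \<xi> \<eta> a \<in> U} | \<xi> \<eta> U. l2_seq \<xi> \<and> l2_seq \<eta> \<and> open U}"
    by (auto intro!: exI[of _ "\<lambda>n. 0"] exI[of _ UNIV])
  then show ?thesis
    unfolding weak_star_def topology_generated_by_topspace by blast
qed

text \<open>For the direction from right to left, the sets that the values eventually enter once they contain the
  limit are closed under the operations generating the topology.\<close>

lemma limitin_weak_star_iff:
  "limitin (weak_star M) g l F \<longleftrightarrow> l \<in> M \<and> (\<forall>\<^sub>F t in F. g t \<in> M) \<and>
     (\<forall>\<xi> \<eta>. l2_seq \<xi> \<and> l2_seq \<eta> \<longrightarrow> ((\<lambda>t. vec_functional \<xi> \<eta> (g t)) \<longlongrightarrow> vec_functional \<xi> \<eta> l) F)"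
  (is "_ \<longleftrightarrow> ?R")
proof
  assume lim: "limitin (weak_star M) g l F"
  then have l: "l \<in> M"
    by (simp add: limitin_def topspace_weak_star)
  have ev: "\<forall>\<^sub>F t in F. g t \<in> U" if "openin (weak_star M) U" "l \<in> U" for U
    using lim that by (auto simp: limitin_def)
  have "openin (weak_star M) M"
    by (metis openin_topspace topspace_weak_star)
  moreover have "((\<lambda>t. vec_functional \<xi> \<eta> (g t)) \<longlongrightarrow> vec_functional \<xi> \<eta> l) F"
    if "l2_seq \<xi>" "l2_seq \<eta>" for \<xi> \<eta>
  proof (rule topological_tendstoI)
    fix V :: "complex set"
    assume V: "open V" "vec_functional \<xi> \<eta> l \<in> V"
    have "openin (weak_star M) {a \<in> M. vec_functional \<xi> \<eta> a \<in> V}"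
      unfolding weak_star_def by (rule topology_generated_by_Basis) (use that V in blast)
    from ev[OF this] show "\<forall>\<^sub>F t in F. vec_functional \<xi> \<eta> (g t) \<in> V"
      using l V by (auto elim: eventually_mono)
  qed
  ultimately show ?R
    using l ev by blast
next
  assume R: ?R
  have "\<forall>\<^sub>F t in F. g t \<in> U" if "openin (weak_star M) U" "l \<in> U" for U
  proof -
    have "generate_topology_on
        {{a \<in> M. vec_functional \<xi> \<eta> a \<in> U} | \<xi> \<eta> U. l2_seq \<xi> \<and> l2_seq \<eta> \<and> open U} U"
      using that(1) unfolding weak_star_def by (simp add: openin_topology_generated_by_iff)
    then show ?thesis
      using that(2)
    proof induction
      case (Int a b)
      then show ?case by (auto intro: eventually_conj)
    next
      case (UN K)
      then obtain k where "k \<in> K" "l \<in> k" "\<forall>\<^sub>F t in F. g t \<in> k" by auto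
      then show ?case by (auto elim: eventually_mono)
    next
      case (Basis s)
      then obtain \<xi> \<eta> V where s: "s = {a \<in> M. vec_functional \<xi> \<eta> a \<in> V}" "l2_seq \<xi>" "l2_seq \<eta>" "open V"
        by auto
      have "\<forall>\<^sub>F t in F. vec_functional \<xi> \<eta> (g t) \<in> V"
        using R s Basis.prems by (intro topological_tendstoD) auto
      with R show ?case
        by (auto simp: s intro: eventually_conj)
    qed auto
  qed
  then show "limitin (weak_star M) g l F"
    using R by (auto simp: limitin_def topspace_weak_star)
qed

lemma limitin_weak_star_cinner:
  assumes "limitin (weak_star M) g l F"
  shows "((\<lambda>t. cinner (blinfun_apply (g t) x) y) \<longlongrightarrow> cinner (blinfun_apply l x) y) F"
proof -
  have "((\<lambda>t. vec_functional \<xi> \<eta> (g t)) \<longlongrightarrow> vec_functional \<xi> \<eta> l) F" if "l2_seq \<xi>" "l2_seq \<eta>" for \<xi> \<eta>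
    using assms that by (simp add: limitin_weak_star_iff)
  from this[OF l2_seq_single l2_seq_single] show ?thesis
    by (simp only: vec_functional_single)
qed

lemma limitin_weak_star_unique:
  assumes "limitin (weak_star M) g l F" "limitin (weak_star M) g l' F" "F \<noteq> bot"
  shows "l = l'"
proof (rule blinfun_eqI)
  fix x
  have "cinner (l x) y = cinner (l' x) y" for y
    by (rule tendsto_unique[OF assms(3) limitin_weak_star_cinner[OF assms(1)]
          limitin_weak_star_cinner[OF assms(2)]])
  then show "l x = l' x"
    by (intro cinner_eqI) (simp only: Re_cinner_commute[of _ "blinfun_apply _ _"])
qed

lemma limitin_weak_star_norm:
  assumes "(g \<longlongrightarrow> l) F" "l \<in> M" "\<forall>\<^sub>F t in F. g t \<in> M"
  shows "limitin (weak_star M) g l F"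
  unfolding limitin_weak_star_iff
  using assms by (auto intro: bounded_linear.tendsto[OF bounded_linear_vec_functional])

lemma limitin_weak_star_norm_le:
  assumes "limitin (weak_star M) g l F" "F \<noteq> bot" "\<forall>\<^sub>F t in F. norm (g t) \<le> c" "c \<ge> 0"
  shows "norm l \<le> c"
proof (rule norm_oper_le)
  fix x y
  have "((\<lambda>t. Re (cinner (g t x) y)) \<longlongrightarrow> Re (cinner (l x) y)) F"
    by (intro tendsto_intros limitin_weak_star_cinner[OF assms(1)])
  moreover have "\<forall>\<^sub>F t in F. Re (cinner (g t x) y) \<le> c * norm x * norm y"
    using assms(3)
  proof eventually_elim
    case (elim t)
    have "Re (cinner (g t x) y) \<le> norm (g t x) * norm y"
      by (rule Re_cinner_le)
    also have "norm (g t x) \<le> norm (g t) * norm x"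
      by (rule norm_blinfun)
    also have "\<dots> \<le> c * norm x"
      by (intro mult_right_mono elim) simp
    finally show ?case
      by (simp add: mult_right_mono)
  qed
  ultimately show "Re (cinner (l x) y) \<le> c * norm x * norm y"
    using assms(2) by (rule tendsto_upperbound)
qed (rule assms)

section \<open>Uniform boundedness\<close>

text \<open>By Baire's theorem one of the closed sets on which all \<open>a\<^sub>n\<close> are bounded by \<open>k\<close> contains a ball; every
  vector is a multiple of a difference of two points of that ball.\<close>

lemma uniform_boundedness:
  fixes a :: "nat \<Rightarrow> 'a::banach \<Rightarrow>\<^sub>L 'b::real_normed_vector"
  assumes "\<And>x. Bseq (\<lambda>n. a n x)"
  shows "Bseq a"
proof -
  define E where "E k = {x. \<forall>n. norm (a n x) \<le> real k}" for k
  have closed: "closed (E k)" for k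
  proof -
    have "closed {x. norm (a n x) \<le> real k}" for n
      by (intro closed_Collect_le continuous_intros)
    then show ?thesis
      unfolding E_def Collect_all_eq by (intro closed_INT) simp
  qed
  have "\<exists>k. x \<in> E k" for x
  proof -
    obtain K where "\<And>n. norm (a n x) \<le> K"
      using assms[of x] unfolding Bseq_def by auto
    moreover obtain k where "K \<le> real k"
      using real_arch_simple by blast
    ultimately show ?thesis
      by (auto simp: E_def intro: order_trans)
  qed
  then have cover: "\<Union>(range E) = UNIV"
    by blast
  have "\<exists>k. interior (E k) \<noteq> {}"
  proof (rule ccontr)
    assume "\<not> ?thesis"
    then have "euclidean interior_of \<Union>(range E) = {}"
      using closed
      by (intro Baire_category_alt) (auto simp: completely_metrizable_space_euclidean)
    then show False
      by (simp add: cover)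
  qed
  then obtain k x0 r where r: "r > 0" "ball x0 r \<subseteq> E k"
    by (metis all_not_in_conv mem_interior)
  have "norm (a n) \<le> 4 * real k / r" for n
  proof (rule norm_blinfun_bound)
    fix x
    show "norm (a n x) \<le> 4 * real k / r * norm x"
    proof (cases "x = 0")
      case False
      define s where "s = r / (2 * norm x)"
      have s: "s > 0"
        using r False by (simp add: s_def)
      have "x0 \<in> E k" "x0 + s *\<^sub>R x \<in> E k"
        using r False by (auto simp: s_def dist_norm intro!: subsetD[OF r(2)])
      then have "norm (a n x0) \<le> k" "norm (a n (x0 + s *\<^sub>R x)) \<le> k"
        by (auto simp: E_def)
      then have "norm (a n (x0 + s *\<^sub>R x) - a n x0) \<le> 2 * k"
        using norm_triangle_ineq4[of "a n (x0 + s *\<^sub>R x)" "a n x0"] by linarith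
      then have "s * norm (a n x) \<le> 2 * k"
        using s by (simp add: blinfun.add_right blinfun.scaleR_right)
      then show ?thesis
        using r False by (simp add: s_def field_simps)
    qed simp
  qed (use r in simp)
  then show ?thesis
    by (rule BseqI')
qed

text \<open>Uniform boundedness is used twice: for the functionals \<open>\<langle>a\<^sub>n x, \<cdot>\<rangle>\<close> at fixed \<open>x\<close>, and then for the
  operators.\<close>

lemma uniform_boundedness_weak:
  fixes a :: "nat \<Rightarrow> 'h::chilbert_space oper"
  assumes "\<And>x y. Bseq (\<lambda>n. cinner (a n x) y)"
  shows "Bseq a"
proof (rule uniform_boundedness)
  fix x
  define b where "b n = Blinfun (cinner (a n x))" for n
  have b: "blinfun_apply (b n) = cinner (a n x)" for n
    unfolding b_def
    by (rule bounded_linear_Blinfun_apply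
        [OF bounded_bilinear.bounded_linear_right[OF bounded_bilinear_cinner]])
  have "Bseq b"
    by (rule uniform_boundedness) (simp add: b assms)
  then obtain K where K: "\<And>n. norm (b n) \<le> K"
    unfolding Bseq_def by auto
  have "norm (a n x) \<le> K" for n
  proof (rule norm_le_Re_cinner)
    fix y
    have "Re (cinner (a n x) y) \<le> norm (b n y)"
      by (simp add: b complex_Re_le_cmod)
    also have "\<dots> \<le> norm (b n) * norm y"
      by (rule norm_blinfun)
    also have "\<dots> \<le> K * norm y"
      by (intro mult_right_mono K) simp
    finally show "Re (cinner (a n x) y) \<le> K * norm y" .
  qed (use K[of 0] norm_ge_zero order_trans in blast)
  then show "Bseq (\<lambda>n. a n x)"
    by (rule BseqI')
qed

section \<open>Markov semigroups\<close>

lemma positive_op_Re: "positive_op a \<Longrightarrow> 0 \<le> Re (cinner (a x) x)"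
  by (simp add: positive_op_def complex_nonneg_Reals_iff)

lemma le_op_form: "a \<preceq> b \<Longrightarrow> Re (cinner (a x) x) \<le> Re (cinner (b x) x)"
  unfolding le_op_def using positive_op_Re[of "b - a" x]
  by (simp add: blinfun.diff_left cinner_diff_left)

locale quantum_markov = vn_algebra M for M :: "'h::chilbert_space oper set" +
  fixes \<tau> :: "'h oper \<Rightarrow> complex" and T :: "real \<Rightarrow> 'h oper \<Rightarrow> 'h oper"
  assumes markov: "markov_semigroup M \<tau> T"
    and dom: "s > 0 \<Longrightarrow> f \<in> M \<Longrightarrow> T s f \<in> dom_inf M T"
begin

lemma T_M: "t \<ge> 0 \<Longrightarrow> f \<in> M \<Longrightarrow> T t f \<in> M"
  and T_add: "t \<ge> 0 \<Longrightarrow> f \<in> M \<Longrightarrow> g \<in> M \<Longrightarrow> T t (f + g) = T t f + T t g"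
  and T_scale_op: "t \<ge> 0 \<Longrightarrow> f \<in> M \<Longrightarrow> T t (scale_op c f) = scale_op c (T t f)"
  and T_0: "f \<in> M \<Longrightarrow> T 0 f = f"
  and T_semigroup: "t \<ge> 0 \<Longrightarrow> s \<ge> 0 \<Longrightarrow> f \<in> M \<Longrightarrow> T t (T s f) = T (t + s) f"
  and T_normal: "t \<ge> 0 \<Longrightarrow> continuous_map (weak_star M) (weak_star M) (T t)"
  and T_cp: "t \<ge> 0 \<Longrightarrow> completely_positive M (T t)"
  and T_id: "t \<ge> 0 \<Longrightarrow> T t id_blinfun = id_blinfun"
  and T_limit_0: "f \<in> M \<Longrightarrow> limitin (weak_star M) (\<lambda>t. T t f) f (at_right 0)"
  using markov unfolding markov_semigroup_def by auto

lemma T_scaleR: "t \<ge> 0 \<Longrightarrow> f \<in> M \<Longrightarrow> T t (r *\<^sub>R f) = r *\<^sub>R T t f"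
  using T_scale_op[of t f "complex_of_real r"] by (simp add: scale_op_of_real)

lemma T_diff: "t \<ge> 0 \<Longrightarrow> f \<in> M \<Longrightarrow> g \<in> M \<Longrightarrow> T t (f - g) = T t f - T t g"
  using T_add[of t f "(-1) *\<^sub>R g"] T_scaleR[of t g "-1"] M_scaleR[of g "-1"] by simp

lemma T_minus: "t \<ge> 0 \<Longrightarrow> f \<in> M \<Longrightarrow> T t (- f) = - T t f"
  using T_scaleR[of t f "-1"] by simp

lemma T_limit:
  assumes "t \<ge> 0" "limitin (weak_star M) g l F"
  shows "limitin (weak_star M) (\<lambda>s. T t (g s)) (T t l) F"
  using continuous_map_limit[OF T_normal[OF assms(1)] assms(2)] by (simp add: o_def)

lemma T_positive:
  assumes "t \<ge> 0" "f \<in> M" "positive_op f"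
  shows "positive_op (T t f)"
proof -
  have "positive_matrix 1 (\<lambda>i j. f)"
    using assms(3) by (simp add: positive_matrix_def positive_op_def)
  then have "positive_matrix 1 (\<lambda>i j. T t f)"
    using T_cp[OF assms(1), unfolded completely_positive_def, rule_format, of 1 "\<lambda>i j. f"] assms(2)
    by simp
  then have "(\<Sum>i<1. \<Sum>j<1. cinner (T t f ((\<lambda>_. x) (j::nat))) ((\<lambda>_. x) (i::nat))) \<in> \<real>\<^sub>\<ge>\<^sub>0" for x
    unfolding positive_matrix_def by (rule spec)
  then show ?thesis
    by (simp add: positive_op_def)
qed

text \<open>Complete positivity is applied to the positive \<open>2 \<times> 2\<close> matrix with rows \<open>(1, f)\<close> and
  \<open>(f\<^sup>*, f\<^sup>* f)\<close>, whose form is \<open>\<parallel>x + f y\<parallel>\<^sup>2\<close>.\<close>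

lemma T_2_positive:
  assumes t: "t \<ge> 0" and f: "f \<in> M"
  shows "cinner x x + cinner (T t f y) x + cinner (T t (adj_op f) x) y
    + cinner (T t (abs_sq f) y) y \<in> \<real>\<^sub>\<ge>\<^sub>0"
proof -
  define a where "a i j = (if i = (0::nat) then (if j = (0::nat) then id_blinfun else f)
    else (if j = 0 then adj_op f else abs_sq f))" for i j
  have sum2: "(\<Sum>i<2. h i) = h 0 + h (Suc 0)" for h :: "nat \<Rightarrow> complex"
    by (simp add: numeral_2_eq_2)
  have "positive_matrix 2 a"
    unfolding positive_matrix_def
  proof
    fix \<xi> :: "nat \<Rightarrow> 'h"
    have "(\<Sum>i<2. \<Sum>j<2. cinner (a i j (\<xi> j)) (\<xi> i)) = cinner (\<xi> 0 + f (\<xi> 1)) (\<xi> 0 + f (\<xi> 1))"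
      by (simp add: sum2 a_def cinner_simps cinner_abs_sq M_bounded_ops[OF f]
          cinner_adj_op'[OF M_bounded_ops[OF f]])
    then show "(\<Sum>i<2. \<Sum>j<2. cinner (a i j (\<xi> j)) (\<xi> i)) \<in> \<real>\<^sub>\<ge>\<^sub>0"
      by (simp add: cinner_self complex_nonneg_Reals_iff flip: of_real_power)
  qed
  moreover have "a i j \<in> M" for i j
    by (simp add: a_def M_id f M_adj M_abs_sq)
  ultimately have "positive_matrix 2 (\<lambda>i j. T t (a i j))"
    using T_cp[OF t, unfolded completely_positive_def, rule_format, of 2 a] by simp
  then have "(\<Sum>i<2. \<Sum>j<2. cinner (T t (a i j) ((\<lambda>i. if i = 0 then x else y) j))
      ((\<lambda>i. if i = 0 then x else y) i)) \<in> \<real>\<^sub>\<ge>\<^sub>0"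
    unfolding positive_matrix_def by (rule spec)
  then show ?thesis
    by (simp add: sum2 a_def T_id[OF t] add.assoc)
qed

text \<open>The values of the positive form are real; inserting \<open>y\<close> and \<open>\<i> y\<close> compares the imaginary and the
  real parts of \<open>\<langle>T\<^sub>t f y, x\<rangle>\<close> and \<open>\<langle>T\<^sub>t (f\<^sup>*) x, y\<rangle>\<close>.\<close>

lemma T_adj:
  assumes t: "t \<ge> 0" and f: "f \<in> M"
  shows "T t (adj_op f) = adj_op (T t f)"
proof -
  have im: "Im (cinner (T t f y) x) + Im (cinner (T t (adj_op f) x) y) = 0" for x y
    using T_2_positive[OF assms, of x y] T_2_positive[OF assms, of 0 y] cinner_self[of x]
    by (simp add: complex_nonneg_Reals_iff flip: of_real_power)
  have "adj_op (T t f) = T t (adj_op f)"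
  proof (rule adj_op_unique)
    show "T t f \<in> bounded_ops"
      using assms by (simp add: M_bounded_ops T_M)
    fix y x
    have "Re (cinner (T t f y) x) = Re (cinner (T t (adj_op f) x) y)"
      using im[of "\<i> *\<^sub>C y" x] T_M[OF t f] by (simp add: M_apply_scaleC cinner_simps)
    moreover have "Im (cinner (T t f y) x) = - Im (cinner (T t (adj_op f) x) y)"
      using im[of y x] by simp
    moreover have "cinner y (T t (adj_op f) x) = cnj (cinner (T t (adj_op f) x) y)"
      by (rule cinner_commute)
    ultimately show "cinner (T t f y) x = cinner y (T t (adj_op f) x)"
      by (simp add: complex_eq_iff)
  qed
  then show ?thesis by simp
qed

text \<open>The positive form of the \<open>2 \<times> 2\<close> matrix is evaluated at \<open>x = - T\<^sub>t f y\<close>, which minimises it in \<open>x\<close>.\<close>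

lemma kadison_schwarz:
  assumes t: "t \<ge> 0" and f: "f \<in> M"
  shows "positive_op (T t (abs_sq f) - abs_sq (T t f))"
  unfolding positive_op_def
proof
  fix y
  define u where "u = T t f y"
  have bd: "T t f \<in> bounded_ops"
    by (intro M_bounded_ops T_M t f)
  have "cinner (- u) (- u) + cinner u (- u) + cinner (adj_op (T t f) (- u)) y
      + cinner (T t (abs_sq f) y) y \<in> \<real>\<^sub>\<ge>\<^sub>0"
    using T_2_positive[OF assms, of "- u" y] by (simp only: T_adj[OF assms] u_def)
  moreover have "cinner (adj_op (T t f) (- u)) y = - cinner u u"
    by (simp only: cinner_adj_op'[OF bd] cinner_minus_left u_def)
  moreover have "cinner ((T t (abs_sq f) - abs_sq (T t f)) y) y
      = cinner (T t (abs_sq f) y) y - cinner u u"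
    by (simp only: blinfun.diff_left cinner_diff_left cinner_abs_sq[OF bd] u_def)
  ultimately show "cinner ((T t (abs_sq f) - abs_sq (T t f)) y) y \<in> \<real>\<^sub>\<ge>\<^sub>0"
    by (simp add: cinner_minus_left cinner_minus_right)
qed

lemma kadison_schwarz_form:
  assumes t: "t \<ge> 0" and f: "f \<in> M"
  shows "(norm (T t f x))\<^sup>2 \<le> Re (cinner (T t (abs_sq f) x) x)"
  using positive_op_Re[OF kadison_schwarz[OF assms], of x] T_M[OF t f]
  by (simp add: blinfun.diff_left cinner_diff_left cinner_abs_sq M_bounded_ops Re_cinner_self)

lemma T_form_mono:
  assumes t: "t \<ge> 0" and "f \<in> M" "g \<in> M" "positive_op (g - f)"
  shows "Re (cinner (T t f x) x) \<le> Re (cinner (T t g x) x)"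
  using positive_op_Re[OF T_positive[OF t M_diff[OF assms(3,2)] assms(4)], of x]
  by (simp add: T_diff assms blinfun.diff_left cinner_diff_left)

text \<open>Kadison-Schwarz, and positivity and unitality applied to \<open>|f|\<^sup>2 \<le> \<parallel>f\<parallel>\<^sup>2 1\<close>.\<close>

lemma T_contraction:
  assumes t: "t \<ge> 0" and f: "f \<in> M"
  shows "norm (T t f) \<le> norm f"
proof (rule norm_blinfun_bound)
  fix x
  let ?c = "(norm f)\<^sup>2 *\<^sub>R id_blinfun"
  have "positive_op (?c - abs_sq f)"
    unfolding positive_op_def
  proof
    fix y
    have "(norm (f y))\<^sup>2 \<le> (norm f)\<^sup>2 * (norm y)\<^sup>2"
      using power_mono[OF norm_blinfun[of f y] norm_ge_zero, of 2] by (simp add: power_mult_distrib)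
    moreover have "cinner ((?c - abs_sq f) y) y
        = complex_of_real ((norm f)\<^sup>2 * (norm y)\<^sup>2 - (norm (f y))\<^sup>2)"
      by (simp add: blinfun.diff_left blinfun.scaleR_left cinner_simps cinner_abs_sq
          M_bounded_ops[OF f] cinner_self)
    ultimately show "cinner ((?c - abs_sq f) y) y \<in> \<real>\<^sub>\<ge>\<^sub>0"
      by (simp add: complex_nonneg_Reals_iff)
  qed
  then have "Re (cinner (T t (abs_sq f) x) x) \<le> Re (cinner (T t ?c x) x)"
    by (intro T_form_mono t M_abs_sq f M_scaleR M_id)
  also have "\<dots> = (norm f * norm x)\<^sup>2"
    by (simp add: T_scaleR t M_id T_id blinfun.scaleR_left cinner_simps Re_cinner_self
        power_mult_distrib flip: of_real_power)
  finally have "(norm (T t f x))\<^sup>2 \<le> (norm f * norm x)\<^sup>2"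
    by (rule order_trans[OF kadison_schwarz_form[OF assms]])
  then show "norm (T t f x) \<le> norm f * norm x"
    by (rule power2_le_imp_le) simp
qed simp

end

section \<open>Regularity of orbits\<close>

text \<open>For \<open>\<epsilon> > 0\<close>, the last point at which \<open>|z x - z a| \<le> \<epsilon> (x - a)\<close> holds has to be \<open>b\<close>: at an earlier
  point the right derivative would allow one to go further.\<close>

lemma zero_right_derivative_imp_const:
  fixes z :: "real \<Rightarrow> real"
  assumes "a \<le> b" and cont: "continuous_on {a..b} z"
    and der: "\<And>x. a \<le> x \<Longrightarrow> x < b \<Longrightarrow> (z has_vector_derivative 0) (at_right x)"
  shows "z b = z a"
proof -
  have *: "\<bar>z b - z a\<bar> \<le> \<epsilon> * (b - a)" if \<epsilon>: "\<epsilon> > 0" for \<epsilon>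
  proof -
    define g where "g x = \<bar>z x - z a\<bar> - \<epsilon> * (x - a)" for x
    define S where "S = {x \<in> {a..b}. g x \<le> 0}"
    have "closed S"
      unfolding S_def g_def
      by (intro continuous_on_closed_Collect_le continuous_intros cont closed_atLeastAtMost)
    moreover have "bounded S"
      by (rule bounded_subset[of "{a..b}"]) (auto simp: S_def)
    ultimately have "compact S"
      by (simp add: compact_eq_bounded_closed)
    moreover have "a \<in> S"
      using assms(1) by (simp add: S_def g_def)
    ultimately obtain c where c: "c \<in> S" "\<And>x. x \<in> S \<Longrightarrow> x \<le> c"
      using compact_attains_sup[of S] by blast
    have "c = b"
    proof (rule ccontr)
      assume "c \<noteq> b"
      then have cb: "a \<le> c" "c < b"
        using c(1) by (auto simp: S_def)
      have "((\<lambda>x. (z x - z c) / (x - c)) \<longlongrightarrow> 0) (at_right c)"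
        using der[OF cb] by (simp add: has_field_derivative_iff
            has_real_derivative_iff_has_vector_derivative[symmetric])
      then have "\<forall>\<^sub>F x in at_right c. \<bar>(z x - z c) / (x - c)\<bar> < \<epsilon>"
        by (drule_tac tendstoD[OF _ \<epsilon>]) (simp add: dist_real_def)
      moreover have "\<forall>\<^sub>F x in at_right c. x \<in> {c<..<b}"
        using cb by (intro eventually_at_rightI)
      ultimately have "\<forall>\<^sub>F x in at_right c. False"
      proof eventually_elim
        case (elim x)
        then have "\<bar>z x - z c\<bar> < \<epsilon> * (x - c)"
          by (simp add: abs_divide divide_less_eq)
        moreover have "\<bar>z c - z a\<bar> \<le> \<epsilon> * (c - a)"
          using c(1) by (simp add: S_def g_def)
        ultimately have "g x \<le> 0"
          unfolding g_def by (simp add: algebra_simps)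
        then show False
          using c(2)[of x] elim cb by (simp add: S_def)
      qed
      then show False
        by (simp add: trivial_limit_at_right_real)
    qed
    then show ?thesis
      using c(1) by (simp add: S_def g_def)
  qed
  have "\<bar>z b - z a\<bar> \<le> 0"
  proof (rule field_le_epsilon)
    fix e :: real
    assume e: "e > 0"
    have "\<bar>z b - z a\<bar> \<le> e / (b - a + 1) * (b - a)"
      using e assms(1) by (intro *) simp
    also have "\<dots> \<le> e / (b - a + 1) * (b - a + 1)"
      using e assms(1) by (intro mult_left_mono) auto
    finally show "\<bar>z b - z a\<bar> \<le> 0 + e"
      using assms(1) by simp
  qed
  then show ?thesis by simp
qed

lemma UN_greaterThan_0: "(\<Union>r\<in>{0<..}. {r<..}) = {0::real<..}"
proof -
  have "x \<in> (\<Union>r\<in>{0<..}. {r<..})" if "x > 0" for x :: real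
    using that by (intro UN_I[of "x / 2"]) auto
  then show ?thesis by force
qed

lemma has_vector_derivative_imp_quotient:
  assumes "(f has_vector_derivative d) (at x)"
  shows "((\<lambda>h. (1 / h) *\<^sub>R (f (x + h) - f x)) \<longlongrightarrow> d) (at 0)"
proof -
  have "((\<lambda>h. norm (f (x + h) - f x - h *\<^sub>R d) / norm h) \<longlongrightarrow> 0) (at 0)"
    using assms by (simp add: has_vector_derivative_def has_derivative_at)
  moreover have "\<forall>\<^sub>F h in at 0. norm (f (x + h) - f x - h *\<^sub>R d) / norm h
      = norm ((1 / h) *\<^sub>R (f (x + h) - f x) - d)"
  proof (rule eventually_mono[OF eventually_at_filter[THEN iffD2]])
    show "\<forall>\<^sub>F h in nhds 0. h \<noteq> 0 \<longrightarrow> h \<in> UNIV \<longrightarrow> h \<noteq> (0::real)" by simp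
    fix h :: real
    assume h: "h \<noteq> 0"
    have "(1 / h) *\<^sub>R (f (x + h) - f x) - d = (1 / h) *\<^sub>R (f (x + h) - f x - h *\<^sub>R d)"
      using h by (simp add: scaleR_diff_right)
    then show "norm (f (x + h) - f x - h *\<^sub>R d) / norm h = norm ((1 / h) *\<^sub>R (f (x + h) - f x) - d)"
      by simp
  qed
  ultimately have "((\<lambda>h. norm ((1 / h) *\<^sub>R (f (x + h) - f x) - d)) \<longlongrightarrow> 0) (at 0)"
    by (rule Lim_transform_eventually)
  then show ?thesis
    by (subst Lim_null) (simp only: tendsto_norm_zero_iff)
qed

context quantum_markov
begin

lemma generator_limit:
  assumes "f \<in> dom_inf M T"
  shows "limitin (weak_star M) (\<lambda>t. (1 / t) *\<^sub>R (f - T t f)) (generator M T f) (at_right 0)"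
proof -
  obtain g where g: "limitin (weak_star M) (\<lambda>t. (1 / t) *\<^sub>R (f - T t f)) g (at_right 0)"
    using assms by (auto simp: dom_inf_def)
  then have "generator M T f = g"
    unfolding generator_def
    by (intro the_equality) (auto intro: limitin_weak_star_unique simp: trivial_limit_at_right_real)
  with g show ?thesis by simp
qed

lemma generator_M: "f \<in> dom_inf M T \<Longrightarrow> generator M T f \<in> M"
  using generator_limit[of f] by (simp add: limitin_weak_star_iff)

lemma dom_inf_M: "f \<in> dom_inf M T \<Longrightarrow> f \<in> M"
  by (simp add: dom_inf_def)

lemma T_generator_limit:
  assumes f: "f \<in> dom_inf M T" and u: "u \<ge> 0"
  shows "limitin (weak_star M) (\<lambda>h. (1 / h) *\<^sub>R (T u f - T (u + h) f)) (T u (generator M T f)) (at_right 0)"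
proof -
  have "\<forall>\<^sub>F h in at_right 0. T u ((1 / h) *\<^sub>R (f - T h f)) = (1 / h) *\<^sub>R (T u f - T (u + h) f)"
    using eventually_at_right_less[of 0]
  proof eventually_elim
    case (elim h)
    then show ?case
      using u dom_inf_M[OF f] by (simp add: T_scaleR T_diff M_diff T_M T_semigroup)
  qed
  with T_limit[OF u generator_limit[OF f]] show ?thesis
    by (rule limitin_transform_eventually[rotated])
qed

text \<open>The semigroup law alone does not give this: normality of \<open>T\<^sub>u\<close> takes it inside the weak-* limit.\<close>

lemma generator_T:
  assumes f: "f \<in> dom_inf M T" and u: "u \<ge> 0"
  shows "generator M T (T u f) = T u (generator M T f)"
proof -
  have "\<forall>\<^sub>F h in at_right 0. (1 / h) *\<^sub>R (T u f - T (u + h) f) = (1 / h) *\<^sub>R (T u f - T h (T u f))"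
    using eventually_at_right_less[of 0]
  proof eventually_elim
    case (elim h)
    then show ?case
      using u dom_inf_M[OF f] by (simp add: T_semigroup add.commute)
  qed
  with T_generator_limit[OF assms]
  have "limitin (weak_star M) (\<lambda>h. (1 / h) *\<^sub>R (T u f - T h (T u f))) (T u (generator M T f)) (at_right 0)"
    by (rule limitin_transform_eventually[rotated])
  then show ?thesis
    unfolding generator_def
    by (intro the_equality) (auto intro: limitin_weak_star_unique simp: trivial_limit_at_right_real)
qed

text \<open>Weak-* convergent sequences are bounded, so the difference quotients of an element of the
  domain are bounded near \<open>0\<close>.\<close>

lemma dom_inf_lipschitz:
  assumes f: "f \<in> dom_inf M T"
  shows "\<exists>C \<delta>. \<delta> > 0 \<and> C \<ge> 0 \<and> (\<forall>h. 0 < h \<and> h < \<delta> \<longrightarrow> norm (T h f - f) \<le> C * h)"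
proof (rule ccontr)
  assume "\<not> ?thesis"
  then have "\<exists>h. 0 < h \<and> h < inverse (real (Suc n)) \<and> norm (T h f - f) > real n * h" for n
    by (meson not_le of_nat_0_le_iff inverse_positive_iff_positive of_nat_0_less_iff zero_less_Suc)
  then obtain h where h: "\<And>n. 0 < h n" "\<And>n. h n < inverse (real (Suc n))"
      "\<And>n. norm (T (h n) f - f) > real n * h n"
    by metis
  have "h \<longlonglongrightarrow> 0"
    by (rule tendsto_sandwich[OF _ _ tendsto_const LIMSEQ_inverse_real_of_nat])
      (use h(1,2) in \<open>auto intro!: always_eventually less_imp_le\<close>)
  then have h0: "filterlim h (at_right 0) sequentially"
    by (rule tendsto_imp_filterlim_at_right) (simp add: h(1))
  define a where "a n = (1 / h n) *\<^sub>R (f - T (h n) f)" for n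
  have "Bseq a"
  proof (rule uniform_boundedness_weak)
    fix x y
    have "(\<lambda>n. cinner (a n x) y) \<longlonglongrightarrow> cinner (generator M T f x) y"
      unfolding a_def
      by (rule filterlim_compose[OF limitin_weak_star_cinner[OF generator_limit[OF f]] h0])
    then show "Bseq (\<lambda>n. cinner (a n x) y)"
      by (intro convergent_imp_Bseq convergentI)
  qed
  then obtain K where K: "\<And>n. norm (a n) \<le> K"
    unfolding Bseq_def by auto
  have "real n < K" for n
  proof -
    have "real n * h n < norm (a n) * h n"
      using h(1)[of n] h(3)[of n] by (simp add: a_def norm_minus_commute)
    then have "real n < norm (a n)"
      using h(1)[of n] by simp
    with K[of n] show ?thesis by simp
  qed
  then show False
    using real_arch_simple[of K] by (meson not_le)
qed

text \<open>Contractivity transports the Lipschitz estimate at \<open>0\<close> along the orbit, in both directions of time.\<close>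

lemma dom_inf_orbit_continuous:
  assumes f: "f \<in> dom_inf M T"
  shows "continuous_on {0..} (\<lambda>u. T u f)"
proof -
  obtain C \<delta> where C: "\<delta> > 0" "C \<ge> 0" "\<And>h. 0 < h \<Longrightarrow> h < \<delta> \<Longrightarrow> norm (T h f - f) \<le> C * h"
    using dom_inf_lipschitz[OF f] by metis
  have fM: "f \<in> M"
    by (rule dom_inf_M[OF f])
  have lip: "norm (T v f - T u f) \<le> C * (v - u)" if "0 \<le> u" "u < v" "v < u + \<delta>" for u v
  proof -
    have "T v f - T u f = T u (T (v - u) f - f)"
      using that fM by (simp add: T_diff T_M T_semigroup)
    also have "norm \<dots> \<le> norm (T (v - u) f - f)"
      using that fM by (intro T_contraction M_diff T_M) auto
    also have "\<dots> \<le> C * (v - u)"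
      using that by (intro C) auto
    finally show ?thesis .
  qed
  show ?thesis
    unfolding continuous_on_iff
  proof (intro ballI allI impI)
    fix u e :: real
    assume "u \<in> {0..}" "e > 0"
    \<comment> \<open>\<open>C + 1\<close> rather than \<open>C\<close>, which may vanish\<close>
    define d where "d = min \<delta> (e / (C + 1))"
    have d: "d > 0"
      using C \<open>e > 0\<close> by (simp add: d_def)
    have small: "C * s < e" if "0 \<le> s" "s < d" for s
    proof -
      have "C * s \<le> (C + 1) * s"
        using that by (intro mult_right_mono) auto
      also have "\<dots> < (C + 1) * (e / (C + 1))"
        using that C by (intro mult_strict_left_mono) (auto simp: d_def)
      finally show ?thesis using C by simp
    qed
    show "\<exists>d>0. \<forall>v\<in>{0..}. dist v u < d \<longrightarrow> dist (T v f) (T u f) < e"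
    proof (intro exI[of _ d] conjI d ballI impI)
      fix v
      assume v: "v \<in> {0..}" "dist v u < d"
      consider "v = u" | "u < v" | "v < u" by linarith
      then show "dist (T v f) (T u f) < e"
      proof cases
        case 1
        then show ?thesis using \<open>e > 0\<close> by simp
      next
        case 2
        with v \<open>u \<in> {0..}\<close> have "norm (T v f - T u f) \<le> C * (v - u)"
          by (intro lip) (auto simp: dist_real_def d_def)
        also have "\<dots> < e"
          using 2 v by (intro small) (auto simp: dist_real_def)
        finally show ?thesis by (simp add: dist_norm)
      next
        case 3
        with v \<open>u \<in> {0..}\<close> have "norm (T u f - T v f) \<le> C * (u - v)"
          by (intro lip) (auto simp: dist_real_def d_def)
        also have "\<dots> < e"
          using 3 v by (intro small) (auto simp: dist_real_def)
        finally show ?thesis by (simp add: dist_norm norm_minus_commute)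
      qed
    qed
  qed
qed

lemma orbit_continuous:
  assumes f: "f \<in> M"
  shows "continuous_on {0<..} (\<lambda>u. T u f)"
proof -
  have "continuous_on {r<..} (\<lambda>u. T u f)" if r: "r > 0" for r
  proof -
    have "continuous_on {r<..} (\<lambda>u. T (u - r) (T r f))"
      by (intro continuous_on_compose2[OF dom_inf_orbit_continuous[OF dom[OF r f]]]
          continuous_intros) auto
    then show ?thesis
      by (rule continuous_on_eq) (use r f in \<open>simp add: T_semigroup\<close>)
  qed
  then have "continuous_on (\<Union>r\<in>{0<..}. {r<..}) (\<lambda>u. T u f)"
    by (intro continuous_on_open_UN) auto
  then show ?thesis
    by (simp only: UN_greaterThan_0)
qed

text \<open>The weak right derivative of the orbit of \<open>f \<in> dom\<^sub>\<infinity>(A)\<close> is \<open>- T\<^sub>u (A f)\<close>, which is norm continuous;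
  a continuous function with vanishing right derivative is constant, which turns this into an
  identity of norm integrals.\<close>

lemma orbit_integral:
  assumes f: "f \<in> dom_inf M T" and ab: "0 < a" "a \<le> b"
  shows "T b f = T a f - integral {a..b} (\<lambda>u. T u (generator M T f))"
proof -
  define k where "k u = T u (generator M T f)" for u
  have k: "continuous_on {a..b} k"
    unfolding k_def using ab
    by (intro continuous_on_subset[OF orbit_continuous[OF generator_M[OF f]]]) auto
  have Tc: "continuous_on {a..b} (\<lambda>u. T u f)"
    using ab by (intro continuous_on_subset[OF dom_inf_orbit_continuous[OF f]]) auto
  define Z where "Z u = T u f + integral {a..u} k" for u
  have "Re (cinner (Z b x) y) = Re (cinner (Z a x) y)" for x y
  proof (rule zero_right_derivative_imp_const[OF ab(2)])
    define L where "L c = Re (cinner (blinfun_apply c x) y)" for c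
    have L: "bounded_linear L"
      unfolding L_def
      by (intro bounded_linear_compose[OF bounded_linear_Re]
          bounded_linear_compose[OF bounded_bilinear.bounded_linear_left[OF bounded_bilinear_cinner]]
          blinfun.bounded_linear_left)
    interpret L: bounded_linear L by (rule L)
    have "continuous_on {a..b} Z"
      unfolding Z_def
      by (intro continuous_intros Tc indefinite_integral_continuous_1 integrable_continuous_real k)
    then have "continuous_on {a..b} (\<lambda>u. L (Z u))"
      by (rule L.continuous_on)
    then show "continuous_on {a..b} (\<lambda>u. Re (cinner (blinfun_apply (Z u) x) y))"
      by (simp add: L_def)
    fix u
    assume u: "a \<le> u" "u < b"
    have "((\<lambda>h. - L ((1 / h) *\<^sub>R (T u f - T (u + h) f))) \<longlongrightarrow> - L (k u)) (at_right 0)"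
      unfolding L_def k_def using u ab
      by (intro tendsto_intros limitin_weak_star_cinner[OF T_generator_limit[OF f]]) auto
    then have "((\<lambda>h. (L (T (u + h) f) - L (T u f)) / h) \<longlongrightarrow> - L (k u)) (at_right 0)"
      by (simp add: L.scaleR L.diff diff_divide_distrib)
    then have "((\<lambda>v. (L (T v f) - L (T u f)) / (v - u)) \<longlongrightarrow> - L (k u)) (at_right u)"
      by (subst at_right_to_0) (simp add: filterlim_filtermap add.commute)
    then have 1: "((\<lambda>v. L (T v f)) has_vector_derivative - L (k u)) (at_right u)"
      by (simp add: has_field_derivative_iff has_real_derivative_iff_has_vector_derivative[symmetric])
    have "((\<lambda>v. integral {a..v} k) has_vector_derivative k u) (at u within {a..b})"
      by (rule integral_has_vector_derivative[OF k]) (use u in auto)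
    then have "((\<lambda>v. integral {a..v} k) has_vector_derivative k u) (at u within {u..b})"
      by (rule has_vector_derivative_within_subset) (use u in auto)
    then have "((\<lambda>v. integral {a..v} k) has_vector_derivative k u) (at_right u)"
      using u by (simp add: at_within_Icc_at_right)
    then have 2: "((\<lambda>v. L (integral {a..v} k)) has_vector_derivative L (k u)) (at_right u)"
      by (rule L.has_vector_derivative)
    show "((\<lambda>u. Re (cinner (blinfun_apply (Z u) x) y)) has_vector_derivative 0) (at_right u)"
      using has_vector_derivative_add[OF 1 2] by (simp add: Z_def L.add flip: L_def)
  qed
  then have "Z b = Z a"
    by (intro blinfun_eqI cinner_eqI) (simp only: Re_cinner_commute[of _ "blinfun_apply _ _"])
  then have "T b f + integral {a..b} k = T a f"
    by (simp add: Z_def)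
  then show ?thesis
    by (simp add: k_def[abs_def] eq_diff_eq)
qed

text \<open>Since \<open>A T\<^sub>r f\<close> is again an element of \<open>M\<close>, its orbit is norm continuous, and the fundamental theorem of
  calculus applies to the integral formula for the orbit of \<open>T\<^sub>r f\<close>.\<close>

theorem orbit_has_vector_derivative:
  assumes f: "f \<in> M" and u: "u > 0"
  shows "((\<lambda>u. T u f) has_vector_derivative - generator M T (T u f)) (at u)"
proof -
  \<comment> \<open>shifting the orbit by \<open>r\<close> makes its starting point \<open>T\<^sub>r f\<close> an element of the domain, and \<open>u - r = 2 r\<close>
    is an interior point of an interval that stays away from \<open>0\<close>\<close>
  define r where "r = u / 3"
  have r: "r > 0" "u = r + 2 * r"
    using u by (auto simp: r_def)
  define g where "g = T r f"
  have g: "g \<in> dom_inf M T"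
    unfolding g_def by (rule dom[OF r(1) f])
  define k where "k v = T v (generator M T g)" for v
  have k: "continuous_on {r..3 * r} k"
    unfolding k_def using r
    by (intro continuous_on_subset[OF orbit_continuous[OF generator_M[OF g]]]) auto
  have "((\<lambda>v. integral {r..v} k) has_vector_derivative k (2 * r)) (at (2 * r) within {r..3 * r})"
    by (rule integral_has_vector_derivative[OF k]) (use r(1) in auto)
  moreover have "at (2 * r) within {r..3 * r} = at (2 * r)"
    by (rule at_within_interior) (use r(1) in simp)
  ultimately have "((\<lambda>v. integral {r..v} k) has_vector_derivative k (2 * r)) (at (2 * r))"
    by simp
  then have A: "((\<lambda>v. T r g - integral {r..v} k) has_vector_derivative 0 - k (2 * r)) (at (2 * r))"
    by (intro has_vector_derivative_diff has_vector_derivative_const)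
  have B: "((\<lambda>v. T v g) has_vector_derivative 0 - k (2 * r)) (at (2 * r))"
  proof (rule has_vector_derivative_transform_within_open[OF A, of "{r<..}"])
    fix v
    assume "v \<in> {r<..}"
    then show "T r g - integral {r..v} k = T v g"
      using orbit_integral[OF g r(1), of v] by (simp add: k_def[abs_def])
  qed (use r in auto)
  have "((\<lambda>v. v - r) has_vector_derivative 1 - 0) (at u)"
    by (intro has_vector_derivative_diff has_vector_derivative_id has_vector_derivative_const)
  moreover have "u - r = 2 * r"
    using r(2) by simp
  ultimately have "((\<lambda>v. T v g) \<circ> (\<lambda>v. v - r) has_vector_derivative (1 - 0) *\<^sub>R (0 - k (2 * r))) (at u)"
    using B by (intro vector_diff_chain_at) auto
  then have "((\<lambda>v. T (v - r) g) has_vector_derivative - k (2 * r)) (at u)"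
    by (simp add: o_def)
  moreover have "generator M T (T u f) = k (2 * r)"
    using generator_T[OF g, of "2 * r"] f r by (simp add: k_def g_def T_semigroup add.commute)
  ultimately have "((\<lambda>v. T (v - r) g) has_vector_derivative - generator M T (T u f)) (at u)"
    by simp
  then show ?thesis
  proof (rule has_vector_derivative_transform_within_open[where S = "{r<..}"])
    fix v
    assume "v \<in> {r<..}"
    then show "T (v - r) g = T v f"
      using f r by (simp add: g_def T_semigroup)
  qed (use r in auto)
qed

lemma generator_orbit_M: "f \<in> M \<Longrightarrow> u > 0 \<Longrightarrow> generator M T (T u f) \<in> M"
  by (rule generator_M[OF dom])

lemma generator_orbit_continuous:
  assumes f: "f \<in> M"
  shows "continuous_on {0<..} (\<lambda>u. generator M T (T u f))"
proof -
  have "continuous_on {r<..} (\<lambda>u. generator M T (T u f))" if r: "r > 0" for r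
  proof -
    have "continuous_on {r<..} (\<lambda>u. T (u - r) (generator M T (T r f)))"
      by (intro continuous_on_compose2[OF orbit_continuous[OF generator_orbit_M[OF f r]]]
          continuous_intros) auto
    then show ?thesis
      by (rule continuous_on_eq)
        (use r f in \<open>simp add: T_semigroup flip: generator_T[OF dom[OF r f]]\<close>)
  qed
  then have "continuous_on (\<Union>r\<in>{0<..}. {r<..}) (\<lambda>u. generator M T (T u f))"
    by (intro continuous_on_open_UN) auto
  then show ?thesis
    by (simp only: UN_greaterThan_0)
qed

lemma weak_star_deriv_eqI:
  assumes "limitin (weak_star M) (\<lambda>h. (1 / h) *\<^sub>R (g (t + h) - g t)) d (at 0)"
  shows "weak_star_deriv M g t = d"
  unfolding weak_star_deriv_def
  using assms by (intro the_equality) (auto intro: limitin_weak_star_unique)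

lemma weak_star_deriv_orbit:
  assumes f: "f \<in> M" and t: "t > 0"
  shows "weak_star_deriv M (\<lambda>s. T s f) t = - generator M T (T t f)"
proof (rule weak_star_deriv_eqI, rule limitin_weak_star_norm)
  show "((\<lambda>h. (1 / h) *\<^sub>R (T (t + h) f - T t f)) \<longlongrightarrow> - generator M T (T t f)) (at 0)"
    by (rule has_vector_derivative_imp_quotient[OF orbit_has_vector_derivative[OF assms]])
  show "- generator M T (T t f) \<in> M"
    by (intro M_minus generator_orbit_M assms)
  have "\<forall>\<^sub>F h in at 0. h \<in> {-t<..<t}"
    using t by (intro eventually_at_in_open') auto
  then show "\<forall>\<^sub>F h in at 0. (1 / h) *\<^sub>R (T (t + h) f - T t f) \<in> M"
    by (rule eventually_mono) (use t f in \<open>auto intro!: M_scaleR M_diff T_M\<close>)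
qed

end

section \<open>Weak integrals over the half-line\<close>

text \<open>Weak integrals are obtained as norm limits over these compact intervals; the limit then lies
  in the norm closed set \<open>M\<close>.\<close>

definition exhaust :: "nat \<Rightarrow> real set" where
  "exhaust n = {inverse (real (Suc n))..real (Suc n)}"

lemma exhaust_subset: "exhaust n \<subseteq> {0<..}"
proof
  fix x assume "x \<in> exhaust n"
  then have "0 < inverse (real (Suc n))" "inverse (real (Suc n)) \<le> x"
    by (simp_all add: exhaust_def del: of_nat_Suc)
  then have "0 < x" by (rule less_le_trans)
  then show "x \<in> {0<..}" by simp
qed

lemma set_integrable_halfline_bound:
  fixes h :: "real \<Rightarrow> 'b::{banach,second_countable_topology}" and m :: "real \<Rightarrow> real"
  assumes "continuous_on {0<..} h" "set_integrable lborel {0<..} m"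
    and "\<And>u. u > 0 \<Longrightarrow> norm (h u) \<le> m u"
  shows "set_integrable lborel {0<..} h"
proof (rule set_integrable_bound[OF assms(2)])
  show "set_borel_measurable lborel {0<..} h"
    unfolding set_borel_measurable_def
    using borel_measurable_continuous_on_indicator[OF _ assms(1)] by simp
  show "AE u in lborel. u \<in> {0<..} \<longrightarrow> norm (h u) \<le> norm (m u)"
    using assms(3) by (auto intro!: AE_I2 order_trans[OF _ abs_ge_self])
qed

lemma integral_exhaust_tendsto:
  fixes h :: "real \<Rightarrow> 'b::euclidean_space" and m :: "real \<Rightarrow> real"
  assumes h: "continuous_on {0<..} h" and m: "set_integrable lborel {0<..} m"
    and le: "\<And>u. u > 0 \<Longrightarrow> norm (h u) \<le> m u"
  shows "(\<lambda>n. integral (exhaust n) h) \<longlonglongrightarrow> (LINT u:{0<..}|lborel. h u)"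
proof -
  note hI = set_integrable_halfline_bound[OF assms]
  have "set_integrable lborel (exhaust n) h" for n
    by (rule set_integrable_subset[OF hI]) (use exhaust_subset in \<open>auto simp: exhaust_def simp del: of_nat_Suc\<close>)
  then have eq: "integral (exhaust n) h = (LINT u|lborel. indicator (exhaust n) u *\<^sub>R h u)" for n
    using set_borel_integral_eq_integral(2)[of "exhaust n" h] by (simp add: set_lebesgue_integral_def)
  have "(\<lambda>n. LINT u|lborel. indicator (exhaust n) u *\<^sub>R h u) \<longlonglongrightarrow>
      (LINT u|lborel. indicator {0<..} u *\<^sub>R h u)"
  proof (rule integral_dominated_convergence)
    show "(\<lambda>u. indicator {0<..} u *\<^sub>R h u) \<in> borel_measurable lborel"
      using borel_measurable_continuous_on_indicator[OF _ h] by simp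
    show "(\<lambda>u. indicator (exhaust n) u *\<^sub>R h u) \<in> borel_measurable lborel" for n
      using borel_measurable_continuous_on_indicator[OF _ continuous_on_subset[OF h exhaust_subset]]
      by (simp add: exhaust_def)
    show "integrable lborel (\<lambda>u. indicator {0<..} u *\<^sub>R m u)"
      using m by (simp add: set_integrable_def)
    show "AE u in lborel. norm (indicator (exhaust n) u *\<^sub>R h u) \<le> indicator {0<..} u *\<^sub>R m u" for n
    proof (rule AE_I2)
      fix u
      show "norm (indicator (exhaust n) u *\<^sub>R h u) \<le> indicator {0<..} u *\<^sub>R m u"
      proof (cases "u > 0")
        case True
        then show ?thesis
          using le[OF True] order_trans[OF norm_ge_zero le[OF True]]
          by (simp add: indicator_def)
      next
        case False
        then show ?thesis
          using exhaust_subset[of n] by (auto simp: indicator_def)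
      qed
    qed
    show "AE u in lborel. (\<lambda>n. indicator (exhaust n) u *\<^sub>R h u) \<longlonglongrightarrow> indicator {0<..} u *\<^sub>R h u"
    proof (rule AE_I2)
      fix u :: real
      show "(\<lambda>n. indicator (exhaust n) u *\<^sub>R h u) \<longlonglongrightarrow> indicator {0<..} u *\<^sub>R h u"
      proof (cases "u > 0")
        case True
        obtain N1 where N1: "inverse (real (Suc N1)) < u"
          using reals_Archimedean[OF True] by blast
        obtain N2 where N2: "u \<le> real N2"
          using real_arch_simple by blast
        have "\<forall>\<^sub>F n in sequentially. indicator (exhaust n) u *\<^sub>R h u = indicator {0<..} u *\<^sub>R h u"
          using eventually_ge_at_top[of "max N1 N2"]
        proof eventually_elim
          case (elim n)
          have "inverse (real (Suc n)) \<le> inverse (real (Suc N1))"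
            using elim by (intro le_imp_inverse_le) auto
          then have "inverse (real (Suc n)) \<le> u"
            using N1 by (rule order_trans[OF _ less_imp_le])
          moreover have "u \<le> real (Suc n)"
            using elim N2 by simp
          ultimately have "u \<in> exhaust n"
            by (simp add: exhaust_def)
          with True show ?case by simp
        qed
        then show ?thesis by (rule tendsto_eventually)
      next
        case False
        then have "u \<notin> exhaust n" for n
          using exhaust_subset[of n] by auto
        with False show ?thesis by simp
      qed
    qed
  qed
  then show ?thesis
    by (simp add: eq set_lebesgue_integral_def)
qed

context vn_algebra
begin

text \<open>Membership in \<open>M\<close> consists of linear equations between values of bounded linear maps, which commute with
  the integral.\<close>

lemma integral_M:
  fixes g :: "real \<Rightarrow> 'h oper"
  assumes g: "continuous_on {a..b} g" and M: "\<And>u. u \<in> {a..b} \<Longrightarrow> g u \<in> M"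
  shows "integral {a..b} g \<in> M"
proof (rule MI)
  have lin: "L (integral {a..b} g) = L' (integral {a..b} g)"
    if "bounded_linear L" "bounded_linear L'" "\<And>u. u \<in> {a..b} \<Longrightarrow> L (g u) = L' (g u)"
    for L L' :: "'h oper \<Rightarrow> 'h"
  proof -
    have "L (integral {a..b} g) = integral {a..b} (L \<circ> g)"
      using integral_linear[OF integrable_continuous_real[OF g] that(1)] by simp
    also have "\<dots> = integral {a..b} (L' \<circ> g)"
      by (rule integral_cong) (simp add: that(3))
    also have "\<dots> = L' (integral {a..b} g)"
      using integral_linear[OF integrable_continuous_real[OF g] that(2)] by simp
    finally show ?thesis .
  qed
  show "integral {a..b} g (c *\<^sub>C x) = c *\<^sub>C integral {a..b} g x" for c x
    by (rule lin)
      (auto intro!: blinfun.bounded_linear_left bounded_linear_compose[OF bounded_linear_scaleC]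
        simp: M_apply_scaleC M)
  show "b' (integral {a..b} g x) = integral {a..b} g (b' x)" if "b' \<in> commutant M" for b' x
    by (rule lin)
      (use that M in \<open>auto intro!: blinfun.bounded_linear_left
        bounded_linear_compose[OF blinfun.bounded_linear_right] simp: M_commute[of "g _"]\<close>)
qed

text \<open>The integrals over a compact exhaustion form a norm Cauchy sequence, dominated by those
  of \<open>m\<close>.\<close>

lemma weak_integral_exists:
  fixes g :: "real \<Rightarrow> 'h oper"
  assumes M: "\<And>u. u > 0 \<Longrightarrow> g u \<in> M" and g: "continuous_on {0<..} g"
    and m: "set_integrable lborel {0<..} m" "continuous_on {0<..} m"
    and le: "\<And>u. u > 0 \<Longrightarrow> norm (g u) \<le> m u"
  shows "\<exists>b\<in>M. \<forall>\<xi> \<eta>. l2_seq \<xi> \<and> l2_seq \<eta> \<longrightarrow>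
    has_bochner_integral (restrict_space lborel {0<..})
      (\<lambda>u. vec_functional \<xi> \<eta> (g u)) (vec_functional \<xi> \<eta> b)"
proof -
  define b where "b n = integral (exhaust n) g" for n
  define I where "I n = integral (exhaust n) m" for n
  have m0: "m u \<ge> 0" if "u > 0" for u
    using le[OF that] norm_ge_zero order_trans by blast
  have "I \<longlonglongrightarrow> (LINT u:{0<..}|lborel. m u)"
    unfolding I_def by (rule integral_exhaust_tendsto[OF m(2,1)]) (simp add: m0)
  then have I: "Cauchy I"
    by (rule LIMSEQ_imp_Cauchy)
  have sub: "continuous_on {c..d} g" "continuous_on {c..d} m" if "c > 0" for c d
    using that by (auto intro: continuous_on_subset[OF g] continuous_on_subset[OF m(2)])
  have diff: "norm (b j - b i) \<le> I j - I i" if "i \<le> j" for i j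
  proof -
    define l where "l n = inverse (real (Suc n))" for n
    define r where "r n = real (Suc n)" for n
    have lr: "0 < l j" "l j \<le> l i" "l i \<le> r i" "r i \<le> r j"
      using that by (auto simp: l_def r_def field_simps)
    have split: "integral (exhaust j) h = integral {l j..l i} h + integral (exhaust i) h + integral {r i..r j} h"
      if "\<And>c d. c > 0 \<Longrightarrow> h integrable_on {c..d}" for h :: "real \<Rightarrow> 'b::banach"
    proof -
      have "integral {l j..r j} h = integral {l j..l i} h + integral {l i..r j} h"
        by (rule Henstock_Kurzweil_Integration.integral_combine[symmetric])
          (use lr that in auto)
      also have "integral {l i..r j} h = integral {l i..r i} h + integral {r i..r j} h"
        by (rule Henstock_Kurzweil_Integration.integral_combine[symmetric])
          (use lr that in auto)
      finally show ?thesis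
        by (simp only: exhaust_def l_def r_def add.assoc)
    qed
    have ig: "g integrable_on {c..d}" "m integrable_on {c..d}" if "c > 0" for c d
      using sub[OF that] by (auto intro: integrable_continuous_real)
    have bound: "norm (integral {c..d} g) \<le> integral {c..d} m" if "c > 0" for c d
      using that le by (intro Henstock_Kurzweil_Integration.integral_norm_bound_integral ig) auto
    have "norm (b j - b i) = norm (integral {l j..l i} g + integral {r i..r j} g)"
      using split[of g] ig(1) by (simp add: b_def)
    also have "\<dots> \<le> integral {l j..l i} m + integral {r i..r j} m"
      using lr by (intro norm_triangle_le add_mono bound) auto
    also have "\<dots> = I j - I i"
      using split[of m] ig(2) by (simp add: I_def)
    finally show ?thesis .
  qed
  have "Cauchy b"
  proof (rule metric_CauchyI)
    fix e :: real
    assume "e > 0"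
    then obtain N where N: "\<And>i j. i \<ge> N \<Longrightarrow> j \<ge> N \<Longrightarrow> dist (I i) (I j) < e"
      using I metric_CauchyD by blast
    have "dist (b i) (b j) < e" if "i \<ge> N" "j \<ge> N" for i j
    proof (cases "i \<le> j")
      case True
      then show ?thesis
        using diff[of i j] N[OF that] by (simp add: dist_norm norm_minus_commute)
    next
      case False
      then show ?thesis
        using diff[of j i] N[OF that] by (simp add: dist_norm)
    qed
    then show "\<exists>N. \<forall>i\<ge>N. \<forall>j\<ge>N. dist (b i) (b j) < e" by blast
  qed
  then obtain B where B: "b \<longlonglongrightarrow> B"
    using Cauchy_convergent convergent_def by blast
  have bM: "b n \<in> M" for n
    unfolding b_def exhaust_def
    by (rule integral_M) (auto intro!: sub M intro: less_le_trans[rotated])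
  have "B \<in> M"
    by (rule closed_sequentially[OF M_closed bM B])
  moreover have "has_bochner_integral (restrict_space lborel {0<..})
      (\<lambda>u. vec_functional \<xi> \<eta> (g u)) (vec_functional \<xi> \<eta> B)" if "l2_seq \<xi>" "l2_seq \<eta>" for \<xi> \<eta>
  proof -
    define L where "L = vec_functional \<xi> \<eta>"
    have "bounded_linear L"
      unfolding L_def by (rule bounded_linear_vec_functional[OF that])
    then interpret L: bounded_linear L .
    obtain K where K: "K > 0" "\<And>a. norm (L a) \<le> norm a * K"
      using L.pos_bounded by blast
    have Lg: "continuous_on {0<..} (\<lambda>u. L (g u))"
      by (rule L.continuous_on[OF g])
    have mK: "set_integrable lborel {0<..} (\<lambda>u. m u * K)"
      using m(1) by simp
    have LgK: "norm (L (g u)) \<le> m u * K" if "u > 0" for u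
      using K(2)[of "g u"] le[OF that] K(1) by (meson mult_right_mono less_imp_le order_trans)
    have "(\<lambda>n. integral (exhaust n) (\<lambda>u. L (g u))) \<longlonglongrightarrow> (LINT u:{0<..}|lborel. L (g u))"
      by (rule integral_exhaust_tendsto[OF Lg mK LgK])
    moreover have "integral (exhaust n) (\<lambda>u. L (g u)) = L (b n)" for n
      unfolding b_def exhaust_def
      using integral_linear[OF integrable_continuous_real[OF sub(1)] \<open>bounded_linear L\<close>,
          of "inverse (real (Suc n))" "real (Suc n)"]
      by (simp add: o_def)
    ultimately have "(\<lambda>n. L (b n)) \<longlonglongrightarrow> (LINT u:{0<..}|lborel. L (g u))"
      by simp
    moreover have "(\<lambda>n. L (b n)) \<longlonglongrightarrow> L B"
      by (rule L.tendsto[OF B])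
    ultimately have "(LINT u:{0<..}|lborel. L (g u)) = L B"
      by (rule LIMSEQ_unique)
    moreover have "set_integrable lborel {0<..} (\<lambda>u. L (g u))"
      by (rule set_integrable_halfline_bound[OF Lg mK LgK])
    ultimately show ?thesis
      by (subst has_bochner_integral_restrict_space)
        (simp_all add: has_bochner_integral_iff set_integrable_def set_lebesgue_integral_def L_def)
  qed
  ultimately show ?thesis by blast
qed

text \<open>The functionals \<open>\<langle>\<cdot> x, y\<rangle>\<close> separate operators, so the description in \<open>weak_star_integral\<close> is unique.\<close>

lemma weak_star_integral_eqI:
  assumes "b \<in> M" and "\<And>\<xi> \<eta>. l2_seq \<xi> \<Longrightarrow> l2_seq \<eta> \<Longrightarrow>
      has_bochner_integral \<mu> (\<lambda>u. vec_functional \<xi> \<eta> (g u)) (vec_functional \<xi> \<eta> b)"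
  shows "weak_star_integral M \<mu> g = b"
  unfolding weak_star_integral_def
proof (rule the_equality)
  fix b'
  assume b': "b' \<in> M \<and> (\<forall>\<xi> \<eta>. l2_seq \<xi> \<and> l2_seq \<eta> \<longrightarrow>
    has_bochner_integral \<mu> (\<lambda>u. vec_functional \<xi> \<eta> (g u)) (vec_functional \<xi> \<eta> b'))"
  have "cinner (b' x) y = cinner (b x) y" for x y
    using b' assms(2)[OF l2_seq_single[of x] l2_seq_single[of y]] l2_seq_single[of x] l2_seq_single[of y]
    unfolding vec_functional_single[symmetric] by (blast intro: has_bochner_integral_eq)
  then show "b' = b"
    by (intro blinfun_eqI cinner_eqI) (simp only: Re_cinner_commute[of _ "blinfun_apply _ _"])
qed (use assms in auto)

end

section \<open>The Poisson kernel\<close>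

definition poisson_kernel :: "real \<Rightarrow> real \<Rightarrow> real" where
  "poisson_kernel t u = 1 / (2 * sqrt pi) * (t * exp (- t\<^sup>2 / (4 * u)) * u powr (- 3 / 2))"

lemma poisson_kernel_nonneg: "t \<ge> 0 \<Longrightarrow> poisson_kernel t u \<ge> 0"
  by (simp add: poisson_kernel_def)

lemma continuous_on_poisson_kernel: "continuous_on {0<..} (poisson_kernel t)"
  unfolding poisson_kernel_def by (intro continuous_intros) auto

lemma poisson_kernel_scaling:
  assumes "t > 0" "v > 0"
  shows "poisson_kernel t (t\<^sup>2 * v) = poisson_kernel 1 v / t\<^sup>2"
proof -
  have "(t\<^sup>2 * v) powr (- 3 / 2) = v powr (- 3 / 2) / t ^ 3"
  proof -
    have "(t\<^sup>2) powr (- 3 / 2) = t powr (- 3)"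
      using assms by (simp add: powr_powr flip: powr_numeral)
    also have "\<dots> = 1 / t ^ 3"
      using assms by (simp add: powr_minus divide_inverse powr_numeral)
    finally show ?thesis
      using assms by (simp add: powr_mult)
  qed
  then show ?thesis
    using assms by (simp add: poisson_kernel_def field_simps power2_eq_square power3_eq_cube)
qed

text \<open>Since \<open>(1 + 1/v)\<^sup>2 \<le> 64 exp (1/(4v))\<close>, the function \<open>exp (-1/(4v)) v\<^sup>-\<^sup>1\<^sup>-\<^sup>s\<close> is dominated by
  \<open>64 (1 + v)\<^sup>-\<^sup>1\<^sup>-\<^sup>s\<close>, which has the bounded antiderivative \<open>-64 (1 + v)\<^sup>-\<^sup>s / s\<close>.\<close>

lemma poisson_kernel_moment_integrable:
  assumes \<gamma>: "0 \<le> \<gamma>" "\<gamma> < 1 / 2"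
  shows "set_integrable lborel {0<..} (\<lambda>v. poisson_kernel 1 v * v powr \<gamma>)"
proof (rule set_integrable_halfline_bound)
  define s where "s = 1 / 2 - \<gamma>"
  have s: "0 < s" "s \<le> 1 / 2"
    using \<gamma> by (auto simp: s_def)
  show "continuous_on {0<..} (\<lambda>v. poisson_kernel 1 v * v powr \<gamma>)"
    by (intro continuous_intros continuous_on_poisson_kernel) auto
  have "set_integrable lborel (einterval 0 \<infinity>) (\<lambda>v. (1 + v) powr (- 1 - s))"
  proof (rule interval_integral_FTC_nonneg(1))
    define F where "F v = - ((1 + v) powr (- s)) / s" for v :: real
    show "DERIV F v :> (1 + v) powr (- 1 - s)" if "0 < ereal v" for v
    proof -
      have "DERIV (\<lambda>v. 1 + v) v :> 0 + 1"
        by (intro derivative_intros)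
      then have "DERIV (\<lambda>v. (1 + v) powr (- s)) v :> (- s) * (1 + v) powr (- s - 1) * (0 + 1)"
        using that by (intro DERIV_chain2[OF has_real_derivative_powr]) auto
      then have "DERIV F v :> - ((- s) * (1 + v) powr (- s - 1) * (0 + 1)) / s"
        unfolding F_def by (intro DERIV_cdivide DERIV_minus)
      moreover have "- s - 1 = - 1 - s" by simp
      ultimately show ?thesis using s by simp
    qed
    show "isCont (\<lambda>v. (1 + v) powr (- 1 - s)) v" if "0 < ereal v" for v
      using that by (intro continuous_intros) auto
    have "isCont F 0"
      unfolding F_def by (intro continuous_intros) (use s in auto)
    then have "(F \<longlongrightarrow> F 0) (at_right 0)"
      unfolding isCont_def by (rule filterlim_mono[OF _ order_refl at_le]) simp
    then show "((F \<circ> real_of_ereal) \<longlongrightarrow> F 0) (at_right 0)"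
      by (simp add: ereal_tendsto_simps zero_ereal_def)
    have "(F \<longlongrightarrow> - 0 / s) at_top"
      unfolding F_def
      by (intro tendsto_intros tendsto_neg_powr filterlim_tendsto_add_at_top[OF tendsto_const]
          filterlim_ident) (use s in auto)
    then show "((F \<circ> real_of_ereal) \<longlongrightarrow> - 0 / s) (at_left \<infinity>)"
      by (simp add: ereal_tendsto_simps)
  qed auto
  moreover have "einterval 0 \<infinity> = {0::real<..}"
    by (auto simp: einterval_def)
  ultimately show "set_integrable lborel {0<..} (\<lambda>v. 64 * (1 + v) powr (- 1 - s))"
    by simp
  show "norm (poisson_kernel 1 v * v powr \<gamma>) \<le> 64 * (1 + v) powr (- 1 - s)" if v: "v > 0" for v
  proof -
    have "(1 + 1 / v) powr (1 + s) \<le> (1 + 1 / v) powr 2"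
      using v s by (intro powr_mono) auto
    also have "\<dots> = (1 + 1 / v)\<^sup>2"
      using v by (simp add: powr_numeral add_pos_pos)
    also have "\<dots> \<le> (8 * exp (1 / v / 8))\<^sup>2"
    proof (rule power_mono)
      have "1 + x \<le> 8 * exp (x / 8)" if "x > 0" for x :: real
        using exp_ge_add_one_self[of "x / 8"] that by linarith
      from this[of "1 / v"] show "1 + 1 / v \<le> 8 * exp (1 / v / 8)"
        using v by simp
    qed (use v in simp)
    also have "\<dots> = 64 * exp (1 / (4 * v))"
      by (simp add: power_mult_distrib exp_double[symmetric])
    finally have main: "(1 + 1 / v) powr (1 + s) \<le> 64 * exp (1 / (4 * v))" .
    have "1 + v = v * (1 + 1 / v)"
      using v by (simp add: field_simps)
    then have "(1 + v) powr (1 + s) = v powr (1 + s) * (1 + 1 / v) powr (1 + s)"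
      using v by (simp add: powr_mult)
    also have "\<dots> \<le> v powr (1 + s) * (64 * exp (1 / (4 * v)))"
      by (intro mult_left_mono main) simp
    finally have "exp (- 1 / (4 * v)) * v powr (- 1 - s) \<le> 64 * (1 + v) powr (- 1 - s)"
    proof -
      assume *: "(1 + v) powr (1 + s) \<le> v powr (1 + s) * (64 * exp (1 / (4 * v)))"
      have "exp (- 1 / (4 * v)) * v powr (- (1 + s)) \<le> 64 * (1 + v) powr (- (1 + s))"
      proof -
        have inv: "1 / e * inverse B \<le> 64 * inverse A"
          if "A > 0" "B > 0" "e > 0" "A \<le> B * (64 * e)" for A B e :: real
          using that by (simp add: field_simps)
        have e: "exp (- 1 / (4 * v)) = 1 / exp (1 / (4 * v))"
          by (simp only: minus_divide_left[symmetric] exp_minus inverse_eq_divide)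
        show ?thesis
          unfolding powr_minus e by (rule inv[OF _ _ _ *]) (use v in auto)
      qed
      then show ?thesis by simp
    qed
    moreover have "poisson_kernel 1 v * v powr \<gamma>
        = 1 / (2 * sqrt pi) * (exp (- 1 / (4 * v)) * v powr (- 1 - s))"
      by (simp add: poisson_kernel_def s_def powr_add[symmetric] mult.assoc)
    moreover have "1 / (2 * sqrt pi) \<le> 1"
    proof -
      have "2 * 1 \<le> 2 * sqrt pi"
        by (rule mult_left_mono) (use pi_gt3 in auto)
      then have "1 \<le> 2 * sqrt pi"
        by (rule order_trans[rotated]) simp
      then show ?thesis by (simp add: divide_le_eq)
    qed
    moreover have "0 \<le> exp (- 1 / (4 * v)) * v powr (- 1 - s)"
      by simp
    ultimately show ?thesis
      using mult_right_mono[of "1 / (2 * sqrt pi)" 1 "exp (- 1 / (4 * v)) * v powr (- 1 - s)"]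
      by simp
  qed
qed

lemma poisson_kernel_integrable: "set_integrable lborel {0<..} (poisson_kernel 1)"
proof -
  have "set_integrable lborel {0<..} (\<lambda>v. poisson_kernel 1 v * v powr 0)"
    by (rule poisson_kernel_moment_integrable) auto
  then show ?thesis
    by (subst set_integrable_cong[OF refl]) (auto simp: powr_zero_eq_one)
qed

text \<open>With \<open>E(x) = \<integral>\<^sub>0\<^sup>x exp (-y\<^sup>2) dy\<close>, the kernel is the derivative of
  \<open>- 2 E (1 / (2 sqrt v)) / sqrt pi\<close>.\<close>

lemma poisson_kernel_integral: "(LINT v:{0<..}|lborel. poisson_kernel 1 v) = 1"
proof -
  define E where "E x = integral {0..x} (\<lambda>y::real. exp (- y\<^sup>2))" for x
  have E_deriv: "DERIV E x :> exp (- x\<^sup>2)" if "x > 0" for x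
  proof -
    have "(E has_vector_derivative exp (- x\<^sup>2)) (at x within {0..x + 1})"
      unfolding E_def by (rule integral_has_vector_derivative) (use that in \<open>auto intro!: continuous_intros\<close>)
    moreover have "at x within {0..x + 1} = at x"
      by (rule at_within_interior) (use that in simp)
    ultimately show ?thesis
      by (simp add: has_real_derivative_iff_has_vector_derivative)
  qed
  have E_0: "(E \<longlongrightarrow> 0) (at_right 0)"
  proof -
    have "continuous_on {0..1} E"
      unfolding E_def
      by (intro indefinite_integral_continuous_1 integrable_continuous_real continuous_intros)
    then have "(E \<longlongrightarrow> E 0) (at 0 within {0..1})"
      by (simp add: continuous_on_def)
    then show ?thesis
      by (simp add: at_within_Icc_at_right E_def)
  qed
  have E_top: "(E \<longlongrightarrow> sqrt pi / 2) at_top"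
  proof -
    let ?f = "\<lambda>x::real. indicator {0..} x *\<^sub>R exp (- x\<^sup>2)"
    have f: "integrable lborel ?f" "(LINT x|lborel. ?f x) = sqrt pi / 2"
      using gaussian_moment_0 by (auto simp: has_bochner_integral_iff)
    have "((\<lambda>y. LINT x|lborel. indicator {..y} x *\<^sub>R ?f x) \<longlongrightarrow> sqrt pi / 2) at_top"
      unfolding f(2)[symmetric] by (rule tendsto_integral_at_top[OF _ f(1)]) simp
    moreover have "(LINT x|lborel. indicator {..y} x *\<^sub>R ?f x) = E y" for y
    proof -
      have "set_integrable lborel {0..y} (\<lambda>x. exp (- x\<^sup>2))"
        by (intro borel_integrable_atLeastAtMost' continuous_intros)
      then have "E y = (LINT x:{0..y}|lborel. exp (- x\<^sup>2))"
        unfolding E_def by (simp add: set_borel_integral_eq_integral)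
      also have "\<dots> = (LINT x|lborel. indicator {..y} x *\<^sub>R ?f x)"
        unfolding set_lebesgue_integral_def
        by (intro Bochner_Integration.integral_cong) (auto simp: indicator_def)
      finally show ?thesis by simp
    qed
    ultimately show ?thesis by simp
  qed
  define F where "F v = - (2 / sqrt pi) * E (1 / (2 * sqrt v))" for v
  have "(LBINT v=0..\<infinity>. poisson_kernel 1 v) = 0 - - 1"
  proof (rule interval_integral_FTC_nonneg(2))
    show "DERIV F v :> poisson_kernel 1 v" if "0 < ereal v" for v
    proof -
      have v: "v > 0" using that by simp
      have "DERIV (\<lambda>v. 1 / (2 * sqrt v)) v :> - 1 / (4 * (v * sqrt v))"
        using v by (auto intro!: derivative_eq_intros simp: field_simps)
      then have "DERIV (\<lambda>v. E (1 / (2 * sqrt v))) v :>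
          exp (- (1 / (2 * sqrt v))\<^sup>2) * (- 1 / (4 * (v * sqrt v)))"
        using v by (intro DERIV_chain2[OF E_deriv]) auto
      then have "DERIV F v :>
          - (2 / sqrt pi) * (exp (- (1 / (2 * sqrt v))\<^sup>2) * (- 1 / (4 * (v * sqrt v))))"
        unfolding F_def by (rule DERIV_cmult)
      moreover have "v powr (- 3 / 2) = 1 / (v * sqrt v)"
      proof -
        have "v powr (- 3 / 2) = v powr (- 1 - 1 / 2)" by simp
        also have "\<dots> = 1 / (v * sqrt v)"
          using v by (simp only: powr_diff powr_minus powr_half_sqrt) (simp add: field_simps)
        finally show ?thesis .
      qed
      ultimately show ?thesis
        using v by (simp add: poisson_kernel_def power_divide power_mult_distrib mult_ac)
    qed
    show "isCont (poisson_kernel 1) v" if "0 < ereal v" for v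
      using continuous_on_poisson_kernel[of 1] that
      by (simp add: continuous_on_eq_continuous_at)
    have "((\<lambda>v. 2 * sqrt v) \<longlongrightarrow> 2 * sqrt 0) (at_right 0)"
      by (intro tendsto_intros)
    then have "filterlim (\<lambda>v. 2 * sqrt v) (at_right 0) (at_right 0)"
      by (intro tendsto_imp_filterlim_at_right)
        (auto intro!: eventually_mono[OF eventually_at_right_less])
    then have "filterlim (\<lambda>v. 1 / (2 * sqrt v)) at_top (at_right 0)"
      using filterlim_compose[OF filterlim_inverse_at_top_right] by (simp add: inverse_eq_divide)
    then have "(F \<longlongrightarrow> - (2 / sqrt pi) * (sqrt pi / 2)) (at_right 0)"
      unfolding F_def by (intro tendsto_intros filterlim_compose[OF E_top])
    then show "((F \<circ> real_of_ereal) \<longlongrightarrow> - 1) (at_right 0)"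
      by (simp add: ereal_tendsto_simps zero_ereal_def)
    have "filterlim (\<lambda>v. 2 * sqrt v) at_top at_top"
      by (intro filterlim_tendsto_pos_mult_at_top[OF tendsto_const _ sqrt_at_top]) simp
    then have "filterlim (\<lambda>v. 1 / (2 * sqrt v)) (at_right 0) at_top"
      by (intro tendsto_imp_filterlim_at_right tendsto_divide_0[OF tendsto_const]
          filterlim_at_top_imp_at_infinity)
        (auto intro!: eventually_mono[OF eventually_gt_at_top])
    then have "(F \<longlongrightarrow> - (2 / sqrt pi) * 0) at_top"
      unfolding F_def by (intro tendsto_intros filterlim_compose[OF E_0])
    then show "((F \<circ> real_of_ereal) \<longlongrightarrow> 0) (at_left \<infinity>)"
      by (simp add: ereal_tendsto_simps)
  qed (auto simp: poisson_kernel_nonneg)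
  moreover have "einterval 0 \<infinity> = {0::real<..}"
    by (auto simp: einterval_def)
  ultimately show ?thesis
    by (simp add: interval_lebesgue_integral_def)
qed

abbreviation halfline :: "real measure" where
  "halfline \<equiv> restrict_space lborel {0<..}"

lemma has_bochner_integral_halfline_scaling:
  fixes h :: "real \<Rightarrow> 'b::{banach,second_countable_topology}"
  assumes c: "c > 0"
  shows "has_bochner_integral halfline h I \<longleftrightarrow> has_bochner_integral halfline (\<lambda>v. c *\<^sub>R h (c * v)) I"
proof -
  have scale: "has_bochner_integral lborel F (I /\<^sub>R c) \<longleftrightarrow> has_bochner_integral lborel (\<lambda>v. c *\<^sub>R F v) I"
    for F :: "real \<Rightarrow> 'b"
  proof
    assume "has_bochner_integral lborel F (I /\<^sub>R c)"
    then have "has_bochner_integral lborel (\<lambda>v. c *\<^sub>R F v) (c *\<^sub>R (I /\<^sub>R c))"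
      by (intro has_bochner_integral_scaleR_right)
    then show "has_bochner_integral lborel (\<lambda>v. c *\<^sub>R F v) I"
      using c by simp
  next
    assume "has_bochner_integral lborel (\<lambda>v. c *\<^sub>R F v) I"
    then have "has_bochner_integral lborel (\<lambda>v. inverse c *\<^sub>R (c *\<^sub>R F v)) (inverse c *\<^sub>R I)"
      by (intro has_bochner_integral_scaleR_right)
    then show "has_bochner_integral lborel F (I /\<^sub>R c)"
      using c by simp
  qed
  have ind: "indicator {0<..} (0 + c * v) = (indicator {0<..} v :: real)" for v
    using c by (simp add: indicator_def zero_less_mult_iff)
  have "has_bochner_integral halfline h I \<longleftrightarrow>
      has_bochner_integral lborel (\<lambda>u. indicator {0<..} u *\<^sub>R h u) I"
    by (rule has_bochner_integral_restrict_space) simp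
  also have "\<dots> \<longleftrightarrow> has_bochner_integral lborel (\<lambda>v. indicator {0<..} v *\<^sub>R h (c * v)) (I /\<^sub>R c)"
    using c by (subst lborel_has_bochner_integral_real_affine_iff[of c _ _ 0]) (simp_all only: ind, simp_all)
  also have "\<dots> \<longleftrightarrow> has_bochner_integral lborel (\<lambda>v. indicator {0<..} v *\<^sub>R (c *\<^sub>R h (c * v))) I"
    unfolding scale by (simp add: mult.commute)
  also have "\<dots> \<longleftrightarrow> has_bochner_integral halfline (\<lambda>v. c *\<^sub>R h (c * v)) I"
    by (rule has_bochner_integral_restrict_space[symmetric]) simp
  finally show ?thesis .
qed

lemma integrable_halfline_iff: "integrable halfline h \<longleftrightarrow> set_integrable lborel {0<..} h"
  for h :: "real \<Rightarrow> 'b::{banach,second_countable_topology}"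
  by (subst integrable_restrict_space) (simp_all add: set_integrable_def)

lemma integral_halfline: "integral\<^sup>L halfline h = (LINT v:{0<..}|lborel. h v)"
  for h :: "real \<Rightarrow> 'b::{banach,second_countable_topology}"
  by (subst integral_restrict_space) (simp_all add: set_lebesgue_integral_def)

abbreviation kappa :: "real \<Rightarrow> real" ("\<kappa>") where
  "\<kappa> \<equiv> poisson_kernel 1"

definition kernel_moment :: "real \<Rightarrow> real" where
  "kernel_moment \<gamma> = (LINT v|halfline. \<kappa> v * v powr \<gamma>)"

lemma has_bochner_integral_kernel_moment:
  "0 \<le> \<gamma> \<Longrightarrow> \<gamma> < 1 / 2 \<Longrightarrow>
    has_bochner_integral halfline (\<lambda>v. \<kappa> v * v powr \<gamma>) (kernel_moment \<gamma>)"
  by (simp add: has_bochner_integral_iff kernel_moment_def integrable_halfline_iff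
      poisson_kernel_moment_integrable)

lemma has_bochner_integral_kernel: "has_bochner_integral halfline \<kappa> 1"
  by (simp add: has_bochner_integral_iff integrable_halfline_iff integral_halfline
      poisson_kernel_integrable poisson_kernel_integral)

text \<open>After this substitution the density no longer depends on \<open>t\<close>.\<close>

lemma poisson_kernel_scaleR_scaling:
  fixes h :: "real \<Rightarrow> 'b::{banach,second_countable_topology}"
  assumes t: "t > 0"
  shows "has_bochner_integral halfline (\<lambda>u. poisson_kernel t u *\<^sub>R h u) I \<longleftrightarrow>
    has_bochner_integral halfline (\<lambda>v. \<kappa> v *\<^sub>R h (t\<^sup>2 * v)) I"
proof -
  have "has_bochner_integral halfline (\<lambda>u. poisson_kernel t u *\<^sub>R h u) I \<longleftrightarrow>
    has_bochner_integral halfline (\<lambda>v. t\<^sup>2 *\<^sub>R (poisson_kernel t (t\<^sup>2 * v) *\<^sub>R h (t\<^sup>2 * v))) I"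
    using t by (intro has_bochner_integral_halfline_scaling) simp
  also have "\<dots> \<longleftrightarrow> has_bochner_integral halfline (\<lambda>v. \<kappa> v *\<^sub>R h (t\<^sup>2 * v)) I"
    by (rule has_bochner_integral_cong) (use t in \<open>simp_all add: poisson_kernel_scaling\<close>)
  finally show ?thesis .
qed

text \<open>The triangle inequality for weak integrals, tested on all scalar products.\<close>

lemma norm_weak_integral_le:
  fixes b :: "'h::chilbert_space oper" and g :: "real \<Rightarrow> 'h oper"
  assumes b: "\<And>x y :: 'h. has_bochner_integral halfline (\<lambda>v. \<kappa> v * Re (cinner (g v x) y)) (Re (cinner (b x) y))"
    and g: "\<And>v. v > 0 \<Longrightarrow> norm (g v) \<le> w v"
    and W: "has_bochner_integral halfline (\<lambda>v. \<kappa> v * w v) W"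
  shows "norm b \<le> W"
proof (rule norm_oper_le)
  have w: "0 \<le> w v" if "v > 0" for v
    using g[OF that] norm_ge_zero order_trans by blast
  have W': "W = (LINT v|halfline. \<kappa> v * w v)"
    using W by (simp add: has_bochner_integral_iff)
  show "0 \<le> W"
    unfolding W' by (intro integral_nonneg_AE AE_I2) (simp add: poisson_kernel_nonneg w)
  fix x y :: 'h
  have xy: "has_bochner_integral halfline (\<lambda>v. \<kappa> v * w v * (norm x * norm y)) (W * (norm x * norm y))"
    by (intro has_bochner_integral_mult_left W)
  have "Re (cinner (b x) y) = (LINT v|halfline. \<kappa> v * Re (cinner (g v x) y))"
    using b[of x y] by (simp add: has_bochner_integral_iff)
  also have "\<dots> \<le> (LINT v|halfline. \<kappa> v * w v * (norm x * norm y))"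
  proof (rule integral_mono)
    show "integrable halfline (\<lambda>v. \<kappa> v * Re (cinner (g v x) y))"
      using b[of x y] by (simp add: has_bochner_integral_iff)
    show "integrable halfline (\<lambda>v. \<kappa> v * w v * (norm x * norm y))"
      using xy by (simp only: has_bochner_integral_iff)
    fix v
    assume "v \<in> space halfline"
    then have v: "v > 0" by (simp add: space_restrict_space)
    have "Re (cinner (g v x) y) \<le> norm (g v x) * norm y"
      by (rule Re_cinner_le)
    also have "\<dots> \<le> (norm (g v) * norm x) * norm y"
      by (intro mult_right_mono norm_blinfun) simp
    also have "\<dots> \<le> (w v * norm x) * norm y"
      by (intro mult_right_mono g v) simp_all
    finally have "\<kappa> v * Re (cinner (g v x) y) \<le> \<kappa> v * ((w v * norm x) * norm y)"
      by (intro mult_left_mono poisson_kernel_nonneg) simp_all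
    then show "\<kappa> v * Re (cinner (g v x) y) \<le> \<kappa> v * w v * (norm x * norm y)"
      by (simp only: mult.assoc)
  qed
  also have "\<dots> = W * norm x * norm y"
    using xy by (simp only: has_bochner_integral_iff mult.assoc)
  finally show "Re (cinner (b x) y) \<le> W * norm x * norm y" .
qed

section \<open>The subordinated semigroup\<close>

context quantum_markov
begin

lemma poisson_vec_functional_aux:
  assumes f: "f \<in> M" and t: "t > 0"
  shows "poisson M T t f \<in> M \<and> (\<forall>\<xi> \<eta>. l2_seq \<xi> \<and> l2_seq \<eta> \<longrightarrow>
    has_bochner_integral halfline (\<lambda>v. \<kappa> v *\<^sub>R vec_functional \<xi> \<eta> (T (t\<^sup>2 * v) f))
      (vec_functional \<xi> \<eta> (poisson M T t f)))"
proof -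
  define g where "g u = poisson_kernel t u *\<^sub>R T u f" for u
  have "has_bochner_integral halfline (poisson_kernel t) 1"
    using poisson_kernel_scaleR_scaling[OF t, of "\<lambda>_. 1 :: real" 1] has_bochner_integral_kernel
    by simp
  then have int: "set_integrable lborel {0<..} (\<lambda>u. poisson_kernel t u * norm f)"
    using integrable_halfline_iff[of "poisson_kernel t"] by (auto simp: has_bochner_integral_iff)
  have le: "norm (g u) \<le> poisson_kernel t u * norm f" if "u > 0" for u
    unfolding g_def using that t
    by (simp add: abs_of_nonneg poisson_kernel_nonneg mult_left_mono T_contraction f)
  have "\<exists>b\<in>M. \<forall>\<xi> \<eta>. l2_seq \<xi> \<and> l2_seq \<eta> \<longrightarrow>
    has_bochner_integral halfline (\<lambda>u. vec_functional \<xi> \<eta> (g u)) (vec_functional \<xi> \<eta> b)"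
  proof (rule weak_integral_exists[OF _ _ int _ le])
    show "g u \<in> M" if "u > 0" for u
      unfolding g_def using that by (intro M_scaleR T_M f) simp
    show "continuous_on {0<..} g"
      unfolding g_def by (intro continuous_intros continuous_on_poisson_kernel orbit_continuous f)
    show "continuous_on {0<..} (\<lambda>u. poisson_kernel t u * norm f)"
      by (intro continuous_intros continuous_on_poisson_kernel)
  qed
  then obtain b where b: "b \<in> M" "\<And>\<xi> \<eta>. l2_seq \<xi> \<Longrightarrow> l2_seq \<eta> \<Longrightarrow>
    has_bochner_integral halfline (\<lambda>u. vec_functional \<xi> \<eta> (g u)) (vec_functional \<xi> \<eta> b)"
    by blast
  have eq: "poisson M T t f = b"
    using t weak_star_integral_eqI[OF b]
    by (simp add: poisson_def g_def[abs_def] poisson_kernel_def)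
  show ?thesis
    unfolding eq
  proof (intro conjI allI impI b(1))
    fix \<xi> \<eta> :: "nat \<Rightarrow> 'h"
    assume *: "l2_seq \<xi> \<and> l2_seq \<eta>"
    interpret L: bounded_linear "vec_functional \<xi> \<eta>"
      using * by (intro bounded_linear_vec_functional) auto
    show "has_bochner_integral halfline (\<lambda>v. \<kappa> v *\<^sub>R vec_functional \<xi> \<eta> (T (t\<^sup>2 * v) f))
        (vec_functional \<xi> \<eta> b)"
      by (rule poisson_kernel_scaleR_scaling[OF t, THEN iffD1])
        (use b(2)[of \<xi> \<eta>] * in \<open>simp add: g_def L.scaleR\<close>)
  qed
qed

lemma poisson_M: "t \<ge> 0 \<Longrightarrow> f \<in> M \<Longrightarrow> poisson M T t f \<in> M"
  using poisson_vec_functional_aux[of f t] by (cases "t = 0") (auto simp: poisson_def)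

lemma poisson_vec_functional:
  assumes "f \<in> M" "t > 0" "l2_seq \<xi>" "l2_seq \<eta>"
  shows "has_bochner_integral halfline (\<lambda>v. \<kappa> v *\<^sub>R vec_functional \<xi> \<eta> (T (t\<^sup>2 * v) f))
      (vec_functional \<xi> \<eta> (poisson M T t f))"
  using poisson_vec_functional_aux[OF assms(1,2)] assms(3,4) by blast

lemma has_bochner_integral_Re_cinner:
  assumes "\<And>\<xi> \<eta>. l2_seq \<xi> \<Longrightarrow> l2_seq \<eta> \<Longrightarrow>
    has_bochner_integral \<mu> (\<lambda>v. k v *\<^sub>R vec_functional \<xi> \<eta> (g v)) (vec_functional \<xi> \<eta> b)"
  shows "has_bochner_integral \<mu> (\<lambda>v. k v * Re (cinner (g v x) y)) (Re (cinner (b x) y))"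
  using has_bochner_integral_bounded_linear[OF bounded_linear_Re
      assms[OF l2_seq_single[of x] l2_seq_single[of y]]]
  by (simp add: vec_functional_single)

lemma poisson_form:
  assumes "f \<in> M" "t > 0"
  shows "has_bochner_integral halfline (\<lambda>v. \<kappa> v * Re (cinner (T (t\<^sup>2 * v) f x) y))
      (Re (cinner (poisson M T t f x) y))"
  by (rule has_bochner_integral_Re_cinner) (rule poisson_vec_functional[OF assms])

lemma poisson_contraction:
  assumes "f \<in> M" "t > 0"
  shows "norm (poisson M T t f) \<le> norm f"
proof (rule norm_weak_integral_le[OF poisson_form[OF assms]])
  show "norm (T (t\<^sup>2 * v) f) \<le> norm f" if "v > 0" for v
    using that by (intro T_contraction assms) simp
  show "has_bochner_integral halfline (\<lambda>v. \<kappa> v * norm f) (norm f)"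
    using has_bochner_integral_mult_left[OF has_bochner_integral_kernel, of "norm f"] by simp
qed

section \<open>The column Lipschitz norm\<close>

text \<open>Telescoping along \<open>u / 2\<^sup>n\<close>, whose orbit points converge to \<open>f\<close> in the weak-* topology.\<close>

lemma norm_diff_orbit_le:
  assumes f: "f \<in> M" and \<gamma>: "\<gamma> > 0" and K: "K \<ge> 0" and u: "u > 0"
    and step: "\<And>t. t > 0 \<Longrightarrow> norm (T t f - T (2 * t) f) \<le> K * t powr \<gamma>"
  shows "norm (f - T u f) \<le> (2 powr (- \<gamma>) / (1 - 2 powr (- \<gamma>))) * K * u powr \<gamma>"
proof -
  define q :: real where "q = 2 powr (- \<gamma>)"
  have q: "0 < q" "q < 1"
    using \<gamma> by (simp_all add: q_def powr_less_one)
  define C where "C = q / (1 - q) * K * u powr \<gamma>"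
  have C: "C \<ge> 0"
    using q K by (simp add: C_def)
  have tel: "norm (T (u / 2 ^ n) f - T u f) \<le> C * (1 - q ^ n)" for n
  proof (induction n)
    case (Suc n)
    have "norm (T (u / 2 ^ Suc n) f - T (2 * (u / 2 ^ Suc n)) f) \<le> K * (u / 2 ^ Suc n) powr \<gamma>"
      using u by (intro step) simp
    \<comment> \<open>the increments are the terms of a geometric series with ratio \<open>q\<close>\<close>
    also have "(u / 2 ^ Suc n) powr \<gamma> = q ^ Suc n * u powr \<gamma>"
    proof -
      have "(2 ^ Suc n :: real) powr \<gamma> = (2 powr \<gamma>) ^ Suc n"
      proof -
        have "(2 ^ Suc n :: real) powr \<gamma> = (2 powr real (Suc n)) powr \<gamma>"
          by (simp only: powr_realpow zero_less_numeral)
        also have "\<dots> = (2 powr \<gamma>) powr real (Suc n)"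
          by (simp only: powr_powr mult.commute)
        also have "\<dots> = (2 powr \<gamma>) ^ Suc n"
          by (rule powr_realpow) simp
        finally show ?thesis .
      qed
      then show ?thesis
        using u by (subst powr_divide)
          (simp_all only: q_def powr_minus power_inverse divide_inverse mult.commute less_imp_le
            zero_le_power zero_le_numeral)
    qed
    also have "K * (q ^ Suc n * u powr \<gamma>) = C * (q ^ n - q ^ Suc n)"
      using q by (simp add: C_def field_simps)
    finally have "norm (T (u / 2 ^ Suc n) f - T (u / 2 ^ n) f) \<le> C * (q ^ n - q ^ Suc n)"
      by simp
    then have "norm (T (u / 2 ^ Suc n) f - T u f) \<le> C * (q ^ n - q ^ Suc n) + C * (1 - q ^ n)"
      using Suc.IH norm_triangle_ineq[of "T (u / 2 ^ Suc n) f - T (u / 2 ^ n) f" "T (u / 2 ^ n) f - T u f"]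
      by simp
    then show ?case
      by (simp add: algebra_simps)
  qed (simp add: f)
  have "(\<lambda>n. u / 2 ^ n) \<longlonglongrightarrow> 0"
    using tendsto_mult_right_zero[OF LIMSEQ_realpow_zero[of "1/2 :: real"], of u]
    by (simp add: power_divide)
  then have lim: "filterlim (\<lambda>n. u / 2 ^ n) (at_right 0) sequentially"
    by (rule tendsto_imp_filterlim_at_right) (simp add: u)
  have "limitin (weak_star M) (\<lambda>n. T (u / 2 ^ n) f - T u f) (f - T u f) sequentially"
    unfolding limitin_weak_star_iff
  proof (intro conjI allI impI)
    show "f - T u f \<in> M" "\<forall>\<^sub>F n in sequentially. T (u / 2 ^ n) f - T u f \<in> M"
      using u by (auto intro!: M_diff T_M f always_eventually)
    fix \<xi> \<eta> :: "nat \<Rightarrow> 'h"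
    assume *: "l2_seq \<xi> \<and> l2_seq \<eta>"
    interpret L: bounded_linear "vec_functional \<xi> \<eta>"
      using * by (intro bounded_linear_vec_functional) auto
    have "((\<lambda>t. vec_functional \<xi> \<eta> (T t f)) \<longlongrightarrow> vec_functional \<xi> \<eta> f) (at_right 0)"
      using T_limit_0[OF f] * by (simp add: limitin_weak_star_iff)
    then have "(\<lambda>n. vec_functional \<xi> \<eta> (T (u / 2 ^ n) f)) \<longlonglongrightarrow> vec_functional \<xi> \<eta> f"
      by (rule filterlim_compose[OF _ lim])
    then show "(\<lambda>n. vec_functional \<xi> \<eta> (T (u / 2 ^ n) f - T u f)) \<longlonglongrightarrow> vec_functional \<xi> \<eta> (f - T u f)"
      unfolding L.diff by (intro tendsto_diff tendsto_const)
  qed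
  moreover have "norm (T (u / 2 ^ n) f - T u f) \<le> C" for n
  proof -
    have "C * (1 - q ^ n) \<le> C * 1"
      using C q by (intro mult_left_mono) auto
    with tel[of n] show ?thesis by simp
  qed
  ultimately have "norm (f - T u f) \<le> C"
    by (intro limitin_weak_star_norm_le[OF _ _ _ C]) auto
  then show ?thesis
    by (simp add: C_def q_def)
qed

text \<open>By the Kadison-Schwarz inequality \<open>\<parallel>T\<^sub>t f - T\<^sub>2\<^sub>t f\<parallel>\<^sup>2 \<le> \<parallel>T\<^sub>t |f - T\<^sub>t f|\<^sup>2\<parallel>\<close>.\<close>

lemma norm_orbit_step_le:
  assumes f: "f \<in> M" and t: "t > 0"
  shows "norm (T t f - T (2 * t) f) \<le> sqrt (norm (T t (abs_sq (f - T t f))))"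
proof (rule norm_blinfun_bound)
  fix x
  have d: "f - T t f \<in> M"
    using t by (intro M_diff T_M f) simp
  have "(norm ((T t f - T (2 * t) f) x))\<^sup>2 = (norm (T t (f - T t f) x))\<^sup>2"
    using t f by (simp add: T_diff T_M T_semigroup)
  also have "\<dots> \<le> Re (cinner (T t (abs_sq (f - T t f)) x) x)"
    using t by (intro kadison_schwarz_form d) simp
  also have "\<dots> \<le> norm (T t (abs_sq (f - T t f)) x) * norm x"
    by (rule Re_cinner_le)
  also have "\<dots> \<le> norm (T t (abs_sq (f - T t f))) * norm x * norm x"
    by (intro mult_right_mono norm_blinfun) simp
  also have "\<dots> = (sqrt (norm (T t (abs_sq (f - T t f)))) * norm x)\<^sup>2"
    by (simp add: power_mult_distrib power2_eq_square)
  finally show "norm ((T t f - T (2 * t) f) x) \<le> sqrt (norm (T t (abs_sq (f - T t f)))) * norm x"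
    by (rule power2_le_imp_le) simp
qed simp

theorem poisson_Lc_bound:
  assumes f: "f \<in> M" and \<alpha>: "0 < \<alpha>" "\<alpha> < 1" and K: "K \<ge> 0" and t: "t > 0"
    and bound: "\<And>t. t > 0 \<Longrightarrow> 1 / t powr (\<alpha> / 2) * sqrt (norm (T t (abs_sq (f - T t f)))) \<le> K"
  shows "1 / t powr \<alpha> * sqrt (norm (poisson M T t (abs_sq (f - poisson M T t f))))
    \<le> (2 powr (- (\<alpha> / 2)) / (1 - 2 powr (- (\<alpha> / 2)))) * kernel_moment (\<alpha> / 2) * K"
proof -
  define C where "C = 2 powr (- (\<alpha> / 2)) / (1 - 2 powr (- (\<alpha> / 2)))"
  define P where "P = poisson M T t f"
  have PM: "P \<in> M" "f - P \<in> M"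
    using t by (auto simp: P_def intro!: M_diff f poisson_M)
  have step: "norm (T s f - T (2 * s) f) \<le> K * s powr (\<alpha> / 2)" if "s > 0" for s
    using norm_orbit_step_le[OF f that] bound[OF that] that by (simp add: divide_le_eq)
  have orbit: "norm (f - T u f) \<le> C * K * u powr (\<alpha> / 2)" if "u > 0" for u
    unfolding C_def using norm_diff_orbit_le[OF f _ K that step] \<alpha> by simp
  have "norm (f - P) \<le> C * K * t powr \<alpha> * kernel_moment (\<alpha> / 2)"
  proof (rule norm_weak_integral_le)
    fix x y
    have "has_bochner_integral halfline (\<lambda>v. \<kappa> v * Re (cinner (f x) y) - \<kappa> v * Re (cinner (T (t\<^sup>2 * v) f x) y))
        (1 * Re (cinner (f x) y) - Re (cinner (P x) y))"
      unfolding P_def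
      by (intro has_bochner_integral_diff has_bochner_integral_mult_left has_bochner_integral_kernel
          poisson_form f t)
    then show "has_bochner_integral halfline (\<lambda>v. \<kappa> v * Re (cinner ((f - T (t\<^sup>2 * v) f) x) y))
        (Re (cinner ((f - P) x) y))"
      by (simp add: blinfun.diff_left cinner_diff_left right_diff_distrib)
  next
    fix v :: real
    assume v: "v > 0"
    have "(t\<^sup>2) powr (\<alpha> / 2) = t powr \<alpha>"
      using t by (simp add: powr_powr flip: powr_numeral)
    then have "(t\<^sup>2 * v) powr (\<alpha> / 2) = t powr \<alpha> * v powr (\<alpha> / 2)"
      using v t by (simp add: powr_mult)
    then show "norm (f - T (t\<^sup>2 * v) f) \<le> C * K * t powr \<alpha> * v powr (\<alpha> / 2)"
      using orbit[of "t\<^sup>2 * v"] v t by simp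
  next
    have "has_bochner_integral halfline (\<lambda>v. (C * K * t powr \<alpha>) * (\<kappa> v * v powr (\<alpha> / 2)))
       ((C * K * t powr \<alpha>) * kernel_moment (\<alpha> / 2))"
      using \<alpha> by (intro has_bochner_integral_mult_right has_bochner_integral_kernel_moment) auto
    then show "has_bochner_integral halfline (\<lambda>v. \<kappa> v * (C * K * t powr \<alpha> * v powr (\<alpha> / 2)))
       (C * K * t powr \<alpha> * kernel_moment (\<alpha> / 2))"
      by (simp add: mult_ac)
  qed
  moreover have "sqrt (norm (poisson M T t (abs_sq (f - P)))) \<le> norm (f - P)"
  proof (rule real_le_lsqrt)
    have "norm (poisson M T t (abs_sq (f - P))) \<le> norm (abs_sq (f - P))"
      by (intro poisson_contraction M_abs_sq PM t)
    also have "\<dots> \<le> (norm (f - P))\<^sup>2"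
      by (intro norm_abs_sq_le M_bounded_ops PM)
    finally show "norm (poisson M T t (abs_sq (f - P))) \<le> (norm (f - P))\<^sup>2" .
  qed simp_all
  ultimately have "sqrt (norm (poisson M T t (abs_sq (f - P)))) \<le> C * kernel_moment (\<alpha> / 2) * K * t powr \<alpha>"
    by (simp add: mult_ac)
  then show ?thesis
    using t by (simp add: P_def C_def divide_le_eq)
qed

end

section \<open>The derivative Lipschitz norm\<close>

context quantum_markov
begin

text \<open>The mean value inequality with comparison function \<open>K u\<^sup>\<gamma> / \<gamma>\<close>.\<close>

lemma orbit_lipschitz_powr:
  assumes f: "f \<in> M" and \<gamma>: "\<gamma> > 0" and ab: "0 < a" "a \<le> b"
    and bound: "\<And>u. u > 0 \<Longrightarrow> norm (generator M T (T u f)) \<le> K * u powr (\<gamma> - 1)"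
  shows "norm (T b f - T a f) \<le> K / \<gamma> * (b powr \<gamma> - a powr \<gamma>)"
proof (cases "a = b")
  case False
  have "norm (T b f - T a f) \<le> K / \<gamma> * b powr \<gamma> - K / \<gamma> * a powr \<gamma>"
  proof (rule differentiable_bound_general[where f = "\<lambda>u. T u f"])
    show "a < b" using False ab by simp
    show "continuous_on {a..b} (\<lambda>u. T u f)"
      using ab by (intro continuous_on_subset[OF orbit_continuous[OF f]]) auto
    show "continuous_on {a..b} (\<lambda>u. K / \<gamma> * u powr \<gamma>)"
      using ab by (intro continuous_intros) auto
    fix u
    assume "a < u" "u < b"
    then have u: "u > 0" using ab by simp
    show "((\<lambda>u. T u f) has_vector_derivative - generator M T (T u f)) (at u)"
      by (rule orbit_has_vector_derivative[OF f u])
    have "((\<lambda>u. K / \<gamma> * u powr \<gamma>) has_real_derivative K / \<gamma> * (\<gamma> * u powr (\<gamma> - 1))) (at u)"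
      by (intro DERIV_cmult has_real_derivative_powr u)
    then show "((\<lambda>u. K / \<gamma> * u powr \<gamma>) has_vector_derivative K * u powr (\<gamma> - 1)) (at u)"
      using \<gamma> by (simp add: has_real_derivative_iff_has_vector_derivative)
    show "norm (- generator M T (T u f)) \<le> K * u powr (\<gamma> - 1)"
      using bound[OF u] by simp
  qed
  then show ?thesis by (simp add: right_diff_distrib)
qed simp

text \<open>Differentiation under the integral in \<open>P\<^sub>t f = \<integral> \<kappa>(v) T\<^bsub>t\<^sup>2v\<^esub> f dv\<close>. The difference quotients in \<open>t\<close>
  are dominated by a multiple of \<open>\<kappa>(v) v\<^bsup>\<alpha>/2\<^esup>\<close>.\<close>

lemma poisson_derivative:
  assumes f: "f \<in> M" and \<alpha>: "0 < \<alpha>" "\<alpha> < 1" and K: "K \<ge> 0" and t: "t > 0"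
    and bound: "\<And>u. u > 0 \<Longrightarrow> norm (generator M T (T u f)) \<le> K * u powr (\<alpha> / 2 - 1)"
  shows "\<exists>d. limitin (weak_star M) (\<lambda>h. (1 / h) *\<^sub>R (poisson M T (t + h) f - poisson M T t f)) d (at 0)
    \<and> norm d \<le> 2 * kernel_moment (\<alpha> / 2) * K * t powr (\<alpha> - 1)"
proof -
  \<comment> \<open>derivative of \<open>s \<mapsto> T\<^bsub>s\<^sup>2v\<^esub> f\<close> at \<open>t\<close>, and a bound for it\<close>
  define A where "A v = (- 2 * t * v) *\<^sub>R generator M T (T (t\<^sup>2 * v) f)" for v
  define w where "w v = 2 * K * t powr (\<alpha> - 1) * v powr (\<alpha> / 2)" for v
  have t2: "(t\<^sup>2) powr \<gamma> = t powr (2 * \<gamma>)" for \<gamma>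
    using t by (simp add: powr_powr flip: powr_numeral)
  have A_le: "norm (A v) \<le> w v" if v: "v > 0" for v
  proof -
    have "norm (A v) \<le> 2 * t * v * (K * (t\<^sup>2 * v) powr (\<alpha> / 2 - 1))"
      using v t bound[of "t\<^sup>2 * v"] by (simp add: A_def abs_mult mult_left_mono)
    also have "(t\<^sup>2 * v) powr (\<alpha> / 2 - 1) = t powr (\<alpha> - 2) * v powr (\<alpha> / 2 - 1)"
      using t v by (simp add: powr_mult t2)
    also have "t powr (\<alpha> - 2) = t powr (\<alpha> - 1) / t"
      using t powr_diff[of t "\<alpha> - 1" 1] by simp
    also have "v powr (\<alpha> / 2 - 1) = v powr (\<alpha> / 2) / v"
      using v powr_diff[of v "\<alpha> / 2" 1] by simp
    also have "2 * t * v * (K * (t powr (\<alpha> - 1) / t * (v powr (\<alpha> / 2) / v))) = w v"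
      using t v by (simp add: w_def)
    finally show ?thesis .
  qed
  have mom: "has_bochner_integral halfline (\<lambda>v. \<kappa> v * (c * v powr (\<alpha> / 2))) (c * kernel_moment (\<alpha> / 2))" for c
  proof -
    have "has_bochner_integral halfline (\<lambda>v. c * (\<kappa> v * v powr (\<alpha> / 2))) (c * kernel_moment (\<alpha> / 2))"
      using \<alpha> by (intro has_bochner_integral_mult_right has_bochner_integral_kernel_moment) auto
    then show ?thesis by (simp only: mult.left_commute)
  qed
  have "\<exists>d\<in>M. \<forall>\<xi> \<eta>. l2_seq \<xi> \<and> l2_seq \<eta> \<longrightarrow>
    has_bochner_integral halfline (\<lambda>v. vec_functional \<xi> \<eta> (\<kappa> v *\<^sub>R A v)) (vec_functional \<xi> \<eta> d)"
  proof (rule weak_integral_exists)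
    show "\<kappa> v *\<^sub>R A v \<in> M" if "v > 0" for v
      unfolding A_def using that t by (intro M_scaleR generator_orbit_M f) simp
    have "continuous_on {0<..} A"
      unfolding A_def
      by (intro continuous_intros continuous_on_compose2[OF generator_orbit_continuous[OF f]])
        (use t in auto)
    then show "continuous_on {0<..} (\<lambda>v. \<kappa> v *\<^sub>R A v)"
      by (intro continuous_intros continuous_on_poisson_kernel)
    show "set_integrable lborel {0<..} (\<lambda>v. \<kappa> v * w v)"
      using mom[of "2 * K * t powr (\<alpha> - 1)"]
      by (simp add: w_def has_bochner_integral_iff flip: integrable_halfline_iff)
    show "continuous_on {0<..} (\<lambda>v. \<kappa> v * w v)"
      unfolding w_def by (intro continuous_intros continuous_on_poisson_kernel) auto
    show "norm (\<kappa> v *\<^sub>R A v) \<le> \<kappa> v * w v" if "v > 0" for v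
      by (simp add: abs_of_nonneg poisson_kernel_nonneg mult_left_mono A_le that)
  qed
  then obtain d where dM: "d \<in> M" and d: "\<And>\<xi> \<eta>. l2_seq \<xi> \<Longrightarrow> l2_seq \<eta> \<Longrightarrow>
    has_bochner_integral halfline (\<lambda>v. vec_functional \<xi> \<eta> (\<kappa> v *\<^sub>R A v)) (vec_functional \<xi> \<eta> d)"
    by blast
  have d': "has_bochner_integral halfline (\<lambda>v. \<kappa> v *\<^sub>R vec_functional \<xi> \<eta> (A v)) (vec_functional \<xi> \<eta> d)"
    if "l2_seq \<xi>" "l2_seq \<eta>" for \<xi> \<eta>
    using d[OF that] by (simp add: linear_simps bounded_linear_vec_functional[OF that])
  have "norm d \<le> 2 * K * t powr (\<alpha> - 1) * kernel_moment (\<alpha> / 2)"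
  proof (rule norm_weak_integral_le[OF _ A_le])
    show "has_bochner_integral halfline (\<lambda>v. \<kappa> v * Re (cinner (A v x) y)) (Re (cinner (d x) y))" for x y
      by (rule has_bochner_integral_Re_cinner) (rule d')
    show "has_bochner_integral halfline (\<lambda>v. \<kappa> v * w v) (2 * K * t powr (\<alpha> - 1) * kernel_moment (\<alpha> / 2))"
      unfolding w_def by (rule mom)
  qed auto
  moreover have "limitin (weak_star M) (\<lambda>h. (1 / h) *\<^sub>R (poisson M T (t + h) f - poisson M T t f)) d (at 0)"
    unfolding limitin_weak_star_iff
  proof (intro conjI dM allI impI)
    have near: "\<forall>\<^sub>F h in at 0. h \<in> {-t<..<t}"
      using t by (intro eventually_at_in_open') auto
    then show "\<forall>\<^sub>F h in at 0. (1 / h) *\<^sub>R (poisson M T (t + h) f - poisson M T t f) \<in> M"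
      by (rule eventually_mono) (use t f in \<open>auto intro!: M_scaleR M_diff poisson_M\<close>)
    \<comment> \<open>any number above the derivative of \<open>s\<^sup>\<alpha>\<close> at \<open>t\<close> bounds its difference quotients near \<open>t\<close>\<close>
    define B where "B = \<alpha> * t powr (\<alpha> - 1) + 1"
    have "((\<lambda>h. ((t + h) powr \<alpha> - t powr \<alpha>) / h) \<longlongrightarrow> \<alpha> * t powr (\<alpha> - 1)) (at 0)"
      using has_real_derivative_powr[OF t, of \<alpha>] by (simp add: DERIV_def)
    then have "((\<lambda>h. \<bar>((t + h) powr \<alpha> - t powr \<alpha>) / h\<bar>) \<longlongrightarrow> \<bar>\<alpha> * t powr (\<alpha> - 1)\<bar>) (at 0)"
      by (rule tendsto_rabs)
    moreover have "\<bar>\<alpha> * t powr (\<alpha> - 1)\<bar> < B"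
      using \<alpha> by (simp add: B_def)
    ultimately have quot: "\<forall>\<^sub>F h in at 0. \<bar>((t + h) powr \<alpha> - t powr \<alpha>) / h\<bar> < B"
      by (rule order_tendstoD(2))
    fix \<xi> \<eta> :: "nat \<Rightarrow> 'h"
    assume *: "l2_seq \<xi> \<and> l2_seq \<eta>"
    define L where "L = vec_functional \<xi> \<eta>"
    have "bounded_linear L"
      unfolding L_def using * by (intro bounded_linear_vec_functional) auto
    then interpret L: bounded_linear L .
    obtain N where N: "N > 0" "\<And>a. norm (L a) \<le> norm a * N"
      using L.pos_bounded by blast
    define Q where "Q h v = \<kappa> v *\<^sub>R L ((1 / h) *\<^sub>R (T ((t + h)\<^sup>2 * v) f - T (t\<^sup>2 * v) f))" for h v
    have Q: "has_bochner_integral halfline (Q h) (L ((1 / h) *\<^sub>R (poisson M T (t + h) f - poisson M T t f)))"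
      if h: "h \<in> {-t<..<t}" for h
    proof -
      have "has_bochner_integral halfline (\<lambda>v. (1 / h) *\<^sub>R (\<kappa> v *\<^sub>R L (T ((t + h)\<^sup>2 * v) f) - \<kappa> v *\<^sub>R L (T (t\<^sup>2 * v) f)))
          ((1 / h) *\<^sub>R (L (poisson M T (t + h) f) - L (poisson M T t f)))"
        unfolding L_def using h t *
        by (intro has_bochner_integral_scaleR_right has_bochner_integral_diff poisson_vec_functional f) auto
      then show ?thesis
        by (simp add: Q_def[abs_def] L.scaleR L.diff scaleR_diff_right mult.commute)
    qed
    have Q_le: "norm (Q h v) \<le> N * (2 * K / \<alpha> * B) * (\<kappa> v * v powr (\<alpha> / 2))"
      if h: "h \<in> {-t<..<t}" "h \<noteq> 0" "\<bar>((t + h) powr \<alpha> - t powr \<alpha>) / h\<bar> < B" and v: "v > 0" for h v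
    proof -
      have sq: "(s\<^sup>2 * v) powr (\<alpha> / 2) = s powr \<alpha> * v powr (\<alpha> / 2)" if "s > 0" for s
      proof -
        have "(s\<^sup>2) powr (\<alpha> / 2) = s powr \<alpha>"
          using that by (simp add: powr_powr flip: powr_numeral)
        then show ?thesis using that v by (simp add: powr_mult)
      qed
      have lip: "norm (T (r\<^sup>2 * v) f - T (s\<^sup>2 * v) f) \<le> 2 * K / \<alpha> * (r powr \<alpha> - s powr \<alpha>) * v powr (\<alpha> / 2)"
        if "0 < s" "s \<le> r" for r s
      proof -
        have rs: "0 < r" "0 < s" using that by auto
        have "norm (T (r\<^sup>2 * v) f - T (s\<^sup>2 * v) f)
            \<le> K / (\<alpha> / 2) * ((r\<^sup>2 * v) powr (\<alpha> / 2) - (s\<^sup>2 * v) powr (\<alpha> / 2))"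
          using that v \<alpha> by (intro orbit_lipschitz_powr[OF f _ _ _ bound] mult_right_mono power_mono) auto
        then show ?thesis
          unfolding sq[OF rs(1)] sq[OF rs(2)] by (simp add: left_diff_distrib right_diff_distrib diff_divide_distrib mult_ac)
      qed
      have "norm (T ((t + h)\<^sup>2 * v) f - T (t\<^sup>2 * v) f)
          \<le> 2 * K / \<alpha> * \<bar>(t + h) powr \<alpha> - t powr \<alpha>\<bar> * v powr (\<alpha> / 2)"
      proof (cases "h > 0")
        case True
        have "t powr \<alpha> \<le> (t + h) powr \<alpha>"
          using True t \<alpha> by (intro powr_mono2) auto
        then show ?thesis
          using lip[of t "t + h"] True t by simp
      next
        case False
        have "(t + h) powr \<alpha> \<le> t powr \<alpha>"
          using False t \<alpha> h by (intro powr_mono2) auto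
        then show ?thesis
          using lip[of "t + h" t] False t h by (simp add: norm_minus_commute)
      qed
      also have "\<dots> \<le> 2 * K / \<alpha> * (B * \<bar>h\<bar>) * v powr (\<alpha> / 2)"
        using h K \<alpha> by (intro mult_right_mono mult_left_mono) (auto simp: abs_divide divide_less_eq)
      finally have "norm ((1 / h) *\<^sub>R (T ((t + h)\<^sup>2 * v) f - T (t\<^sup>2 * v) f))
          \<le> 2 * K / \<alpha> * B * v powr (\<alpha> / 2)"
        using h(2) by (simp add: divide_le_eq mult_ac)
      then have "norm (L ((1 / h) *\<^sub>R (T ((t + h)\<^sup>2 * v) f - T (t\<^sup>2 * v) f)))
          \<le> (2 * K / \<alpha> * B * v powr (\<alpha> / 2)) * N"
        using N by (meson mult_right_mono less_imp_le order_trans)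
      then have "\<kappa> v * norm (L ((1 / h) *\<^sub>R (T ((t + h)\<^sup>2 * v) f - T (t\<^sup>2 * v) f)))
          \<le> \<kappa> v * ((2 * K / \<alpha> * B * v powr (\<alpha> / 2)) * N)"
        by (intro mult_left_mono poisson_kernel_nonneg) simp_all
      then show ?thesis
        by (simp add: Q_def abs_of_nonneg poisson_kernel_nonneg mult_ac)
    qed
    have Q_lim: "((\<lambda>h. Q h v) \<longlongrightarrow> \<kappa> v *\<^sub>R L (A v)) (at 0)" if v: "v > 0" for v
    proof -
      have "((\<lambda>s. s\<^sup>2 * v) has_real_derivative 2 * t * v) (at t)"
        by (auto intro!: derivative_eq_intros)
      then have "((\<lambda>s. s\<^sup>2 * v) has_vector_derivative 2 * t * v) (at t)"
        by (simp add: has_real_derivative_iff_has_vector_derivative)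
      then have "((\<lambda>u. T u f) \<circ> (\<lambda>s. s\<^sup>2 * v) has_vector_derivative
          (2 * t * v) *\<^sub>R (- generator M T (T (t\<^sup>2 * v) f))) (at t)"
        using t v by (intro vector_diff_chain_at orbit_has_vector_derivative f) auto
      then have "((\<lambda>s. T (s\<^sup>2 * v) f) has_vector_derivative A v) (at t)"
        by (simp add: o_def A_def)
      then show ?thesis
        unfolding Q_def
        by (intro tendsto_intros L.tendsto has_vector_derivative_imp_quotient)
    qed
    have "((\<lambda>h. L ((1 / h) *\<^sub>R (poisson M T (t + h) f - poisson M T t f))) \<longlongrightarrow> L d) (at 0)"
      unfolding tendsto_at_iff_sequentially o_def
    proof (intro allI impI)
      fix X :: "nat \<Rightarrow> real"
      assume X: "\<forall>i. X i \<in> UNIV - {0}" "X \<longlonglongrightarrow> 0"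
      then have X0: "filterlim X (at 0) sequentially"
        by (auto simp: filterlim_at)
      have "\<forall>\<^sub>F n in sequentially. X n \<in> {-t<..<t} \<and> \<bar>((t + X n) powr \<alpha> - t powr \<alpha>) / X n\<bar> < B"
        using filterlim_iff[THEN iffD1, OF X0, rule_format, OF eventually_conj[OF near quot]] .
      then obtain n0 where n0: "\<And>n. n \<ge> n0 \<Longrightarrow> X n \<in> {-t<..<t} \<and> \<bar>((t + X n) powr \<alpha> - t powr \<alpha>) / X n\<bar> < B"
        unfolding eventually_sequentially by blast
      have Ld: "L d = (LINT v|halfline. \<kappa> v *\<^sub>R L (A v))"
        using d'[of \<xi> \<eta>] * by (simp add: has_bochner_integral_iff L_def)
      \<comment> \<open>the domination holds only once \<open>X n\<close> is close to \<open>0\<close>, hence the index shift\<close>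
      have "(\<lambda>n. LINT v|halfline. Q (X (n + n0)) v) \<longlonglongrightarrow> (LINT v|halfline. \<kappa> v *\<^sub>R L (A v))"
      proof (rule integral_dominated_convergence)
        show "(\<lambda>v. \<kappa> v *\<^sub>R L (A v)) \<in> borel_measurable halfline"
          using d'[of \<xi> \<eta>] * unfolding L_def
          by (auto simp: has_bochner_integral_iff intro: borel_measurable_integrable)
        show "Q (X (n + n0)) \<in> borel_measurable halfline" for n
          using Q[of "X (n + n0)"] n0[of "n + n0"]
          by (auto simp: has_bochner_integral_iff intro: borel_measurable_integrable)
        show "integrable halfline (\<lambda>v. N * (2 * K / \<alpha> * B) * (\<kappa> v * v powr (\<alpha> / 2)))"
          using has_bochner_integral_mult_right[OF has_bochner_integral_kernel_moment[of "\<alpha> / 2"],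
              of "N * (2 * K / \<alpha> * B)"] \<alpha>
          by (simp only: has_bochner_integral_iff)
        show "AE v in halfline. (\<lambda>n. Q (X (n + n0)) v) \<longlonglongrightarrow> \<kappa> v *\<^sub>R L (A v)"
        proof (rule AE_I2)
          fix v assume "v \<in> space halfline"
          then have "(\<lambda>n. Q (X n) v) \<longlonglongrightarrow> \<kappa> v *\<^sub>R L (A v)"
            by (intro filterlim_compose[OF Q_lim X0]) (simp add: space_restrict_space)
          then show "(\<lambda>n. Q (X (n + n0)) v) \<longlonglongrightarrow> \<kappa> v *\<^sub>R L (A v)"
            by (rule LIMSEQ_ignore_initial_segment)
        qed
        show "AE v in halfline. norm (Q (X (n + n0)) v) \<le> N * (2 * K / \<alpha> * B) * (\<kappa> v * v powr (\<alpha> / 2))" for n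
          using n0[of "n + n0"] X(1) by (intro AE_I2 Q_le) (auto simp: space_restrict_space)
      qed
      moreover have "(LINT v|halfline. Q (X (n + n0)) v)
          = L ((1 / X (n + n0)) *\<^sub>R (poisson M T (t + X (n + n0)) f - poisson M T t f))" for n
        using Q[of "X (n + n0)"] n0[of "n + n0"] by (simp add: has_bochner_integral_iff)
      ultimately have "(\<lambda>n. L ((1 / X (n + n0)) *\<^sub>R (poisson M T (t + X (n + n0)) f - poisson M T t f))) \<longlonglongrightarrow> L d"
        by (simp add: Ld)
      then show "(\<lambda>n. L ((1 / X n) *\<^sub>R (poisson M T (t + X n) f - poisson M T t f))) \<longlonglongrightarrow> L d"
        by (rule LIMSEQ_offset)
    qed
    then show "((\<lambda>h. vec_functional \<xi> \<eta> ((1 / h) *\<^sub>R (poisson M T (t + h) f - poisson M T t f))) \<longlongrightarrow>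
        vec_functional \<xi> \<eta> d) (at 0)"
      by (simp only: L_def)
  qed
  ultimately show ?thesis
    by (intro exI[of _ d]) (simp add: mult_ac)
qed

theorem poisson_Lambda_bound:
  assumes f: "f \<in> M" and \<alpha>: "0 < \<alpha>" "\<alpha> < 1" and K: "K \<ge> 0" and t: "t > 0"
    and bound: "\<And>t. t > 0 \<Longrightarrow>
      1 / t powr (\<alpha> / 2 - 1) * norm (weak_star_deriv M (\<lambda>s. T s f) t) \<le> K"
  shows "1 / t powr (\<alpha> - 1) * norm (weak_star_deriv M (\<lambda>s. poisson M T s f) t)
    \<le> 2 * kernel_moment (\<alpha> / 2) * K"
proof -
  have "norm (generator M T (T u f)) \<le> K * u powr (\<alpha> / 2 - 1)" if "u > 0" for u
    using bound[OF that] that by (simp add: weak_star_deriv_orbit[OF f that] divide_le_eq)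
  from poisson_derivative[OF f \<alpha> K t this]
  obtain d where d: "limitin (weak_star M) (\<lambda>h. (1 / h) *\<^sub>R (poisson M T (t + h) f - poisson M T t f)) d (at 0)"
    "norm d \<le> 2 * kernel_moment (\<alpha> / 2) * K * t powr (\<alpha> - 1)"
    by blast
  have "weak_star_deriv M (\<lambda>s. poisson M T s f) t = d"
    by (rule weak_star_deriv_eqI[OF d(1)])
  then show ?thesis
    using d(2) t by (simp add: divide_le_eq)
qed

end

section \<open>The defect of the Kadison-Schwarz inequality\<close>

text \<open>This disposes of the remainder in the product rule for \<open>T\<^bsub>w-s\<^esub> (S s)\<close>, where \<open>T\<^bsub>w-s\<^esub>\<close> is only known to
  be a contraction.\<close>

lemma has_vector_derivative_zero_dominated:
  assumes R: "(R has_vector_derivative 0) (at x)" and "R x = 0"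
    and le: "\<forall>\<^sub>F h in at 0. norm (Z (x + h)) \<le> norm (R (x + h))" and "Z x = 0"
  shows "(Z has_vector_derivative 0) (at x)"
proof -
  have "((\<lambda>h. norm (R (x + h)) / norm h) \<longlongrightarrow> 0) (at 0)"
    using R \<open>R x = 0\<close> by (simp add: has_vector_derivative_def has_derivative_at)
  then have "((\<lambda>h. norm (Z (x + h)) / norm h) \<longlongrightarrow> 0) (at 0)"
    by (rule tendsto_0_le[where K = 1])
      (use le in \<open>auto elim!: eventually_mono intro!: divide_right_mono\<close>)
  then show ?thesis
    using \<open>Z x = 0\<close> by (simp add: has_vector_derivative_def has_derivative_at)
qed

context quantum_markov
begin

definition defect :: "real \<Rightarrow> 'h oper \<Rightarrow> 'h oper" where
  "defect u f = T u (abs_sq f) - abs_sq (T u f)"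

lemma defect_M: "u \<ge> 0 \<Longrightarrow> f \<in> M \<Longrightarrow> defect u f \<in> M"
  by (simp add: defect_def M_diff M_abs_sq T_M)

lemma defect_positive: "u \<ge> 0 \<Longrightarrow> f \<in> M \<Longrightarrow> positive_op (defect u f)"
  unfolding defect_def by (rule kadison_schwarz)

lemma defect_form:
  assumes "u \<ge> 0" "f \<in> M"
  shows "Re (cinner (defect u f x) x) = Re (cinner (T u (abs_sq f) x) x) - (norm (T u f x))\<^sup>2"
  using T_M[OF assms]
  by (simp add: defect_def blinfun.diff_left cinner_diff_left cinner_abs_sq M_bounded_ops Re_cinner_self)

lemma T_abs_sq_T_form_le:
  assumes "u \<ge> 0" "s \<ge> 0" "f \<in> M"
  shows "Re (cinner (T u (abs_sq (T s f)) x) x) \<le> Re (cinner (T (u + s) (abs_sq f) x) x)"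
proof -
  have "Re (cinner (T u (abs_sq (T s f)) x) x) \<le> Re (cinner (T u (T s (abs_sq f)) x) x)"
    using assms by (intro T_form_mono kadison_schwarz M_abs_sq T_M)
  then show ?thesis
    using assms by (simp add: T_semigroup M_abs_sq)
qed

text \<open>\<open>T\<^sub>u\<close> of the defect over \<open>[0, s]\<close> is the part of the defect over \<open>[0, u + s]\<close> produced up to
  time \<open>s\<close>; the remaining part is the positive defect of \<open>T\<^sub>s f\<close> over \<open>[0, u]\<close>.\<close>

lemma T_defect_form_le:
  assumes "u \<ge> 0" "s \<ge> 0" "f \<in> M"
  shows "Re (cinner (T u (defect s f) x) x) \<le> Re (cinner (defect (u + s) f x) x)"
proof -
  have eq: "T u (defect s f) = T (u + s) (abs_sq f) - T u (abs_sq (T s f))"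
    using assms by (simp add: defect_def T_diff T_M M_abs_sq T_semigroup)
  have "(norm (T (u + s) f x))\<^sup>2 \<le> Re (cinner (T u (abs_sq (T s f)) x) x)"
    using kadison_schwarz_form[of u "T s f" x] assms by (simp add: T_M T_semigroup)
  then show ?thesis
    using assms by (simp add: eq defect_form blinfun.diff_left cinner_diff_left)
qed

text \<open>For \<open>\<epsilon> < u - w\<close> one has \<open>T\<^sub>\<epsilon> D\<^sub>w \<le> (\<epsilon> / (u - w))\<^sup>\<beta> T\<^bsub>u-w\<^esub> D\<^sub>w \<le> D\<^sub>u\<close> with \<open>D\<close> the defect of \<open>f\<close>; then
  \<open>\<epsilon>\<close> tends to \<open>0\<close>.\<close>

lemma defect_mono_quasi_increasing:
  assumes quasi: "quasi_increasing M T" and f: "f \<in> M" and w: "0 < w" "w < u"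
  shows "Re (cinner (defect w f x) x) \<le> Re (cinner (defect u f x) x)"
proof -
  obtain \<beta> where \<beta>: "\<beta> \<ge> 0" "\<And>g s t. g \<in> M \<Longrightarrow> positive_op g \<Longrightarrow> t < s \<Longrightarrow> 0 < t \<Longrightarrow>
      (1 / t powr \<beta>) *\<^sub>R T t g \<preceq> (1 / s powr \<beta>) *\<^sub>R T s g"
    using quasi unfolding quasi_increasing_def by blast
  have "((\<lambda>\<epsilon>. Re (cinner (T \<epsilon> (defect w f) x) x)) \<longlongrightarrow> Re (cinner (defect w f x) x)) (at_right 0)"
    using w by (intro tendsto_intros limitin_weak_star_cinner[OF T_limit_0] defect_M f) simp
  moreover have "\<forall>\<^sub>F \<epsilon> in at_right 0. Re (cinner (T \<epsilon> (defect w f) x) x) \<le> Re (cinner (defect u f x) x)"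
  proof (rule eventually_mono[OF eventually_at_rightI[of 0 "u - w"]])
    fix \<epsilon>
    assume \<epsilon>: "\<epsilon> \<in> {0<..<u - w}"
    let ?q = "\<lambda>s. Re (cinner (T s (defect w f) x) x)"
    have q0: "?q s \<ge> 0" if "s \<ge> 0" for s
      using that w by (intro positive_op_Re T_positive defect_M defect_positive f) auto
    have "?q \<epsilon> / \<epsilon> powr \<beta> \<le> ?q (u - w) / (u - w) powr \<beta>"
      using le_op_form[OF \<beta>(2), of "defect w f" \<epsilon> "u - w" x] \<epsilon> w
      by (simp add: defect_M defect_positive f blinfun.scaleR_left cinner_scaleR_left)
    then have "?q \<epsilon> \<le> ?q (u - w) / (u - w) powr \<beta> * \<epsilon> powr \<beta>"
      using \<epsilon> by (simp add: pos_divide_le_eq)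
    also have "\<dots> \<le> ?q (u - w) / (u - w) powr \<beta> * (u - w) powr \<beta>"
      using \<epsilon> \<beta>(1) by (intro mult_left_mono powr_mono2 divide_nonneg_nonneg q0) auto
    also have "\<dots> = ?q (u - w)"
      using w by simp
    also have "\<dots> \<le> Re (cinner (defect u f x) x)"
      using T_defect_form_le[of "u - w" w f x] w f by simp
    finally show "?q \<epsilon> \<le> Re (cinner (defect u f x) x)" .
  qed (use w in auto)
  ultimately show ?thesis
    by (intro tendsto_upperbound[where F = "at_right 0"]) (auto simp: trivial_limit_at_right_real)
qed

lemma abs_sq_orbit: "s \<ge> 0 \<Longrightarrow> f \<in> M \<Longrightarrow> abs_sq (T s f) = T s (adj_op f) o\<^sub>L T s f"
  by (simp add: abs_sq_def T_adj)

text \<open>The product rule for \<open>s \<mapsto> T\<^bsub>w-s\<^esub> (S s)\<close> with \<open>S s = |T\<^sub>s f|\<^sup>2\<close>. The map \<open>S\<close> is expanded to first order at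
  \<open>s\<close>; the constant and the linear term lie in \<open>M\<close> and have differentiable orbits, and the contraction
  \<open>T\<^bsub>w-r\<^esub>\<close> does not enlarge the remainder \<open>R r\<close>.\<close>

lemma interpolation_derivative:
  assumes f: "f \<in> M" and s: "0 < s" "s < w"
  shows "((\<lambda>s. T (w - s) (abs_sq (T s f))) has_vector_derivative - two_T_Gamma_T M T (w - s) s f) (at s)"
proof -
  define S where "S s = T s (adj_op f) o\<^sub>L T s f" for s
  define S' where "S' = (T s (adj_op f) o\<^sub>L (- generator M T (T s f)))
      + ((- generator M T (T s (adj_op f))) o\<^sub>L T s f)"
  define R where "R r = S r - S s - (r - s) *\<^sub>R S'" for r
  have SM: "S r \<in> M" if "r \<ge> 0" for r
    unfolding S_def using that by (intro M_compose T_M M_adj f)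
  have S'M: "S' \<in> M"
    unfolding S'_def using s by (intro M_add M_compose M_minus T_M M_adj f generator_orbit_M) auto
  have S: "(S has_vector_derivative S') (at s)"
    unfolding S_def S'_def
    by (intro bounded_bilinear.has_vector_derivative[OF bounded_bilinear_blinfun_compose]
        orbit_has_vector_derivative M_adj f s)
  have shift_deriv: "((\<lambda>r. r - s) has_vector_derivative 1 - 0) (at s)"
    by (intro has_vector_derivative_diff has_vector_derivative_const has_vector_derivative_id)
  have "(R has_vector_derivative S' - 0 - (1 - 0) *\<^sub>R S') (at s)"
    unfolding R_def
    by (rule has_vector_derivative_diff[OF has_vector_derivative_diff[OF S has_vector_derivative_const]
          bounded_linear.has_vector_derivative[OF bounded_linear_scaleR_left shift_deriv]])
  then have R: "(R has_vector_derivative 0) (at s)" by simp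
  have shift: "((\<lambda>r. T (w - r) g) has_vector_derivative generator M T (T (w - s) g)) (at s)" if g: "g \<in> M" for g
  proof -
    have "((\<lambda>r. w - r) has_vector_derivative 0 - 1) (at s)"
      by (intro has_vector_derivative_diff has_vector_derivative_const has_vector_derivative_id)
    then have "((\<lambda>u. T u g) \<circ> (\<lambda>r. w - r) has_vector_derivative (0 - 1) *\<^sub>R (- generator M T (T (w - s) g))) (at s)"
      using s by (intro vector_diff_chain_at orbit_has_vector_derivative g) auto
    then show ?thesis by (simp add: o_def)
  qed
  have near: "\<forall>\<^sub>F h in at 0. h \<in> {- s<..<w - s}"
    using s by (intro eventually_at_in_open') auto
  have 1: "((\<lambda>r. T (w - r) (R r)) has_vector_derivative 0) (at s)"
  proof (rule has_vector_derivative_zero_dominated[OF R])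
    show "R s = 0" "T (w - s) (R s) = 0"
      using s T_scaleR[of "w - s" 0 0] M_zero by (simp_all add: R_def)
    show "\<forall>\<^sub>F h in at 0. norm (T (w - (s + h)) (R (s + h))) \<le> norm (R (s + h))"
      using near
      by (rule eventually_mono)
        (use s in \<open>auto simp: R_def intro!: T_contraction M_diff M_scaleR SM S'M\<close>)
  qed
  have 2: "((\<lambda>r. (r - s) *\<^sub>R T (w - r) S') has_vector_derivative
      (s - s) *\<^sub>R generator M T (T (w - s) S') + 1 *\<^sub>R T (w - s) S') (at s)"
    by (intro has_vector_derivative_scaleR shift S'M) (auto intro!: derivative_eq_intros)
  have "((\<lambda>r. T (w - r) (S s) + (r - s) *\<^sub>R T (w - r) S' + T (w - r) (R r)) has_vector_derivative
      generator M T (T (w - s) (S s)) + ((s - s) *\<^sub>R generator M T (T (w - s) S') + 1 *\<^sub>R T (w - s) S') + 0) (at s)"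
    using s by (intro has_vector_derivative_add shift SM 1 2) auto
  then have "((\<lambda>r. T (w - r) (S s) + (r - s) *\<^sub>R T (w - r) S' + T (w - r) (R r)) has_vector_derivative
      generator M T (T (w - s) (S s)) + T (w - s) S') (at s)"
    by simp
  then have "((\<lambda>r. T (w - r) (abs_sq (T r f))) has_vector_derivative
      generator M T (T (w - s) (S s)) + T (w - s) S') (at s)"
  proof (rule has_vector_derivative_transform_within_open[where S = "{0<..<w}"])
    fix r
    assume r: "r \<in> {0<..<w}"
    have "S s + (r - s) *\<^sub>R S' + R r = abs_sq (T r f)"
      using r f by (simp add: R_def S_def abs_sq_orbit)
    moreover have "T (w - r) (S s + (r - s) *\<^sub>R S' + R r)
        = T (w - r) (S s) + (r - s) *\<^sub>R T (w - r) S' + T (w - r) (R r)"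
    proof -
      have "R r \<in> M"
        unfolding R_def using r s by (intro M_diff M_scaleR SM S'M) auto
      then show ?thesis
        using r s SM[of s] S'M by (simp add: T_add T_scaleR M_add M_scaleR)
    qed
    ultimately show "T (w - r) (S s) + (r - s) *\<^sub>R T (w - r) S' + T (w - r) (R r) = T (w - r) (abs_sq (T r f))"
      by simp
  qed (use s in auto)
  moreover have "generator M T (T (w - s) (S s)) + T (w - s) S' = - two_T_Gamma_T M T (w - s) s f"
  proof -
    have "S' = - (generator M T (T s (adj_op f)) o\<^sub>L T s f) - (T s (adj_op f) o\<^sub>L generator M T (T s f))"
      unfolding S'_def
      by (rule blinfun_eqI) (simp add: blinfun.add_left blinfun.diff_left blinfun.minus_left blinfun.minus_right)
    moreover have "generator M T (T s (adj_op f)) o\<^sub>L T s f \<in> M" "T s (adj_op f) o\<^sub>L generator M T (T s f) \<in> M"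
      using s by (auto intro!: M_compose T_M M_adj f generator_orbit_M)
    ultimately have "T (w - s) S' = - T (w - s) (generator M T (T s (adj_op f)) o\<^sub>L T s f)
        - T (w - s) (T s (adj_op f) o\<^sub>L generator M T (T s f))"
      using s by (simp add: T_diff T_minus M_minus)
    then show ?thesis
      by (simp add: two_T_Gamma_T_def S_def)
  qed
  ultimately show ?thesis by simp
qed

text \<open>As \<open>|T\<^bsub>w-\<epsilon>\<^esub> f|\<^sup>2 \<rightarrow> |T\<^sub>w f|\<^sup>2\<close> in norm and \<open>T\<^sub>\<epsilon>\<close> is contractive, only the weak-* continuity of
  \<open>\<epsilon> \<mapsto> T\<^sub>\<epsilon> |T\<^sub>w f|\<^sup>2\<close> at \<open>0\<close> remains.\<close>

lemma interpolation_endpoint: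
  assumes f: "f \<in> M" and w: "w > 0"
  shows "((\<lambda>\<epsilon>. Re (cinner (T \<epsilon> (abs_sq (T (w - \<epsilon>) f)) x) x)) \<longlongrightarrow> (norm (T w f x))\<^sup>2) (at_right 0)"
proof -
  define S where "S s = T s (adj_op f) o\<^sub>L T s f" for s
  have SM: "S r \<in> M" if "r \<ge> 0" for r
    unfolding S_def using that by (intro M_compose T_M M_adj f)
  have cont: "continuous_on {0<..} S"
    unfolding S_def
    by (intro bounded_bilinear.continuous_on[OF bounded_bilinear_blinfun_compose] orbit_continuous M_adj f)
  then have S_cont: "isCont S w"
    using w by (simp add: continuous_on_eq_continuous_at)
  have "((\<lambda>\<epsilon>. w - \<epsilon>) \<longlongrightarrow> w - 0) (at_right 0)"
    by (intro tendsto_intros)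
  then have "((\<lambda>\<epsilon>. w - \<epsilon>) \<longlongrightarrow> w) (at_right 0)"
    by simp
  from isCont_tendsto_compose[OF S_cont this]
  have "((\<lambda>\<epsilon>. S (w - \<epsilon>)) \<longlongrightarrow> S w) (at_right 0)" .
  then have S0: "((\<lambda>\<epsilon>. norm (S (w - \<epsilon>) - S w)) \<longlongrightarrow> 0) (at_right 0)"
    by (simp add: LIM_zero tendsto_norm_zero)
  have near: "\<forall>\<^sub>F \<epsilon> in at_right 0. \<epsilon> \<in> {0<..<w}"
    using w by (intro eventually_at_rightI) 
  have "((\<lambda>\<epsilon>. T \<epsilon> (S (w - \<epsilon>) - S w)) \<longlongrightarrow> 0) (at_right 0)"
  proof (rule Lim_null_comparison[OF _ S0])
    show "\<forall>\<^sub>F \<epsilon> in at_right 0. norm (T \<epsilon> (S (w - \<epsilon>) - S w)) \<le> norm (S (w - \<epsilon>) - S w)"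
      using near by (rule eventually_mono) (auto intro!: T_contraction M_diff SM)
  qed
  then have "((\<lambda>\<epsilon>. Re (cinner (T \<epsilon> (S (w - \<epsilon>) - S w) x) x)) \<longlongrightarrow> Re (cinner ((0 :: 'h oper) x) x)) (at_right 0)"
    by (intro tendsto_intros bounded_bilinear.tendsto[OF bounded_bilinear_cinner]
        bounded_bilinear.tendsto[OF bounded_bilinear_blinfun_apply])
  moreover have "((\<lambda>\<epsilon>. Re (cinner (T \<epsilon> (S w) x) x)) \<longlongrightarrow> Re (cinner (S w x) x)) (at_right 0)"
    using w by (intro tendsto_intros limitin_weak_star_cinner[OF T_limit_0] SM) simp
  ultimately have lim: "((\<lambda>\<epsilon>. Re (cinner (T \<epsilon> (S (w - \<epsilon>) - S w) x) x) + Re (cinner (T \<epsilon> (S w) x) x))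
      \<longlongrightarrow> Re (cinner ((0 :: 'h oper) x) x) + Re (cinner (S w x) x)) (at_right 0)"
    by (rule tendsto_add)
  have val: "Re (cinner ((0 :: 'h oper) x) x) + Re (cinner (S w x) x) = (norm (T w f x))\<^sup>2"
  proof -
    have "S w = abs_sq (T w f)"
      using w f by (simp add: S_def abs_sq_orbit)
    then show ?thesis
      using w f by (simp add: cinner_abs_sq M_bounded_ops T_M Re_cinner_self)
  qed
  have ev: "\<forall>\<^sub>F \<epsilon> in at_right 0. Re (cinner (T \<epsilon> (S (w - \<epsilon>) - S w) x) x) + Re (cinner (T \<epsilon> (S w) x) x)
      = Re (cinner (T \<epsilon> (abs_sq (T (w - \<epsilon>) f)) x) x)"
    using near
  proof (rule eventually_mono)
    fix \<epsilon>
    assume "\<epsilon> \<in> {0<..<w}"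
    then show "Re (cinner (T \<epsilon> (S (w - \<epsilon>) - S w) x) x) + Re (cinner (T \<epsilon> (S w) x) x)
      = Re (cinner (T \<epsilon> (abs_sq (T (w - \<epsilon>) f)) x) x)"
      using SM[of "w - \<epsilon>"] SM[of w] f
      by (simp add: T_diff blinfun.diff_left cinner_diff_left abs_sq_orbit S_def)
  qed
  show ?thesis
    using Lim_transform_eventually[OF lim ev] by (simp only: val)
qed

text \<open>The interpolation \<open>p(s) = \<langle>T\<^bsub>w-s\<^esub> |T\<^sub>s f|\<^sup>2 x, x\<rangle>\<close> is convex on the open interval because \<open>\<Gamma>\<^sup>2 \<ge> 0\<close> makes its
  derivative increasing. At \<open>w\<close> it is continuous, and at \<open>0\<close> the Kadison-Schwarz inequality
  \<open>p(\<epsilon>) \<le> p(0)\<close> takes the place of continuity.\<close>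

lemma defect_half:
  assumes \<Gamma>: "Gamma2_nonneg M T" and f: "f \<in> M" and w: "w > 0"
  shows "Re (cinner (defect w f x) x) \<le> 2 * Re (cinner (T (w / 2) (defect (w / 2) f) x) x)"
proof -
  define p where "p s = Re (cinner (T (w - s) (abs_sq (T s f)) x) x)" for s
  define p' where "p' s = - Re (cinner (two_T_Gamma_T M T (w - s) s f x) x)" for s
  have "convex_on {0<..<w} p"
  proof (rule convex_on_realI)
    show "connected {0<..<w}" by simp
    fix s
    assume s: "s \<in> {0<..<w}"
    have "bounded_linear (\<lambda>a. Re (cinner (blinfun_apply a x) x))"
      by (intro bounded_linear_compose[OF bounded_linear_Re]
          bounded_linear_compose[OF bounded_bilinear.bounded_linear_left[OF bounded_bilinear_cinner]]
          blinfun.bounded_linear_left)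
    from bounded_linear.has_vector_derivative[OF this interpolation_derivative[OF f, of s w]]
    show "(p has_real_derivative p' s) (at s)"
      using s unfolding p_def p'_def has_real_derivative_iff_has_vector_derivative
      by (simp add: blinfun.minus_left cinner_minus_left)
  next
    fix s t
    assume st: "s \<in> {0<..<w}" "t \<in> {0<..<w}" "s \<le> t"
    show "p' s \<le> p' t"
    proof (cases "s = t")
      case False
      have "(1 / 2) *\<^sub>R two_T_Gamma_T M T (w - t) (s + (t - s)) f
          \<preceq> (1 / 2) *\<^sub>R two_T_Gamma_T M T ((w - t) + (t - s)) s f"
        using \<Gamma>[unfolded Gamma2_nonneg_def, rule_format, of "w - t" s "t - s" f] st False f
        by simp
      from le_op_form[OF this, of x] show ?thesis
        by (simp add: p'_def blinfun.scaleR_left cinner_scaleR_left)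
    qed simp
  qed
  then have conv: "2 * p (w / 2) \<le> p 0 + p (w - \<epsilon>)" if "\<epsilon> \<in> {0<..<w}" for \<epsilon>
  proof -
    have "p ((1 - 1 / 2) *\<^sub>R \<epsilon> + (1 / 2) *\<^sub>R (w - \<epsilon>)) \<le> (1 - 1 / 2) * p \<epsilon> + (1 / 2) * p (w - \<epsilon>)"
      using that by (intro convex_onD[OF \<open>convex_on {0<..<w} p\<close>]) auto
    then have "2 * p (w / 2) \<le> p \<epsilon> + p (w - \<epsilon>)"
      by (simp add: field_simps)
    moreover have "p \<epsilon> \<le> p 0"
      using T_abs_sq_T_form_le[of "w - \<epsilon>" \<epsilon> f x] that f by (simp add: p_def T_0)
    ultimately show ?thesis by simp
  qed
  have "((\<lambda>\<epsilon>. p 0 + p (w - \<epsilon>)) \<longlongrightarrow> p 0 + (norm (T w f x))\<^sup>2) (at_right 0)"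
    using tendsto_add[OF tendsto_const interpolation_endpoint[OF f w, of x], of "p 0"]
    by (simp add: p_def)
  moreover have "\<forall>\<^sub>F \<epsilon> in at_right 0. 2 * p (w / 2) \<le> p 0 + p (w - \<epsilon>)"
    by (rule eventually_mono[OF eventually_at_rightI[of 0 w]]) (use conv w in auto)
  ultimately have "2 * p (w / 2) \<le> p 0 + (norm (T w f x))\<^sup>2"
    by (intro tendsto_lowerbound[where F = "at_right 0"]) (auto simp: trivial_limit_at_right_real)
  moreover have "Re (cinner (defect w f x) x) = p 0 - (norm (T w f x))\<^sup>2"
    using w f by (simp add: defect_form p_def T_0)
  moreover have "Re (cinner (T (w / 2) (defect (w / 2) f) x) x) = p 0 - p (w / 2)"
    using w f by (simp add: defect_def T_diff T_M M_abs_sq T_semigroup p_def T_0 blinfun.diff_left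
        cinner_diff_left)
  ultimately show ?thesis by simp
qed

text \<open>With \<open>s = w/2\<close> and \<open>t = u - w/2\<close>, the condition \<open>u \<ge> 3w/4\<close> means \<open>s \<le> 2 t\<close>, so that
  \<open>T\<^sub>s D\<^sub>s \<le> (s/t)\<^sup>\<beta> T\<^sub>t D\<^sub>s \<le> 2\<^sup>\<beta> D\<^sub>u\<close> for the defect \<open>D\<close> of \<open>f\<close>.\<close>

lemma defect_mono_quasi_decreasing:
  assumes quasi: "quasi_decreasing M T" and \<Gamma>: "Gamma2_nonneg M T"
  shows "\<exists>C>0. \<forall>f\<in>M. \<forall>w>0. \<forall>u. 3 / 4 * w \<le> u \<and> u < w \<longrightarrow>
    (\<forall>x. Re (cinner (defect w f x) x) \<le> C * Re (cinner (defect u f x) x))"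
proof -
  obtain \<beta> where \<beta>: "\<beta> \<ge> 0" "\<And>g s t. g \<in> M \<Longrightarrow> positive_op g \<Longrightarrow> t < s \<Longrightarrow> 0 < t \<Longrightarrow>
      (1 / s powr \<beta>) *\<^sub>R T s g \<preceq> (1 / t powr \<beta>) *\<^sub>R T t g"
    using quasi unfolding quasi_decreasing_def by blast
  have "Re (cinner (defect w f x) x) \<le> (2 * 2 powr \<beta>) * Re (cinner (defect u f x) x)"
    if f: "f \<in> M" and w: "w > 0" and u: "3 / 4 * w \<le> u" "u < w" for f w u x
  proof -
    define s where "s = w / 2"
    define t where "t = u - w / 2"
    have st: "0 < t" "t < s" "s \<le> 2 * t"
      using w u by (auto simp: s_def t_def)
    define g where "g = defect s f"
    have g: "g \<in> M" "positive_op g"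
      using st f by (auto simp: g_def defect_M defect_positive)
    let ?q = "\<lambda>r. Re (cinner (T r g x) x)"
    have "?q s / s powr \<beta> \<le> ?q t / t powr \<beta>"
      using le_op_form[OF \<beta>(2)[OF g st(2,1)], of x]
      by (simp add: blinfun.scaleR_left cinner_scaleR_left)
    then have "?q s \<le> ?q t / t powr \<beta> * s powr \<beta>"
      using st by (simp add: pos_divide_le_eq)
    also have "\<dots> \<le> ?q t / t powr \<beta> * (2 * t) powr \<beta>"
      using st g \<beta>(1)
      by (intro mult_left_mono powr_mono2 divide_nonneg_nonneg positive_op_Re T_positive) auto
    also have "\<dots> = 2 powr \<beta> * ?q t"
      using st by (simp add: powr_mult)
    also have "\<dots> \<le> 2 powr \<beta> * Re (cinner (defect (t + s) f x) x)"
      unfolding g_def using st f by (intro mult_left_mono T_defect_form_le) auto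
    also have "t + s = u"
      by (simp add: s_def t_def)
    finally show ?thesis
      using defect_half[OF \<Gamma> f w, of x] by (simp add: g_def s_def)
  qed
  then show ?thesis
    by (intro exI[of _ "2 * 2 powr \<beta>"]) auto
qed

lemma defect_comparison:
  assumes quasi: "quasi_monotone M T" and \<Gamma>: "Gamma2_nonneg M T"
  shows "\<exists>a b C. 0 < a \<and> a < b \<and> C > 0 \<and> (\<forall>f\<in>M. \<forall>w>0. \<forall>v\<in>{a..b}. \<forall>x.
    Re (cinner (defect w f x) x) \<le> C * Re (cinner (defect (w * v) f x) x))"
  using quasi unfolding quasi_monotone_def
proof
  assume "quasi_decreasing M T"
  from defect_mono_quasi_decreasing[OF this \<Gamma>] obtain C where C: "C > 0"
    "\<And>f w u x. f \<in> M \<Longrightarrow> w > 0 \<Longrightarrow> 3 / 4 * w \<le> u \<Longrightarrow> u < w \<Longrightarrow>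
      Re (cinner (defect w f x) x) \<le> C * Re (cinner (defect u f x) x)"
    by blast
  have "Re (cinner (defect w f x) x) \<le> C * Re (cinner (defect (w * v) f x) x)"
    if "f \<in> M" "w > 0" "v \<in> {3 / 4..7 / 8}" for f w v x
    using that by (intro C) auto
  then show ?thesis
    using C(1) by (intro exI[of _ "3 / 4"] exI[of _ "7 / 8"] exI[of _ C]) auto
next
  assume "quasi_increasing M T"
  then have "Re (cinner (defect w f x) x) \<le> 1 * Re (cinner (defect (w * v) f x) x)"
    if "f \<in> M" "w > 0" "v \<in> {2..3}" for f w v x
    using defect_mono_quasi_increasing[of f w "w * v" x] that by simp
  then show ?thesis
    by (intro exI[of _ 2] exI[of _ 3] exI[of _ 1]) auto
qed

text \<open>By convexity of \<open>g \<mapsto> |g|\<^sup>2\<close>, averaging the orbit over the probability density \<open>\<kappa>\<close> only increases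
  the defect.\<close>

lemma poisson_defect_ge:
  assumes f: "f \<in> M" and t: "t > 0"
  shows "integrable halfline (\<lambda>v. \<kappa> v * Re (cinner (defect (t\<^sup>2 * v) f x) x))"
    and "(LINT v|halfline. \<kappa> v * Re (cinner (defect (t\<^sup>2 * v) f x) x))
      \<le> Re (cinner ((poisson M T t (abs_sq f) - abs_sq (poisson M T t f)) x) x)"
proof -
  let ?P = "poisson M T t"
  define N where "N v = (norm (T (t\<^sup>2 * v) f x))\<^sup>2" for v
  define y where "y = ?P f x"
  have \<kappa>1: "integrable halfline \<kappa>" "(LINT v|halfline. \<kappa> v) = 1"
    using has_bochner_integral_kernel by (auto simp: has_bochner_integral_iff)
  have N: "integrable halfline (\<lambda>v. \<kappa> v * N v)"
    unfolding integrable_halfline_iff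
  proof (rule set_integrable_halfline_bound)
    have "continuous_on {0<..} (\<lambda>v. T (t\<^sup>2 * v) f)"
      by (intro continuous_on_compose2[OF orbit_continuous[OF f]] continuous_intros) (use t in auto)
    then show "continuous_on {0<..} (\<lambda>v. \<kappa> v * N v)"
      unfolding N_def by (intro continuous_intros continuous_on_poisson_kernel)
    show "set_integrable lborel {0<..} (\<lambda>v. \<kappa> v * (norm f * norm x)\<^sup>2)"
      using poisson_kernel_integrable by simp
    fix v :: real
    assume "v > 0"
    have "norm (T (t\<^sup>2 * v) f x) \<le> norm (T (t\<^sup>2 * v) f) * norm x"
      by (rule norm_blinfun)
    also have "\<dots> \<le> norm f * norm x"
      using \<open>v > 0\<close> by (intro mult_right_mono T_contraction f) auto
    finally show "norm (\<kappa> v * N v) \<le> \<kappa> v * (norm f * norm x)\<^sup>2"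
      by (simp add: N_def abs_mult poisson_kernel_nonneg mult_left_mono power_mono)
  qed
  have Pf: "has_bochner_integral halfline (\<lambda>v. \<kappa> v * Re (cinner (T (t\<^sup>2 * v) f x) y)) ((norm y)\<^sup>2)"
    using poisson_form[OF f t, of x y] by (simp add: y_def Re_cinner_self)
  \<comment> \<open>\<open>\<parallel>y\<parallel>\<^sup>2\<close> is the average of \<open>Re \<langle>T f x, y\<rangle> \<le> \<parallel>T f x\<parallel>\<^sup>2 / 2 + \<parallel>y\<parallel>\<^sup>2 / 2\<close>; this is Jensen's inequality\<close>
  have "(norm y)\<^sup>2 = (LINT v|halfline. \<kappa> v * Re (cinner (T (t\<^sup>2 * v) f x) y))"
    using Pf by (simp add: has_bochner_integral_iff)
  also have "\<dots> \<le> (LINT v|halfline. (1 / 2) * (\<kappa> v * N v) + (1 / 2) * (\<kappa> v * (norm y)\<^sup>2))"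
  proof (rule integral_mono)
    show "integrable halfline (\<lambda>v. \<kappa> v * Re (cinner (T (t\<^sup>2 * v) f x) y))"
      using Pf by (simp add: has_bochner_integral_iff)
    show "integrable halfline (\<lambda>v. (1 / 2) * (\<kappa> v * N v) + (1 / 2) * (\<kappa> v * (norm y)\<^sup>2))"
      by (intro Bochner_Integration.integrable_add integrable_mult_right integrable_mult_left N \<kappa>1)
    fix v
    have "0 \<le> (norm (T (t\<^sup>2 * v) f x - y))\<^sup>2" by simp
    then have "Re (cinner (T (t\<^sup>2 * v) f x) y) \<le> (1 / 2) * N v + (1 / 2) * (norm y)\<^sup>2"
      unfolding norm_diff_sq N_def by simp
    then have "\<kappa> v * Re (cinner (T (t\<^sup>2 * v) f x) y) \<le> \<kappa> v * ((1 / 2) * N v + (1 / 2) * (norm y)\<^sup>2)"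
      by (intro mult_left_mono poisson_kernel_nonneg) simp_all
    then show "\<kappa> v * Re (cinner (T (t\<^sup>2 * v) f x) y) \<le> (1 / 2) * (\<kappa> v * N v) + (1 / 2) * (\<kappa> v * (norm y)\<^sup>2)"
      by (simp add: algebra_simps)
  qed
  also have "\<dots> = (1 / 2) * (LINT v|halfline. \<kappa> v * N v) + (1 / 2) * (norm y)\<^sup>2"
    using N \<kappa>1 by simp
  finally have y_le: "(norm y)\<^sup>2 \<le> (LINT v|halfline. \<kappa> v * N v)" by simp
  have Psq: "has_bochner_integral halfline (\<lambda>v. \<kappa> v * Re (cinner (T (t\<^sup>2 * v) (abs_sq f) x) x))
      (Re (cinner (?P (abs_sq f) x) x))"
    by (rule poisson_form[OF M_abs_sq[OF f] t])
  have D: "has_bochner_integral halfline (\<lambda>v. \<kappa> v * Re (cinner (T (t\<^sup>2 * v) (abs_sq f) x) x) - \<kappa> v * N v)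
      (Re (cinner (?P (abs_sq f) x) x) - (LINT v|halfline. \<kappa> v * N v))"
    by (intro has_bochner_integral_diff Psq has_bochner_integral_integrable N)
  have "has_bochner_integral halfline (\<lambda>v. \<kappa> v * Re (cinner (defect (t\<^sup>2 * v) f x) x))
      (Re (cinner (?P (abs_sq f) x) x) - (LINT v|halfline. \<kappa> v * N v))"
    by (rule has_bochner_integral_cong[THEN iffD1, OF refl _ refl D])
      (simp add: space_restrict_space defect_form f N_def right_diff_distrib)
  moreover have "Re (cinner ((?P (abs_sq f) - abs_sq (?P f)) x) x) = Re (cinner (?P (abs_sq f) x) x) - (norm y)\<^sup>2"
    using poisson_M[of t f] t f
    by (simp add: blinfun.diff_left cinner_diff_left cinner_abs_sq M_bounded_ops Re_cinner_self y_def)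
  ultimately show "integrable halfline (\<lambda>v. \<kappa> v * Re (cinner (defect (t\<^sup>2 * v) f x) x))"
    "(LINT v|halfline. \<kappa> v * Re (cinner (defect (t\<^sup>2 * v) f x) x))
      \<le> Re (cinner ((?P (abs_sq f) - abs_sq (?P f)) x) x)"
    using y_le by (auto simp: has_bochner_integral_iff)
qed

text \<open>The average of the defects over \<open>v \<in> [a, b]\<close> alone is at least a multiple of the defect at time \<open>t\<^sup>2\<close>.\<close>

theorem poisson_lc_bound:
  assumes quasi: "quasi_monotone M T" and \<Gamma>: "Gamma2_nonneg M T"
  shows "\<exists>C>0. \<forall>f\<in>M. \<forall>t>0. norm (T (t\<^sup>2) (abs_sq f) - abs_sq (T (t\<^sup>2) f))
    \<le> C * norm (poisson M T t (abs_sq f) - abs_sq (poisson M T t f))"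
proof -
  obtain a b C where ab: "0 < a" "a < b" and C: "C > 0"
    and cmp: "\<And>f w v x. f \<in> M \<Longrightarrow> w > 0 \<Longrightarrow> v \<in> {a..b} \<Longrightarrow>
      Re (cinner (defect w f x) x) \<le> C * Re (cinner (defect (w * v) f x) x)"
    using defect_comparison[OF assms] by blast
  \<comment> \<open>a lower bound of \<open>\<kappa>\<close> on \<open>[a, b]\<close>: the exponential is least at \<open>a\<close>, the power at \<open>b\<close>\<close>
  define c where "c = 1 / (2 * sqrt pi) * (exp (- 1 / (4 * a)) * b powr (- 3 / 2))"
  have c: "c > 0"
    using ab by (simp add: c_def)
  have c_le: "c \<le> \<kappa> v" if "v \<in> {a..b}" for v
  proof -
    have "exp (- 1 / (4 * a)) * b powr (- 3 / 2) \<le> exp (- 1 / (4 * v)) * v powr (- 3 / 2)"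
      using that ab by (intro mult_mono powr_mono2') (auto simp: frac_le)
    then show ?thesis
      by (simp add: c_def poisson_kernel_def divide_right_mono)
  qed
  define C' where "C' = C / (c * (b - a))"
  have C': "C' > 0"
    using C c ab by (simp add: C'_def)
  have "norm (T (t\<^sup>2) (abs_sq f) - abs_sq (T (t\<^sup>2) f))
      \<le> C' * norm (poisson M T t (abs_sq f) - abs_sq (poisson M T t f))"
    if f: "f \<in> M" and t: "t > 0" for f t
  proof -
    let ?G = "poisson M T t (abs_sq f) - abs_sq (poisson M T t f)"
    have "norm (defect (t\<^sup>2) f) \<le> C' * norm ?G"
    proof (rule norm_positive_op_le)
      show "defect (t\<^sup>2) f \<in> bounded_ops" "positive_op (defect (t\<^sup>2) f)"
        by (auto intro!: M_bounded_ops defect_M defect_positive f)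
      show "0 \<le> C' * norm ?G"
        using C' by simp
      fix x
      define d where "d = Re (cinner (defect (t\<^sup>2) f x) x)"
      have ind: "has_bochner_integral halfline (\<lambda>v. indicator {a..b} v * (c * d)) ((b - a) * (c * d))"
      proof (intro has_bochner_integral_mult_left)
        have "has_bochner_integral lborel (indicator {a..b}) (b - a)"
          using ab has_bochner_integral_real_indicator[of "{a..b}" lborel] by simp
        then show "has_bochner_integral halfline (indicator {a..b}) (b - a)"
          by (subst has_bochner_integral_restrict_space)
            (use ab in \<open>auto simp: indicator_def elim!: has_bochner_integral_cong[THEN iffD1, rotated -1]\<close>)
      qed
      have "(b - a) * (c * d) = (LINT v|halfline. indicator {a..b} v * (c * d))"
        using ind by (simp only: has_bochner_integral_iff)
      also have "\<dots> \<le> (LINT v|halfline. C * (\<kappa> v * Re (cinner (defect (t\<^sup>2 * v) f x) x)))"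
      proof (rule integral_mono)
        show "integrable halfline (\<lambda>v. indicator {a..b} v * (c * d))"
          using ind by (simp only: has_bochner_integral_iff)
        show "integrable halfline (\<lambda>v. C * (\<kappa> v * Re (cinner (defect (t\<^sup>2 * v) f x) x)))"
          by (intro integrable_mult_right poisson_defect_ge f t)
        fix v
        assume "v \<in> space halfline"
        then have v: "v > 0" by (simp add: space_restrict_space)
        have pos: "Re (cinner (defect (t\<^sup>2 * v) f x) x) \<ge> 0" "d \<ge> 0"
          unfolding d_def using v by (auto intro!: positive_op_Re defect_positive f)
        show "indicator {a..b} v * (c * d) \<le> C * (\<kappa> v * Re (cinner (defect (t\<^sup>2 * v) f x) x))"
        proof (cases "v \<in> {a..b}")
          case True
          have "c * d \<le> \<kappa> v * (C * Re (cinner (defect (t\<^sup>2 * v) f x) x))"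
            using True pos c t unfolding d_def
            by (intro mult_mono c_le cmp f poisson_kernel_nonneg) auto
          with True show ?thesis by (simp add: mult_ac)
        next
          case False
          then show ?thesis
            using pos C by (simp add: poisson_kernel_nonneg)
        qed
      qed
      also have "\<dots> = C * (LINT v|halfline. \<kappa> v * Re (cinner (defect (t\<^sup>2 * v) f x) x))"
        by (rule Bochner_Integration.integral_mult_right) (rule poisson_defect_ge(1)[OF f t])
      also have "\<dots> \<le> C * Re (cinner (?G x) x)"
        using C by (intro mult_left_mono poisson_defect_ge f t) auto
      also have "Re (cinner (?G x) x) \<le> norm (?G x) * norm x"
        by (rule Re_cinner_le)
      also have "norm (?G x) * norm x \<le> norm ?G * norm x * norm x"
        by (intro mult_right_mono norm_blinfun) simp
      finally have "(b - a) * (c * d) \<le> C * (norm ?G * norm x * norm x)"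
        using C by simp
      then have "d \<le> C * (norm ?G * norm x * norm x) / (c * (b - a))"
        using ab c by (simp add: pos_le_divide_eq mult_ac)
      then show "Re (cinner (defect (t\<^sup>2) f x) x) \<le> C' * norm ?G * (norm x)\<^sup>2"
        by (simp add: d_def C'_def power2_eq_square mult_ac)
    qed
    then show ?thesis by (simp add: defect_def)
  qed
  with C' show ?thesis by blast
qed

end

section \<open>Comparison of the Lipschitz norms\<close>

text \<open>The constant \<open>C \<ge> 1\<close> also absorbs the summand \<open>\<parallel>f\<parallel>\<close>, and nothing is to be shown when the right-hand
  supremum is infinite.\<close>

lemma lipschitz_norm_le:
  fixes p q :: "real \<Rightarrow> real"
  assumes C: "1 \<le> C" "c \<le> C"
    and step: "\<And>K t. K \<ge> 0 \<Longrightarrow> (\<And>t. t > 0 \<Longrightarrow> p t \<le> K) \<Longrightarrow> t > 0 \<Longrightarrow> q t \<le> c * K"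
  shows "ennreal n + (SUP t\<in>{0<..}. ennreal (q t))
    \<le> ennreal C * (ennreal n + (SUP t\<in>{0<..}. ennreal (p t)))"
proof (cases "(SUP t\<in>{0<..}. ennreal (p t)) = top")
  case True
  then show ?thesis
    unfolding True using C by (simp add: ennreal_mult_top)
next
  case False
  then obtain K where K: "K \<ge> 0" "(SUP t\<in>{0<..}. ennreal (p t)) = ennreal K"
    by (cases "SUP t\<in>{0<..}. ennreal (p t)") auto
  have "p t \<le> K" if "t > 0" for t
  proof -
    have "ennreal (p t) \<le> (SUP t\<in>{0<..}. ennreal (p t))"
      using that by (intro SUP_upper) simp
    then show ?thesis
      using K by (simp add: ennreal_le_iff)
  qed
  then have "q t \<le> C * K" if "t > 0" for t
    using step[OF K(1) _ that] C(2) K(1) by (meson mult_right_mono order_trans)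
  then have "(SUP t\<in>{0<..}. ennreal (q t)) \<le> ennreal (C * K)"
    by (intro SUP_least ennreal_leI) simp
  also have "\<dots> = ennreal C * ennreal K"
    using C K by (simp add: ennreal_mult)
  finally have "(SUP t\<in>{0<..}. ennreal (q t)) \<le> ennreal C * ennreal K" .
  moreover have "ennreal n \<le> ennreal C * ennreal n"
    using mult_right_mono[of 1 "ennreal C" "ennreal n"] C by simp
  ultimately show ?thesis
    unfolding K(2) distrib_left by (intro add_mono)
qed

context quantum_markov
begin

lemma defect_lipschitz_le:
  assumes quasi: "quasi_monotone M T" and \<Gamma>: "Gamma2_nonneg M T"
  shows "\<exists>c. \<forall>f\<in>M. \<forall>K. (\<forall>t>0. 1 / t powr \<alpha> * sqrt (norm (poisson M T t (abs_sq f) - abs_sq (poisson M T t f))) \<le> K)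
    \<longrightarrow> (\<forall>t>0. 1 / t powr (\<alpha> / 2) * sqrt (norm (T t (abs_sq f) - abs_sq (T t f))) \<le> c * K)"
proof -
  obtain C where C: "C > 0" "\<And>f t. f \<in> M \<Longrightarrow> t > 0 \<Longrightarrow> norm (T (t\<^sup>2) (abs_sq f) - abs_sq (T (t\<^sup>2) f))
      \<le> C * norm (poisson M T t (abs_sq f) - abs_sq (poisson M T t f))"
    using poisson_lc_bound[OF assms] by blast
  have "1 / t powr (\<alpha> / 2) * sqrt (norm (T t (abs_sq f) - abs_sq (T t f))) \<le> sqrt C * K"
    if f: "f \<in> M" and t: "t > 0"
      and K: "\<And>t. t > 0 \<Longrightarrow> 1 / t powr \<alpha> * sqrt (norm (poisson M T t (abs_sq f) - abs_sq (poisson M T t f))) \<le> K"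
    for f t K
  proof -
    define s where "s = sqrt t"
    have s: "s > 0" "t = s\<^sup>2"
      using t by (auto simp: s_def)
    let ?P = "norm (poisson M T s (abs_sq f) - abs_sq (poisson M T s f))"
    have "t powr (\<alpha> / 2) = s powr \<alpha>"
      using s by (simp add: powr_powr flip: powr_numeral)
    moreover have "sqrt (norm (T t (abs_sq f) - abs_sq (T t f))) \<le> sqrt (C * ?P)"
      unfolding s(2) by (intro real_sqrt_le_mono C f s)
    ultimately have "1 / t powr (\<alpha> / 2) * sqrt (norm (T t (abs_sq f) - abs_sq (T t f)))
        \<le> 1 / s powr \<alpha> * (sqrt C * sqrt ?P)"
      by (simp add: real_sqrt_mult divide_right_mono)
    also have "\<dots> = sqrt C * (1 / s powr \<alpha> * sqrt ?P)"
      by simp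
    also have "\<dots> \<le> sqrt C * K"
      using C(1) by (intro mult_left_mono K s) simp
    finally show ?thesis .
  qed
  then show ?thesis by blast
qed

end

theorem theorem1p4:
  fixes M :: "'h::chilbert_space oper set"
    and \<tau> :: "'h oper \<Rightarrow> complex"
    and T :: "real \<Rightarrow> 'h oper \<Rightarrow> 'h oper"
    and \<alpha> :: real
  assumes vn: "von_neumann_algebra M"
    and trace: "normal_faithful_finite_trace M \<tau>"
    and markov: "markov_semigroup M \<tau> T"
    and dom: "\<And>s f. s > 0 \<Longrightarrow> f \<in> M \<Longrightarrow> T s f \<in> dom_inf M T"
    and quasi: "quasi_monotone M T"
    and alpha: "0 < \<alpha>" "\<alpha> < 1"
  shows "\<exists>C>0. \<forall>f\<in>M.
    norm_Lc \<alpha> (poisson M T) f \<le> ennreal C * norm_Lc (\<alpha> / 2) T f \<and>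
    norm_Lambda M \<alpha> (poisson M T) f \<le> ennreal C * norm_Lambda M (\<alpha> / 2) T f \<and>
    (Gamma2_nonneg M T \<longrightarrow>
      norm_lc (\<alpha> / 2) T f \<le> ennreal C * norm_lc \<alpha> (poisson M T) f)"
proof -
  interpret quantum_markov M \<tau> T
    by unfold_locales (fact vn, fact markov, fact dom)
  define c1 where "c1 = (2 powr (- (\<alpha> / 2)) / (1 - 2 powr (- (\<alpha> / 2)))) * kernel_moment (\<alpha> / 2)"
  define c2 where "c2 = 2 * kernel_moment (\<alpha> / 2)"
  \<comment> \<open>a single constant has to serve all three estimates, whether or not \<open>\<Gamma>\<^sup>2 \<ge> 0\<close> holds\<close>
  have "\<exists>c. Gamma2_nonneg M T \<longrightarrow> (\<forall>f\<in>M. \<forall>K.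
      (\<forall>t>0. 1 / t powr \<alpha> * sqrt (norm (poisson M T t (abs_sq f) - abs_sq (poisson M T t f))) \<le> K)
    \<longrightarrow> (\<forall>t>0. 1 / t powr (\<alpha> / 2) * sqrt (norm (T t (abs_sq f) - abs_sq (T t f))) \<le> c * K))"
    using defect_lipschitz_le[OF quasi] by blast
  then obtain c3 where c3: "\<And>f K t. Gamma2_nonneg M T \<Longrightarrow> f \<in> M \<Longrightarrow>
      (\<And>t. t > 0 \<Longrightarrow> 1 / t powr \<alpha> * sqrt (norm (poisson M T t (abs_sq f) - abs_sq (poisson M T t f))) \<le> K)
    \<Longrightarrow> t > 0 \<Longrightarrow> 1 / t powr (\<alpha> / 2) * sqrt (norm (T t (abs_sq f) - abs_sq (T t f))) \<le> c3 * K"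
    by blast
  define C where "C = max 1 (max c1 (max c2 c3))"
  have C: "1 \<le> C" "c1 \<le> C" "c2 \<le> C" "c3 \<le> C"
    by (auto simp: C_def)
  show ?thesis
  proof (intro exI[of _ C] conjI ballI impI)
    show "0 < C" using C(1) by simp
    fix f
    assume f: "f \<in> M"
    show "norm_Lc \<alpha> (poisson M T) f \<le> ennreal C * norm_Lc (\<alpha> / 2) T f"
      unfolding norm_Lc_def c1_def
      by (rule lipschitz_norm_le[OF C(1,2)[unfolded c1_def]], rule poisson_Lc_bound[OF f alpha])
    show "norm_Lambda M \<alpha> (poisson M T) f \<le> ennreal C * norm_Lambda M (\<alpha> / 2) T f"
      unfolding norm_Lambda_def
      by (rule lipschitz_norm_le[OF C(1,3)[unfolded c2_def]], rule poisson_Lambda_bound[OF f alpha])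
    show "norm_lc (\<alpha> / 2) T f \<le> ennreal C * norm_lc \<alpha> (poisson M T) f" if "Gamma2_nonneg M T"
      unfolding norm_lc_def
      by (rule lipschitz_norm_le[OF C(1,4)], rule c3[OF that f])
  qed
qed

end
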